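(* Let $\lambda,\mu,\nu\vdash n$ and let $i,j,k$ be parts of $\lambda,\mu,\nu$ respectively. Define coefficients $c^{\nu,k}_{\lambda,i,\mu,j}$ by $K_{\lambda,i}K_{\mu,j}=\sum_{\nu\vdash n,\,k\in\nu} c^{\nu,k}_{\lambda,i,\mu,j}K_{\nu,k}$. Then \[ c^{\nu,k}_{\lambda,i,\mu,j} = \frac{|\mathcal{C}_{\lambda,i}|\,|\mathcal{C}_{\mu,j}|}{n!}\sum_{\substack{\rho\vdash n\\ \ell\in\rho}} \frac{\gamma^{\rho,\ell}_{\lambda,i}\,\gamma^{\rho,\ell}_{\mu,j}\,\gamma^{\rho,\ell}_{\nu,k}}{d_{\ell_-(\rho)}}\cdot\frac{d_\rho}{d_{\ell_-(\rho)}}. \]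
   Context: $\mathfrak{S}_n$ is the symmetric group on $\{1,\dots,n\}$, $\mathbb{C}[\mathfrak{S}_n]$ its group algebra, and $Z_1(n)$ the set of elements commuting with every element of the subgroup $\mathfrak{S}_{n-1}$ fixing $n$. For $\lambda\vdash n$ and a part $i$ of $\lambda$, $\mathcal{C}_{\lambda,i}$ is the set of permutations of cycle type $\lambda$ in which $n$ lies on a cycle of length $i$, and $K_{\lambda,i}$ is the sum of its elements; these (over $\lambda\vdash n$ and distinct parts $i$) form a basis of $Z_1(n)$, and sums "$i\in\lambda$" range over distinct parts. $[K_{\lambda,i}]g$ is the coefficient of $K_{\lambda,i}$ in $g$. $d_\rho$ is the number of standard Young tableaux of shape $\rho$; $\ell_-(\rho)$ is obtained from $\rho$ by replacing one part $\ell$ by $\ell-1$ (deleting it if $\ell=1$). $e_T$ is Young's seminormal unit of a standard Young tableau $T$; $\mathrm{SYT}_{\rho,\ell}$ is the set of standard Young tableaux of shape $\rho$ with $n$ at the end of a row of length $\ell$; $\Gamma^{\rho,\ell}=\sum_{T\in\mathrm{SYT}_{\rho,\ell}}e_T\in Z_1(n)$. Generalized characters: $\gamma^{\rho,\ell}_{\lambda,i}:=\frac{n!}{d_\rho}[K_{\lambda,i}]\Gamma^{\rho,\ell}$. *)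

theory Defs
  imports
    "HOL-Combinatorics.Permutations"
    "HOL-Combinatorics.Orbits"
    "HOL-Library.Multiset"
    Complex_Main
begin

section \<open>Partitions\<close>

definition is_partition :: "nat \<Rightarrow> nat multiset \<Rightarrow> bool" where
  "is_partition n lam \<longleftrightarrow> sum_mset lam = n \<and> 0 \<notin># lam"

text \<open>Pairs of a partition and one of its \<^emph>\<open>distinct\<close> parts.\<close>

definition marked_partitions :: "nat \<Rightarrow> (nat multiset \<times> nat) set" where
  "marked_partitions n = {(lam, i). is_partition n lam \<and> i \<in># lam}"

definition dec_part :: "nat \<Rightarrow> nat multiset \<Rightarrow> nat multiset" where
  "dec_part l \<rho> = (\<rho> - {#l#}) + (if l = 1 then {#} else {#l - 1#})"


section \<open>The group algebra of the symmetric group\<close>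

text \<open>An element of the group algebra is the function giving its coefficients. Permutations of
  \<open>{1..n}\<close> are maps on \<open>nat\<close> that fix every other number, so that the symmetric group
  on \<open>{1..n}\<close> is literally a subset of the one on \<open>{1..Suc n}\<close>, and an element of the smaller
  group algebra is at the same time an element of the larger one.\<close>

type_synonym galg = "(nat \<Rightarrow> nat) \<Rightarrow> complex"

definition Sym :: "nat \<Rightarrow> (nat \<Rightarrow> nat) set" where
  "Sym n = {p. p permutes {1..n}}"

definition galg_one :: galg where
  "galg_one = (\<lambda>p. if p = id then 1 else 0)"

definition galg_mult :: "nat \<Rightarrow> galg \<Rightarrow> galg \<Rightarrow> galg" where
  "galg_mult n f g = (\<lambda>s. \<Sum>(p, q) \<in> {(p, q). p \<in> Sym n \<and> q \<in> Sym n \<and> p \<circ> q = s}. f p * g q)"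

definition galg_scale :: "complex \<Rightarrow> galg \<Rightarrow> galg" where
  "galg_scale a f = (\<lambda>p. a * f p)"

definition galg_sum :: "('i \<Rightarrow> galg) \<Rightarrow> 'i set \<Rightarrow> galg" where
  "galg_sum f I = (\<lambda>p. \<Sum>i\<in>I. f i p)"


section \<open>Near-central classes\<close>

definition cycle_type :: "nat \<Rightarrow> (nat \<Rightarrow> nat) \<Rightarrow> nat multiset" where
  "cycle_type n p = image_mset card (mset_set (orbit p ` {1..n}))"

definition near_class :: "nat \<Rightarrow> nat multiset \<Rightarrow> nat \<Rightarrow> (nat \<Rightarrow> nat) set" where
  "near_class n lam i = {p \<in> Sym n. cycle_type n p = lam \<and> card (orbit p n) = i}"

definition K_elem :: "nat \<Rightarrow> nat multiset \<Rightarrow> nat \<Rightarrow> galg" where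
  "K_elem n lam i = (\<lambda>p. if p \<in> near_class n lam i then 1 else 0)"

definition K_comb :: "nat \<Rightarrow> (nat multiset \<Rightarrow> nat \<Rightarrow> complex) \<Rightarrow> galg" where
  "K_comb n c = galg_sum (\<lambda>(\<nu>, k). galg_scale (c \<nu> k) (K_elem n \<nu> k)) (marked_partitions n)"

text \<open>The coefficient of a basis element \<open>K_elem n \<nu> k\<close> in \<open>g\<close>. The first condition only fixes
  the irrelevant values of the coefficient function off the index set.\<close>

definition K_coeff :: "nat \<Rightarrow> galg \<Rightarrow> nat multiset \<Rightarrow> nat \<Rightarrow> complex" where
  "K_coeff n g =
     (THE c. (\<forall>\<nu> k. (\<nu>, k) \<notin> marked_partitions n \<longrightarrow> c \<nu> k = 0) \<and> g = K_comb n c)"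

definition conn_coeff ::
  "nat \<Rightarrow> nat multiset \<Rightarrow> nat \<Rightarrow> nat multiset \<Rightarrow> nat \<Rightarrow> nat multiset \<Rightarrow> nat \<Rightarrow> complex" where
  "conn_coeff n lam i \<mu> j \<nu> k = K_coeff n (galg_mult n (K_elem n lam i) (K_elem n \<mu> j)) \<nu> k"


section \<open>Standard Young tableaux\<close>

text \<open>A tableau is the list of its rows, from the longest to the shortest.\<close>

type_synonym tableau = "nat list list"

definition SYT :: "nat multiset \<Rightarrow> tableau set" where
  "SYT \<rho> = {T. map length T = rev (sorted_list_of_multiset \<rho>)
     \<and> distinct (concat T) \<and> set (concat T) = {1..sum_mset \<rho>}
     \<and> (\<forall>r < length T. \<forall>c. Suc c < length (T ! r) \<longrightarrow> T ! r ! c < T ! r ! Suc c)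
     \<and> (\<forall>r. Suc r < length T \<longrightarrow> (\<forall>c < length (T ! Suc r). T ! r ! c < T ! Suc r ! c))}"

definition SYT_end :: "nat \<Rightarrow> nat multiset \<Rightarrow> nat \<Rightarrow> tableau set" where
  "SYT_end n \<rho> l = {T \<in> SYT \<rho>. \<exists>row \<in> set T. length row = l \<and> last row = n}"

definition num_SYT :: "nat multiset \<Rightarrow> nat" where
  "num_SYT \<rho> = card (SYT \<rho>)"

definition shape :: "tableau \<Rightarrow> nat multiset" where
  "shape T = mset (map length T)"

definition remove_entry :: "nat \<Rightarrow> tableau \<Rightarrow> tableau" where
  "remove_entry n T = filter (\<lambda>row. row \<noteq> []) (map (filter (\<lambda>x. x \<noteq> n)) T)"

definition column :: "tableau \<Rightarrow> nat \<Rightarrow> nat set" where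
  "column T c = {row ! c | row. row \<in> set T \<and> c < length row}"

definition row_stab :: "nat \<Rightarrow> tableau \<Rightarrow> (nat \<Rightarrow> nat) set" where
  "row_stab n T = {p \<in> Sym n. \<forall>row \<in> set T. p ` set row = set row}"

definition col_stab :: "nat \<Rightarrow> tableau \<Rightarrow> (nat \<Rightarrow> nat) set" where
  "col_stab n T = {p \<in> Sym n. \<forall>c. p ` column T c = column T c}"

text \<open>The Young symmetrizer: row symmetrizer times column antisymmetrizer.\<close>

definition young_symmetrizer :: "nat \<Rightarrow> tableau \<Rightarrow> galg" where
  "young_symmetrizer n T =
     galg_mult n (\<lambda>p. if p \<in> row_stab n T then 1 else 0)
                 (\<lambda>q. if q \<in> col_stab n T then of_int (sign q) else 0)"

text \<open>Young's seminormal unit of a standard tableau \<open>T\<close> with \<open>n\<close> boxes, by Young's recursion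
  \<open>e\<^sub>T = (d\<^sub>\<rho> / n!) e\<^sub>S E\<^sub>T e\<^sub>S\<close>, where \<open>\<rho>\<close> is the shape of \<open>T\<close>, \<open>E\<^sub>T\<close> its Young symmetrizer,
  and \<open>S\<close> is \<open>T\<close> with the box containing \<open>n\<close> removed. The value is \<open>1\<close> for at most one box.\<close>

fun seminormal_unit :: "nat \<Rightarrow> tableau \<Rightarrow> galg" where
  "seminormal_unit 0 T = galg_one"
| "seminormal_unit (Suc n) T =
     (let e = seminormal_unit n (remove_entry (Suc n) T)
      in galg_scale (of_nat (num_SYT (shape T)) / fact (Suc n))
           (galg_mult (Suc n) e (galg_mult (Suc n) (young_symmetrizer (Suc n) T) e)))"


section \<open>Generalized characters\<close>

definition Gamma_elem :: "nat \<Rightarrow> nat multiset \<Rightarrow> nat \<Rightarrow> galg" where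
  "Gamma_elem n \<rho> l = galg_sum (seminormal_unit n) (SYT_end n \<rho> l)"

definition gen_char :: "nat \<Rightarrow> nat multiset \<Rightarrow> nat \<Rightarrow> nat multiset \<Rightarrow> nat \<Rightarrow> complex" where
  "gen_char n \<rho> l lam i = fact n / of_nat (num_SYT \<rho>) * K_coeff n (Gamma_elem n \<rho> l) lam i"

end

theory Submission
  imports Defs "HOL-Library.Poly_Mapping" "HOL-Combinatorics.Cycles"
begin

text \<open>
  The sums \<open>\<Gamma>\<close> of seminormal units are orthogonal idempotents that span the centralizer \<open>Z\<^sub>1(n)\<close>, so
  multiplication by \<open>K\<^sub>\<lambda>\<^sub>,\<^sub>i\<close> scales each \<open>\<Gamma>\<close>. Comparing coefficients of the identity, where
  \<open>\<Gamma>\<close> has the value \<open>d\<^sub>\<rho> d\<^sub>\<sigma> / n!\<close> with \<open>\<sigma> = \<ell>\<^sub>-(\<rho>)\<close>, shows that the scalar is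
  \<open>|C\<^sub>\<lambda>\<^sub>,\<^sub>i| \<gamma>\<^sub>\<lambda>\<^sub>,\<^sub>i / d\<^sub>\<sigma>\<close>, and the formula is the expansion of \<open>K\<^sub>\<lambda>\<^sub>,\<^sub>i K\<^sub>\<mu>\<^sub>,\<^sub>j \<cdot> \<Sum> \<Gamma>\<close>.

  That the seminormal units are a complete set of orthogonal idempotents is shown by induction on
  \<open>n\<close>. For a Young symmetrizer \<open>E\<close> one has \<open>E x E = \<kappa> \<tau>(x E) E\<close> with \<open>\<kappa> \<noteq> 0\<close>, where \<open>\<tau>\<close> is the
  coefficient of the identity; hence \<open>\<kappa>\<^sup>-\<^sup>1 e\<^sub>S E\<^sub>T e\<^sub>S\<close> is idempotent. Tableaux \<open>T\<close>, \<open>T'\<close> extending the same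
  \<open>S\<close> differ in the sum of the column indices of their entries, which forces \<open>E\<^sub>T x E\<^sub>T\<^sub>' = 0\<close>. As
  \<open>\<Sum> d\<^sub>\<rho>\<^sup>2 = n!\<close>, nonzero elements of the spaces \<open>e\<^sub>T A e\<^sub>U\<close> with \<open>T\<close>, \<open>U\<close> of equal shape already form a basis
  of the group algebra \<open>A\<close>; the trace of right multiplication by \<open>e\<^sub>T\<close> in this basis gives \<open>\<kappa> = n! / d\<^sub>\<rho>\<close>.
\<close>

section \<open>Group algebras\<close>

text \<open>The factor d_rho / n! is part of the definition of a seminormal unit, whereas
  idempotency yields the factor 1 / kappa with kappa = tau(E E). Their equality is global
  information: the induction therefore treats all standard tableaux with n boxes at once, and the
  trace that identifies the constant is taken on the whole algebra. Nonvanishing must be secured at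
  each level. It rests on tau(e_T E_T) = 1, carried along as a second invariant; this passes to one
  more box because a Young symmetrizer has, on the smaller group, the coefficients of the
  symmetrizer of the smaller tableau. Conjugating E_T into E_U then shows e_T A e_U to be nonzero
  for equal shapes; that it is zero for different shapes falls out of the dimension count. The
  scalar by which the centralizer acts on e_T depends only on the shapes of T and of T without n:
  branching is multiplicity free, and the elements of the smaller algebra that link two such
  tableaux commute with the centralizer.\<close>

definition smult :: "complex \<Rightarrow> ('g::group_add \<Rightarrow>\<^sub>0 complex) \<Rightarrow> ('g \<Rightarrow>\<^sub>0 complex)" where
  "smult c x = Poly_Mapping.single 0 c * x"

abbreviation elt :: "'g::group_add \<Rightarrow> ('g \<Rightarrow>\<^sub>0 complex)" where
  "elt g \<equiv> Poly_Mapping.single g 1"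

definition tau :: "('g::group_add \<Rightarrow>\<^sub>0 complex) \<Rightarrow> complex" where
  "tau x = Poly_Mapping.lookup x 0"

text \<open>The convolution is a sum over one factor only, over any finite \<open>F\<close>
  containing its support, so that \<open>F\<close> can later be a support, a symmetric group or a
  row stabilizer.\<close>

lemma lookup_times:
  fixes x y :: "'g::group_add \<Rightarrow>\<^sub>0 complex"
  assumes "finite F" "Poly_Mapping.keys x \<subseteq> F"
  shows "Poly_Mapping.lookup (x * y) k = (\<Sum>g\<in>F. Poly_Mapping.lookup x g * Poly_Mapping.lookup y (- g + k))"
proof -
  have eq: "k = l + q \<longleftrightarrow> q = - l + k" for l q :: 'g
    by (metis add_minus_cancel minus_add_cancel)
  have "Poly_Mapping.lookup (x * y) k =
      (\<Sum>l. Poly_Mapping.lookup x l * Poly_Mapping.lookup y (- l + k))"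
    by (simp add: lookup_mult eq)
  also have "\<dots> = (\<Sum>g\<in>F. Poly_Mapping.lookup x g * Poly_Mapping.lookup y (- g + k))"
    using assms by (intro Sum_any.expand_superset) (auto simp: in_keys_iff)
  finally show ?thesis .
qed

lemma lookup_single_times:
  "Poly_Mapping.lookup (Poly_Mapping.single g c * (y :: 'g::group_add \<Rightarrow>\<^sub>0 complex)) k
     = c * Poly_Mapping.lookup y (- g + k)"
  by (subst lookup_times[of "{g}"]) (auto)

lemma lookup_smult [simp]: "Poly_Mapping.lookup (smult c x) g = c * Poly_Mapping.lookup x g"
  by (simp add: smult_def lookup_single_times)

lemma expand_sum:
  fixes x :: "'g::group_add \<Rightarrow>\<^sub>0 complex"
  assumes "finite F" "Poly_Mapping.keys x \<subseteq> F"
  shows "x = (\<Sum>g\<in>F. smult (Poly_Mapping.lookup x g) (elt g))"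
proof (rule poly_mapping_eqI)
  fix k
  show "Poly_Mapping.lookup x k = Poly_Mapping.lookup (\<Sum>g\<in>F. smult (Poly_Mapping.lookup x g) (elt g)) k"
    using assms by (auto simp: lookup_sum lookup_single when_def sum.delta in_keys_iff if_distrib cong: if_cong)
qed

lemma smult_left: "smult c x * y = smult c (x * y)"
  by (simp add: smult_def mult.assoc)

lemma elt_smult: "elt g * smult c y = smult c (elt g * y)"
  by (rule poly_mapping_eqI) (simp add: lookup_single_times)

lemma smult_add: "smult c (x + y) = smult c x + smult c y"
  by (simp add: smult_def distrib_left)

lemma smult_sum: "smult c (sum f A) = (\<Sum>a\<in>A. smult c (f a))"
  by (simp add: smult_def sum_distrib_left)

lemma smult_smult [simp]: "smult c (smult d x) = smult (c * d) x"
  by (rule poly_mapping_eqI) simp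

text \<open>\<open>smult\<close> is left multiplication by a multiple of the unit, so this is the
  side that needs an argument: scalars are moved past group elements one at a time.\<close>

lemma smult_right: "x * smult c y = smult c (x * y)"
proof -
  have "x * smult c y = (\<Sum>g\<in>Poly_Mapping.keys x. smult (Poly_Mapping.lookup x g) (elt g)) * smult c y"
    using expand_sum[of "Poly_Mapping.keys x" x] by simp
  also have "\<dots> = smult c ((\<Sum>g\<in>Poly_Mapping.keys x. smult (Poly_Mapping.lookup x g) (elt g)) * y)"
    by (simp add: sum_distrib_right smult_sum smult_left elt_smult mult.commute)
  also have "\<dots> = smult c (x * y)"
    using expand_sum[of "Poly_Mapping.keys x" x] by simp
  finally show ?thesis .
qed

lemmas smult_simps = smult_left smult_right smult_smult

lemma smult_one [simp]: "smult 1 x = x" and smult_zero [simp]: "smult 0 x = 0"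
  and smult_zero_right [simp]: "smult c 0 = 0"
  by (rule poly_mapping_eqI, simp)+

lemma smult_add_left: "smult (c + d) x = smult c x + smult d x"
  by (rule poly_mapping_eqI) (simp add: lookup_add distrib_right)

lemma smult_eq_0: "smult c x = 0 \<longleftrightarrow> c = 0 \<or> x = 0"
  by (metis divide_self_if mult.commute smult_one smult_smult smult_zero smult_zero_right times_divide_eq_left mult_1)

lemma tau_smult [simp]: "tau (smult c x) = c * tau x"
  by (simp add: tau_def)

lemma tau_sum: "tau (sum f A) = (\<Sum>a\<in>A. tau (f a))"
  by (simp add: tau_def lookup_sum)

lemma tau_zero [simp]: "tau 0 = 0"
  by (simp add: tau_def)

lemma tau_times:
  assumes "finite F" "Poly_Mapping.keys x \<subseteq> F"
  shows "tau (x * y) = (\<Sum>g\<in>F. Poly_Mapping.lookup x g * Poly_Mapping.lookup y (- g))"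
  by (simp add: tau_def lookup_times[OF assms])

lemma tau_elt_times: "tau (elt g * y) = Poly_Mapping.lookup y (- g)"
  by (simp add: tau_def lookup_single_times)

lemma tau_commute: "tau (x * y) = tau (y * x)"
proof -
  \<comment> \<open>\<open>?F\<close> contains the support of \<open>x\<close>, and its negative
    contains that of \<open>y\<close>; the substitution of - g for g exchanges the two
    products.\<close>
  let ?F = "Poly_Mapping.keys x \<union> uminus ` Poly_Mapping.keys y"
  have fin: "finite ?F" "finite (uminus ` ?F)" by simp_all
  have "tau (x * y) = (\<Sum>g\<in>?F. Poly_Mapping.lookup x g * Poly_Mapping.lookup y (- g))"
    by (rule tau_times) auto
  also have "\<dots> = (\<Sum>g\<in>uminus ` ?F. Poly_Mapping.lookup y g * Poly_Mapping.lookup x (- g))"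
    by (subst sum.reindex) (auto simp: inj_on_def mult.commute)
  also have "\<dots> = tau (y * x)"
    by (rule tau_times[symmetric]) (use fin in \<open>auto simp: image_iff\<close>, force)
  finally show ?thesis .
qed

section \<open>The anti-involution inverting group elements, and positivity of the trace
  form\<close>

definition ginv :: "('g::group_add \<Rightarrow>\<^sub>0 complex) \<Rightarrow> ('g \<Rightarrow>\<^sub>0 complex)" where
  "ginv x = (\<Sum>g\<in>Poly_Mapping.keys x. smult (Poly_Mapping.lookup x g) (elt (- g)))"

lemma lookup_ginv: "Poly_Mapping.lookup (ginv x) g = Poly_Mapping.lookup x (- g)"
proof -
  have "Poly_Mapping.lookup (ginv x) g =
      (\<Sum>h\<in>Poly_Mapping.keys x. if h = - g then Poly_Mapping.lookup x h else 0)"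
    unfolding ginv_def lookup_sum
    by (intro sum.cong) (auto simp: lookup_single when_def)
  also have "\<dots> = Poly_Mapping.lookup x (- g)"
    by (auto simp: in_keys_iff)
  finally show ?thesis .
qed

lemma ginv_times: "ginv (x * y) = ginv y * ginv x"
proof (rule poly_mapping_eqI)
  fix k
  let ?l = Poly_Mapping.lookup
  \<comment> \<open>\<open>F\<close> covers the support of \<open>x\<close>, and its translate by
    \<open>k\<close> that of \<open>ginv y\<close>; the substitution is h = k + g.\<close>
  define F where "F = Poly_Mapping.keys x \<union> (\<lambda>h. - k + h) ` Poly_Mapping.keys (ginv y)"
  have fin: "finite F" by (simp add: F_def)
  have sub: "Poly_Mapping.keys (ginv y) \<subseteq> (\<lambda>g. k + g) ` F"
    by (auto simp: F_def image_image image_Un add.assoc[symmetric])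
  have "?l (ginv (x * y)) k = (\<Sum>g\<in>F. ?l x g * ?l y (- g + - k))"
    using fin by (subst lookup_ginv, subst lookup_times[of F]) (auto simp: F_def)
  also have "\<dots> = (\<Sum>g\<in>F. ?l (ginv y) (k + g) * ?l (ginv x) (- (k + g) + k))"
    by (intro sum.cong) (simp_all add: lookup_ginv minus_add add.assoc mult.commute del: add_uminus_conv_diff)
  also have "\<dots> = (\<Sum>h\<in>(\<lambda>g. k + g) ` F. ?l (ginv y) h * ?l (ginv x) (- h + k))"
    by (subst sum.reindex) (auto simp: inj_on_def)
  also have "\<dots> = ?l (ginv y * ginv x) k"
    using fin sub by (intro lookup_times[symmetric]) auto
  finally show "?l (ginv (x * y)) k = ?l (ginv y * ginv x) k" .
qed

text \<open>\<open>ginv\<close> does not conjugate coefficients, so \<open>tau (x * ginv x)\<close>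
  is the sum of their squares, which is definite for real coefficients. Row symmetrizers and column
  antisymmetrizers have coefficients 0, 1 and -1.\<close>

definition real_coeffs :: "('g::group_add \<Rightarrow>\<^sub>0 complex) \<Rightarrow> bool" where
  "real_coeffs x \<longleftrightarrow> (\<forall>g. Poly_Mapping.lookup x g \<in> \<real>)"

lemma real_coeffs_times: "real_coeffs x \<Longrightarrow> real_coeffs y \<Longrightarrow> real_coeffs (x * y)"
  unfolding real_coeffs_def
  by (auto simp: lookup_times[of "Poly_Mapping.keys x"] intro!: sum_in_Reals Reals_mult)

lemma tau_times_ginv_eq_0:
  assumes "real_coeffs x" "tau (x * ginv x) = 0"
  shows "x = 0"
proof -
  let ?l = "Poly_Mapping.lookup x"
  have "0 = (\<Sum>g\<in>Poly_Mapping.keys x. ?l g * ?l g)"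
    using assms(2) by (subst (asm) tau_times[of "Poly_Mapping.keys x"]) (auto simp: lookup_ginv)
  also have "\<dots> = (\<Sum>g\<in>Poly_Mapping.keys x. complex_of_real (Re (?l g) * Re (?l g)))"
    using assms(1) by (intro sum.cong) (auto simp: real_coeffs_def of_real_Re)
  also have "\<dots> = complex_of_real (\<Sum>g\<in>Poly_Mapping.keys x. Re (?l g) * Re (?l g))"
    by simp
  finally have "(\<Sum>g\<in>Poly_Mapping.keys x. Re (?l g) * Re (?l g)) = 0"
    by (metis of_real_eq_0_iff)
  then have "\<forall>g\<in>Poly_Mapping.keys x. Re (?l g) * Re (?l g) = 0"
    by (subst (asm) sum_nonneg_eq_0_iff) auto
  then have "\<forall>g\<in>Poly_Mapping.keys x. ?l g = 0"
    using assms(1) by (metis mult_eq_0_iff of_real_0 of_real_Re real_coeffs_def)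
  then show ?thesis
    by (intro poly_mapping_eqI) (metis in_keys_iff lookup_zero)
qed

section \<open>Algebras of finite subgroups inside one ambient group algebra\<close>

definition galgebra :: "'g::group_add set \<Rightarrow> ('g \<Rightarrow>\<^sub>0 complex) set" where
  "galgebra G = {x. Poly_Mapping.keys x \<subseteq> G}"

lemma galgebra_iff: "x \<in> galgebra G \<longleftrightarrow> (\<forall>g. g \<notin> G \<longrightarrow> Poly_Mapping.lookup x g = 0)"
  by (auto simp: galgebra_def in_keys_iff)

lemma galgebra_sum [simp]: "(\<And>a. a \<in> S \<Longrightarrow> f a \<in> galgebra G) \<Longrightarrow> sum f S \<in> galgebra G"
  by (auto simp: galgebra_iff lookup_sum intro!: sum.neutral)

lemma galgebra_smult [simp]: "x \<in> galgebra G \<Longrightarrow> smult c x \<in> galgebra G"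
  by (auto simp: galgebra_iff)

lemma galgebra_elt [simp]: "g \<in> G \<Longrightarrow> elt g \<in> galgebra G"
  by (auto simp: galgebra_def)

lemma galgebra_mono: "H \<subseteq> G \<Longrightarrow> x \<in> galgebra H \<Longrightarrow> x \<in> galgebra G"
  by (auto simp: galgebra_def)

text \<open>All symmetric groups will be subgroups of one infinite group, so each group algebra is a
  subset of the same ring and an inclusion of groups needs no embedding map.\<close>

locale finite_group =
  fixes G :: "'g::group_add set"
  assumes fin [simp]: "finite G" and zero_mem [simp]: "0 \<in> G"
    and add_mem [simp]: "\<And>g h. g \<in> G \<Longrightarrow> h \<in> G \<Longrightarrow> g + h \<in> G"
    and minus_mem [simp]: "\<And>g. g \<in> G \<Longrightarrow> - g \<in> G"
begin

abbreviation A where "A \<equiv> galgebra G"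

lemma times_mem [simp]: "x \<in> A \<Longrightarrow> y \<in> A \<Longrightarrow> x * y \<in> A"
  using keys_mult[of x y] add_mem unfolding galgebra_def by fastforce

lemma one_mem [simp]: "1 \<in> A"
  by (simp add: galgebra_def)

lemma expand: "x \<in> A \<Longrightarrow> x = (\<Sum>g\<in>G. smult (Poly_Mapping.lookup x g) (elt g))"
  by (rule expand_sum) (auto simp: galgebra_def)

text \<open>The inverse of a point of the support serves as \<open>g\<close>. This converts
  nonvanishing into a nonzero trace, the kind of scalar that the sandwich identities
  produce.\<close>

lemma tau_nondegenerate:
  assumes "x \<in> A" "x \<noteq> 0"
  obtains g where "g \<in> G" "tau (elt g * x) \<noteq> 0"
proof -
  obtain k where "Poly_Mapping.lookup x k \<noteq> 0"
    using assms(2) by (metis lookup_zero poly_mapping_eqI)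
  moreover from this have "k \<in> G"
    using assms(1) by (auto simp: galgebra_iff)
  ultimately show thesis
    using that[of "- k"] by (simp add: minus_mem tau_elt_times)
qed

end

section \<open>A block decomposition criterion\<close>

interpretation cvs: vector_space "smult :: complex \<Rightarrow> ('g::group_add \<Rightarrow>\<^sub>0 complex) \<Rightarrow> _"
  by unfold_locales (auto simp: smult_add smult_add_left)

text \<open>In the application \<open>I\<close> consists of the standard tableaux with n + 1 boxes,
  \<open>f T\<close> is the unit of \<open>T\<close> without its largest entry, \<open>E T\<close>
  the Young symmetrizer and \<open>kap T\<close> the constant in its square. \<open>E_orth\<close>
  concerns tableaux with the same \<open>f\<close>; \<open>f_orth\<close> separates the others.
  \<open>card_pairs\<close> makes the dimensions of the blocks add up to that of the
  algebra.\<close>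

locale block_data = finite_group G for G :: "'g::group_add set" +
  fixes I :: "'t set" and sh :: "'t \<Rightarrow> 's" and f E :: "'t \<Rightarrow> ('g \<Rightarrow>\<^sub>0 complex)"
    and kap :: "'t \<Rightarrow> complex"
  assumes finI [simp]: "finite I"
    and f_mem [simp]: "T \<in> I \<Longrightarrow> f T \<in> A" and E_mem [simp]: "T \<in> I \<Longrightarrow> E T \<in> A"
    and f_idem: "T \<in> I \<Longrightarrow> f T * f T = f T"
    and f_orth: "T \<in> I \<Longrightarrow> U \<in> I \<Longrightarrow> f T \<noteq> f U \<Longrightarrow> f T * f U = 0"
    and E_sandwich: "T \<in> I \<Longrightarrow> x \<in> A \<Longrightarrow> E T * x * E T = smult (kap T * tau (x * E T)) (E T)"
    and kap_nz: "T \<in> I \<Longrightarrow> kap T \<noteq> 0"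
    and tau_fE: "T \<in> I \<Longrightarrow> tau (f T * E T) = 1"
    and E_orth: "T \<in> I \<Longrightarrow> U \<in> I \<Longrightarrow> T \<noteq> U \<Longrightarrow> f T = f U \<Longrightarrow> x \<in> A \<Longrightarrow> E T * x * E U = 0"
    and E_conj: "T \<in> I \<Longrightarrow> U \<in> I \<Longrightarrow> sh T = sh U \<Longrightarrow> \<exists>g\<in>G. E U = elt g * E T * elt (- g)"
    and card_pairs: "card {(T, U). T \<in> I \<and> U \<in> I \<and> sh T = sh U} = card G"
begin

text \<open>The factor 1 / \<open>kap T\<close> is forced by idempotency; its value is known only
  after the trace computation, in \<open>kap_eq\<close>.\<close>

definition e where "e T = smult (1 / kap T) (f T * E T * f T)"

lemma e_mem [simp]: "T \<in> I \<Longrightarrow> e T \<in> A"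
  by (simp add: e_def)

lemma f_e: "T \<in> I \<Longrightarrow> f T * e T = e T" and e_f: "T \<in> I \<Longrightarrow> e T * f T = e T"
  by (simp_all add: e_def smult_simps mult.assoc[symmetric] f_idem) (simp add: mult.assoc f_idem)

lemma tau_e: "T \<in> I \<Longrightarrow> tau (e T) = 1 / kap T"
proof -
  assume T: "T \<in> I"
  have "tau (f T * E T * f T) = tau (f T * (f T * E T))"
    by (rule tau_commute)
  also have "\<dots> = 1" using T by (simp add: mult.assoc[symmetric] f_idem tau_fE)
  finally show ?thesis by (simp add: e_def)
qed

lemma e_nz: "T \<in> I \<Longrightarrow> e T \<noteq> 0"
  using tau_e[of T] kap_nz[of T] by auto

text \<open>Primitivity of \<open>e T\<close>. The factors \<open>f T\<close> around
  \<open>x\<close> are taken into the middle of the sandwich of \<open>E T\<close>, and cyclicity of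
  the trace brings them back outside.\<close>

lemma e_sandwich:
  assumes T: "T \<in> I" and x: "x \<in> A"
  shows "e T * x * e T = smult (kap T * tau (x * e T)) (e T)"
proof -
  have "e T * x * e T = smult (1 / kap T * (1 / kap T)) (f T * (E T * (f T * x * f T) * E T) * f T)"
    by (simp add: e_def smult_simps mult.assoc)
  also have "\<dots> = smult (tau (f T * x * f T * E T)) (e T)"
    using T x kap_nz[OF T] by (subst E_sandwich) (simp_all add: smult_simps e_def)
  also have "tau (f T * x * f T * E T) = tau (x * (f T * E T * f T))"
    using tau_commute[of "f T" "x * f T * E T"] by (simp add: mult.assoc)
  also have "\<dots> = kap T * tau (x * e T)"
    using kap_nz[OF T] by (simp add: e_def smult_simps)
  finally show ?thesis .
qed

lemma e_idem: "T \<in> I \<Longrightarrow> e T * e T = e T"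
  using e_sandwich[of T 1] tau_e[of T] kap_nz[of T] by simp

lemma e_orth:
  assumes "T \<in> I" "U \<in> I" "T \<noteq> U"
  shows "e T * e U = 0"
proof (cases "f T = f U")
  case True
  have "e T * e U = smult (1 / kap T * (1 / kap U)) (f T * (E T * (f T * f U) * E U) * f U)"
    by (simp add: e_def smult_simps mult.assoc)
  then show ?thesis
    using assms True by (subst (asm) E_orth) simp_all
next
  case False
  have "e T * e U = e T * (f T * f U) * e U"
    using assms by (metis e_f f_e mult.assoc)
  then show ?thesis using f_orth[OF assms(1,2) False] by simp
qed

lemma e_e: "T \<in> I \<Longrightarrow> U \<in> I \<Longrightarrow> e T * e U = (if T = U then e T else 0)"
  using e_idem e_orth by auto

text \<open>This renews the normalization \<open>tau_fE\<close> for the next number of boxes, where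
  \<open>e T\<close> takes the role of \<open>f\<close> and the larger symmetrizer agrees with
  \<open>E T\<close> on the smaller group.\<close>

lemma tau_e_E: "T \<in> I \<Longrightarrow> tau (e T * E T) = 1"
proof -
  assume T: "T \<in> I"
  have "e T * E T = smult (1 / kap T) (f T * (E T * f T * E T))"
    by (simp add: e_def smult_simps mult.assoc)
  then show ?thesis using T kap_nz[OF T] tau_fE[OF T] by (simp add: E_sandwich smult_simps)
qed

text \<open>As \<open>E U\<close> is the conjugate of \<open>E T\<close> by g, the product e U h e T
  contains \<open>E T\<close> twice; the sandwich splits it into the scalar tau(h f T E T g^-1 f U),
  up to a nonzero factor, and the element f U g E T f T. Neither may vanish: if one of the elements
  involved were zero, multiplication by a suitable h would contradict tau(f E) = 1.\<close>

lemma link_nonzero: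
  assumes T: "T \<in> I" and U: "U \<in> I" and sh: "sh T = sh U"
  shows "\<exists>y\<in>A. e U * y * e T \<noteq> 0"
proof -
  obtain g where g: "g \<in> G" and EU: "E U = elt g * E T * elt (- g)"
    using E_conj[OF T U sh] by blast
  have gg: "elt (- g) * elt g = 1" "elt g * elt (- g) = 1"
    by (simp_all add: mult_single)
  have mem: "elt g \<in> A" "elt (- g) \<in> A" using g by simp_all
  note mems = mem T U
  have ET_nz: "f T * E T \<noteq> 0" using T tau_fE[of T] by auto
  have ET_nz': "E T * f T \<noteq> 0" using T tau_fE[of T] tau_commute[of "E T" "f T"] by auto
  have a_nz: "f U * elt g * E T \<noteq> 0"
  proof
    assume "f U * elt g * E T = 0"
    then have "f U * E U = 0" by (simp add: EU mult.assoc[symmetric])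
    then show False using tau_fE[OF U] by simp
  qed
  have a_nz': "E T * elt (- g) * f U \<noteq> 0"
  proof
    assume "E T * elt (- g) * f U = 0"
    then have "E U * f U = 0" by (simp add: EU mult.assoc)
    then show False using tau_fE[OF U] tau_commute[of "E U" "f U"] by simp
  qed
  \<comment> \<open>Multiplying on the left by \<open>E T * elt h\<close>, with h chosen so that the
    resulting trace is nonzero, would leave a nonzero multiple of \<open>E T * f T\<close>.\<close>
  have M: "f U * elt g * E T * f T \<noteq> 0"
  proof
    assume 0: "f U * elt g * E T * f T = 0"
    obtain h where h: "h \<in> G" "tau (elt h * (f U * elt g * E T)) \<noteq> 0"
      using tau_nondegenerate[OF _ a_nz] mems by auto
    have "E T * (elt h * f U * elt g) * E T * f T = E T * elt h * (f U * elt g * E T * f T)"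
      by (simp add: mult.assoc)
    also have "\<dots> = 0" by (simp add: 0)
    finally have "smult (kap T * tau (elt h * f U * elt g * E T)) (E T * f T) = 0"
      using mems h by (subst (asm) E_sandwich) (simp_all add: smult_simps)
    then show False using h ET_nz' kap_nz[OF T] by (simp add: smult_eq_0 mult.assoc)
  qed
  have M': "f T * E T * elt (- g) * f U \<noteq> 0"
  proof
    assume 0: "f T * E T * elt (- g) * f U = 0"
    obtain h where h: "h \<in> G" "tau (elt h * (E T * elt (- g) * f U)) \<noteq> 0"
      using tau_nondegenerate[OF _ a_nz'] mems by auto
    have "f T * (E T * (elt (- g) * f U * elt h) * E T) = (f T * E T * elt (- g) * f U) * elt h * E T"
      by (simp add: mult.assoc)
    also have "\<dots> = 0" by (simp add: 0)
    finally have "smult (kap T * tau (elt (- g) * f U * elt h * E T)) (f T * E T) = 0"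
      using mems h by (subst (asm) E_sandwich) (simp_all add: smult_simps)
    moreover have "tau (elt (- g) * f U * elt h * E T) = tau (elt h * (E T * elt (- g) * f U))"
      using tau_commute[of "elt (- g) * f U" "elt h * E T"] by (simp add: mult.assoc)
    ultimately show False using h ET_nz kap_nz[OF T] by (simp add: smult_eq_0)
  qed
  \<comment> \<open>The scalar is a coefficient of the nonzero element in \<open>M'\<close>, so some
    \<open>h\<close> makes it nonzero.\<close>
  obtain h where h: "h \<in> G" "tau (elt h * (f T * E T * elt (- g) * f U)) \<noteq> 0"
    using tau_nondegenerate[OF _ M'] mems by auto
  have "e U * elt h * e T = smult (1 / kap U * (1 / kap T))
      (f U * elt g * (E T * (elt (- g) * f U * elt h * f T) * E T) * f T)"
    by (simp add: e_def smult_simps EU mult.assoc)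
  also have "\<dots> = smult (1 / kap U * tau (elt (- g) * f U * elt h * f T * E T)) (f U * elt g * E T * f T)"
    using mems h kap_nz[OF T] by (subst E_sandwich) (simp_all add: smult_simps)
  also have "tau (elt (- g) * f U * elt h * f T * E T) = tau (elt h * (f T * E T * elt (- g) * f U))"
    using tau_commute[of "elt (- g) * f U" "elt h * f T * E T"] by (simp add: mult.assoc)
  finally have "e U * elt h * e T \<noteq> 0"
    using h M kap_nz[OF U] by (simp add: smult_eq_0)
  then show ?thesis using h(1) by (intro bexI[of _ "elt h"]) simp_all
qed

text \<open>A nonzero round trip from \<open>T\<close> to \<open>U\<close> and back, normalized.
  Used in the smaller group algebra, it supplies elements that commute with the centralizer and
  transport its eigenvalues from one tableau to another.\<close>

lemma link:
  assumes T: "T \<in> I" and U: "U \<in> I" and sh: "sh T = sh U"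
  shows "\<exists>y\<in>A. \<exists>z\<in>A. e T * y * e U * z * e T = e T"
proof -
  obtain z where z: "z \<in> A" "e U * z * e T \<noteq> 0"
    using link_nonzero[OF T U sh] by blast
  obtain h where h: "h \<in> G" "tau (elt h * (e U * z * e T)) \<noteq> 0"
    using tau_nondegenerate[OF _ z(2)] z T U by auto
  define c where "c = kap T * tau (elt h * (e U * z * e T))"
  have c: "c \<noteq> 0" using h kap_nz[OF T] by (simp add: c_def)
  have "e T * (elt h * e U * z) * e T = smult c (e T)"
    using T U z h unfolding c_def by (subst e_sandwich) (simp_all add: mult.assoc)
  then have "e T * smult (1 / c) (elt h) * e U * z * e T = e T"
    using c by (simp add: smult_simps mult.assoc)
  then show ?thesis using h z by (intro bexI[of _ "smult (1 / c) (elt h)"] bexI[of _ z]) simp_all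
qed

section \<open>A basis of the algebra made of matrix units up to scalars\<close>

definition pairs where "pairs = {(T, U). T \<in> I \<and> U \<in> I \<and> sh T = sh U}"

text \<open>Since the \<open>e\<close> are idempotent, the fixed-point equation says that the
  element lies in e_T A e_U. Up to a scalar \<open>X p\<close> is the matrix unit at position
  \<open>p\<close>.\<close>

definition X where "X p = (SOME x. x \<in> A \<and> x \<noteq> 0 \<and> x = e (fst p) * x * e (snd p))"

lemma X:
  assumes "p \<in> pairs"
  shows "X p \<in> A" "X p \<noteq> 0" "X p = e (fst p) * X p * e (snd p)"
proof -
  obtain T U where p: "p = (T, U)" "T \<in> I" "U \<in> I" "sh U = sh T"
    using assms by (auto simp: pairs_def)
  then obtain y where y: "y \<in> A" "e T * y * e U \<noteq> 0"
    using link_nonzero[of U T] by blast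
  have "\<exists>x. x \<in> A \<and> x \<noteq> 0 \<and> x = e (fst p) * x * e (snd p)"
    using p y by (intro exI[of _ "e T * y * e U"]) (simp add: mult.assoc e_idem, simp add: mult.assoc[symmetric] e_idem)
  from someI_ex[OF this] show "X p \<in> A" "X p \<noteq> 0" "X p = e (fst p) * X p * e (snd p)"
    unfolding X_def[symmetric] by blast+
qed

lemma finite_pairs [simp]: "finite pairs"
  unfolding pairs_def by (rule finite_subset[of _ "I \<times> I"]) auto

lemma e_X_e:
  assumes "p \<in> pairs" "T \<in> I" "U \<in> I"
  shows "e T * X p * e U = (if p = (T, U) then X p else 0)"
proof -
  have pI: "fst p \<in> I" "snd p \<in> I" using assms(1) by (auto simp: pairs_def)
  have "e T * X p * e U = (e T * e (fst p)) * X p * (e (snd p) * e U)"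
    by (subst X(3)[OF assms(1)]) (simp add: mult.assoc)
  then show ?thesis
    using assms pI X(3)[OF assms(1)] by (cases p) (auto simp: e_e)
qed

lemma X_inj: "inj_on X pairs"
proof (rule inj_onI, rule ccontr)
  fix p q assume pq: "p \<in> pairs" "q \<in> pairs" "X p = X q" "p \<noteq> q"
  have I: "fst p \<in> I" "snd p \<in> I" using pq by (auto simp: pairs_def)
  have "X p = e (fst p) * X q * e (snd p)" using X(3)[OF pq(1)] pq(3) by simp
  then show False using e_X_e[OF pq(2) I] pq X(2)[OF pq(1)] by auto
qed

lemma e_sum_X_e:
  assumes "T \<in> I" "U \<in> I"
  shows "e T * (\<Sum>p\<in>pairs. smult (c p) (X p)) * e U =
    (if sh T = sh U then smult (c (T, U)) (X (T, U)) else 0)"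
proof -
  have "e T * (\<Sum>p\<in>pairs. smult (c p) (X p)) * e U = (\<Sum>p\<in>pairs. smult (c p) (e T * X p * e U))"
    by (simp add: sum_distrib_left sum_distrib_right smult_simps)
  also have "\<dots> = (\<Sum>p\<in>pairs. if p = (T, U) then smult (c p) (X p) else 0)"
    using assms by (intro sum.cong) (auto simp: e_X_e)
  also have "\<dots> = (if (T, U) \<in> pairs then smult (c (T, U)) (X (T, U)) else 0)"
    by (simp add: sum.delta')
  finally show ?thesis using assms by (simp add: pairs_def)
qed

lemma X_indep: "cvs.independent (X ` pairs)"
proof (rule cvs.independent_if_scalars_zero)
  fix u x assume s: "(\<Sum>x\<in>X ` pairs. smult (u x) x) = 0" and "x \<in> X ` pairs"
  then obtain T U where p: "(T, U) \<in> pairs" "x = X (T, U)" by auto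
  have "0 = e T * (\<Sum>p\<in>pairs. smult (u (X p)) (X p)) * e U"
    using s by (simp add: sum.reindex[OF X_inj])
  also have "\<dots> = smult (u x) x"
    using p by (subst e_sum_X_e) (auto simp: pairs_def)
  finally show "u x = 0" using X(2)[OF p(1)] p(2) by (simp add: smult_eq_0)
qed simp

lemma A_span: "v \<in> A \<Longrightarrow> v \<in> cvs.span (elt ` G)"
  using expand[of v] by (metis (no_types, lifting) cvs.span_sum cvs.span_scale cvs.span_base imageI)

text \<open>By \<open>card_pairs\<close> there are as many independent elements \<open>X p\<close>
  as group elements, so an element outside their span would give an independent set larger than a
  spanning set.\<close>

lemma coords:
  assumes v: "v \<in> A"
  shows "\<exists>c. v = (\<Sum>p\<in>pairs. smult (c p) (X p))"
proof -
  have card: "card (X ` pairs) = card G"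
    using card_pairs by (simp add: card_image[OF X_inj]) (simp add: pairs_def)
  have "v \<in> cvs.span (X ` pairs)"
  proof (rule ccontr)
    assume nv: "v \<notin> cvs.span (X ` pairs)"
    then have nX: "v \<notin> X ` pairs" using cvs.span_base by blast
    have "cvs.independent (insert v (X ` pairs))"
      using nv X_indep by (rule cvs.independent_insertI)
    moreover have "insert v (X ` pairs) \<subseteq> cvs.span (elt ` G)"
      using A_span v X(1) by blast
    ultimately have "card (insert v (X ` pairs)) \<le> card (elt ` G)"
      using cvs.independent_span_bound[of "elt ` G"] by simp
    also have "\<dots> \<le> card G" by (rule card_image_le) simp
    finally show False using nX card by simp
  qed
  then obtain u where "v = (\<Sum>x\<in>X ` pairs. smult (u x) x)"
    by (auto simp: cvs.span_finite)
  then have "v = (\<Sum>p\<in>pairs. smult (u (X p)) (X p))"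
    by (simp add: sum.reindex[OF X_inj])
  then show ?thesis by (intro exI[of _ "\<lambda>p. u (X p)"])
qed

text \<open>The basis \<open>X\<close> has no element at a position with two different shapes, so
  the sandwich of any expansion vanishes: orthogonality across shapes is a consequence of the
  dimension count.\<close>

lemma e_diff_shape: "T \<in> I \<Longrightarrow> U \<in> I \<Longrightarrow> sh T \<noteq> sh U \<Longrightarrow> v \<in> A \<Longrightarrow> e T * v * e U = 0"
  using coords[of v] e_sum_X_e[of T U] by auto

lemma sum_e: "(\<Sum>T\<in>I. e T) = 1"
proof -
  let ?s = "\<Sum>T\<in>I. e T"
  have "?s * X p = X p" if p: "p \<in> pairs" for p
  proof -
    have "?s * X p = ?s * e (fst p) * X p * e (snd p)"
      by (subst X(3)[OF p]) (simp add: mult.assoc)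
    also have "?s * e (fst p) = (\<Sum>T\<in>I. if T = fst p then e T else 0)"
      unfolding sum_distrib_right using p by (intro sum.cong) (auto simp: e_e pairs_def)
    also have "\<dots> = e (fst p)" using p by (auto simp: pairs_def)
    finally show ?thesis using X(3)[OF p] by simp
  qed
  then have "?s * (\<Sum>p\<in>pairs. smult (c p) (X p)) = (\<Sum>p\<in>pairs. smult (c p) (X p))" for c
    by (simp add: sum_distrib_left smult_simps)
  then have "?s * 1 = 1" using coords[of 1] by (metis one_mem)
  then show ?thesis by simp
qed

text \<open>Both sides are the trace of right multiplication by \<open>e T\<close>, computed in the basis of group
  elements and in the basis \<open>X\<close>.\<close>

lemma tau_e_card: "T \<in> I \<Longrightarrow> of_nat (card G) * tau (e T) = of_nat (card {U \<in> I. sh U = sh T})"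
proof -
  assume T: "T \<in> I"
  let ?l = Poly_Mapping.lookup
  have "\<forall>g\<in>G. \<exists>c. elt g = (\<Sum>p\<in>pairs. smult (c p) (X p))" using coords by simp
  then obtain \<phi> where \<phi>: "\<And>g. g \<in> G \<Longrightarrow> elt g = (\<Sum>p\<in>pairs. smult (\<phi> g p) (X p))" by metis
  \<comment> \<open>\<open>\<phi> g p\<close> is the coordinate of g at \<open>p\<close>; taking the
    same coordinate of \<open>X p\<close>, expanded in group elements, gives 1.\<close>
  have dual: "(\<Sum>g\<in>G. \<phi> g p * ?l (X p) g) = 1" if p: "p \<in> pairs" for p
  proof -
    obtain U V where UV: "p = (U, V)" "U \<in> I" "V \<in> I" "sh U = sh V" using p by (auto simp: pairs_def)
    have "X p = e U * (\<Sum>g\<in>G. smult (?l (X p) g) (elt g)) * e V"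
      using expand[OF X(1)[OF p]] X(3)[OF p] UV by simp
    also have "\<dots> = (\<Sum>g\<in>G. smult (?l (X p) g) (e U * elt g * e V))"
      by (simp add: sum_distrib_left sum_distrib_right smult_simps)
    also have "\<dots> = (\<Sum>g\<in>G. smult (?l (X p) g) (smult (\<phi> g p) (X p)))"
      using UV by (intro sum.cong) (simp_all add: \<phi> e_sum_X_e)
    also have "\<dots> = smult (\<Sum>g\<in>G. \<phi> g p * ?l (X p) g) (X p)"
      by (simp add: cvs.scale_sum_left mult.commute)
    finally have "smult ((\<Sum>g\<in>G. \<phi> g p * ?l (X p) g) - 1) (X p) = 0"
      by (simp add: cvs.scale_left_diff_distrib)
    then show ?thesis using X(2)[OF p] by (simp add: smult_eq_0)
  qed
  have Xe: "X p * e T = (if snd p = T then X p else 0)" if p: "p \<in> pairs" for p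
    by (subst (1 2) X(3)[OF p]) (use p T in \<open>auto simp: mult.assoc e_e pairs_def\<close>)
  have "of_nat (card G) * tau (e T) = (\<Sum>g\<in>G. ?l (elt g * e T) g)"
    by (simp add: lookup_single_times tau_def)
  also have "\<dots> = (\<Sum>g\<in>G. \<Sum>p\<in>pairs. \<phi> g p * ?l (X p * e T) g)"
    by (intro sum.cong) (simp_all add: \<phi> sum_distrib_right lookup_sum smult_simps)
  also have "\<dots> = (\<Sum>p\<in>pairs. \<Sum>g\<in>G. \<phi> g p * ?l (X p * e T) g)"
    by (rule sum.swap)
  also have "\<dots> = (\<Sum>p\<in>pairs. if snd p = T then 1 else 0)"
    by (intro sum.cong) (auto simp: Xe dual)
  also have "\<dots> = of_nat (card {p \<in> pairs. snd p = T})"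
    by (simp add: sum.If_cases Int_def)
  also have "{p \<in> pairs. snd p = T} = (\<lambda>U. (U, T)) ` {U \<in> I. sh U = sh T}"
    using T by (auto simp: pairs_def)
  also have "card \<dots> = card {U \<in> I. sh U = sh T}"
    by (rule card_image) (auto simp: inj_on_def)
  finally show ?thesis .
qed

lemma kap_eq: "T \<in> I \<Longrightarrow> 1 / kap T = of_nat (card {U \<in> I. sh U = sh T}) / of_nat (card G)"
proof -
  assume T: "T \<in> I"
  have "card G \<noteq> 0" using fin zero_mem by (metis card_0_eq empty_iff)
  then show ?thesis using tau_e_card[OF T] tau_e[OF T] by (simp add: field_simps)
qed

end

section \<open>Young symmetrizers\<close>

text \<open>The group is written additively, with \<open>+\<close> for composition, because \<^theory>\<open>HOL-Library.Poly_Mapping\<close>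
  provides the convolution product over additive monoids only.\<close>

typedef sperm = "{p :: nat \<Rightarrow> nat. \<exists>n. p permutes {1..n}}" morphisms ap Sp
  using permutes_id by blast

setup_lifting type_definition_sperm

instantiation sperm :: group_add
begin

lift_definition zero_sperm :: sperm is id
  using permutes_id by blast

lift_definition plus_sperm :: "sperm \<Rightarrow> sperm \<Rightarrow> sperm" is "\<lambda>p q. p \<circ> q"
proof -
  fix p q :: "nat \<Rightarrow> nat"
  assume "\<exists>n. p permutes {1..n}" "\<exists>n. q permutes {1..n}"
  then obtain m n where pq: "p permutes {1..m}" "q permutes {1..n}" by blast
  have "p permutes {1..max m n}" "q permutes {1..max m n}"
    by (rule permutes_subset[OF pq(1)], simp) (rule permutes_subset[OF pq(2)], simp)
  then show "\<exists>n. (p \<circ> q) permutes {1..n}" using permutes_compose by blast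
qed

lift_definition uminus_sperm :: "sperm \<Rightarrow> sperm" is inv
  using permutes_inv by blast

definition minus_sperm :: "sperm \<Rightarrow> sperm \<Rightarrow> sperm" where "minus_sperm p q = p + - q"

instance
proof
  fix a b c :: sperm
  show "a + b + c = a + (b + c)" by transfer (simp add: comp_assoc)
  show "0 + a = a" by transfer simp
  show "a + 0 = a" by transfer simp
  show "- a + a = 0" by transfer (auto dest: permutes_inv_o)
  show "a + - b = a - b" by (simp add: minus_sperm_def)
qed

end

lemma ap_zero [simp]: "ap 0 = id" and ap_plus: "ap (p + q) = ap p \<circ> ap q"
  and ap_uminus: "ap (- p) = inv (ap p)"
  by (transfer; simp)+

section \<open>The symmetric groups as subgroups of \<open>sperm\<close>\<close>

definition SG :: "nat \<Rightarrow> sperm set" where "SG n = {g. ap g \<in> Sym n}"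

lemma SG_iff: "g \<in> SG n \<longleftrightarrow> ap g permutes {1..n}"
  by (simp add: SG_def Sym_def)

lemma ap_Sp: "p permutes {1..n} \<Longrightarrow> ap (Sp p) = p"
  by (rule Sp_inverse) blast

lemma Sp_SG: "p \<in> Sym n \<Longrightarrow> Sp p \<in> SG n" and ap_Sp': "p \<in> Sym n \<Longrightarrow> ap (Sp p) = p"
  by (auto simp: SG_iff Sym_def ap_Sp)

lemma SG_eq: "SG n = Sp ` Sym n"
  using Sp_SG by (auto simp: SG_def image_iff) (metis ap_inverse)

lemma inj_on_Sp: "inj_on Sp (Sym n)"
  by (metis ap_Sp' inj_onI)

lemma finite_Sym [simp]: "finite (Sym n)"
  by (simp add: Sym_def finite_permutations)

lemma card_SG: "card (SG n) = fact n"
proof -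
  have "card (SG n) = card (Sym n)" by (simp add: SG_eq card_image[OF inj_on_Sp])
  also have "\<dots> = fact n" unfolding Sym_def by (rule card_permutations) simp_all
  finally show ?thesis .
qed

interpretation SG: finite_group "SG n" for n
proof
  show "finite (SG n)" by (simp add: SG_eq)
  show "0 \<in> SG n" by (simp add: SG_iff permutes_id)
qed (auto simp: SG_iff ap_plus ap_uminus permutes_compose permutes_inv)

lemma SG_mono: "m \<le> n \<Longrightarrow> SG m \<subseteq> SG n"
  using permutes_subset[of _ "{1..m}" "{1..n}"] by (auto simp: SG_iff)

lemma ap_mem [simp]: "g \<in> SG n \<Longrightarrow> ap g a \<in> {1..n} \<longleftrightarrow> a \<in> {1..n}"
  unfolding SG_iff by (rule permutes_in_image)

lemma ap_in: "g \<in> SG n \<Longrightarrow> a \<in> {1..n} \<Longrightarrow> ap g a \<in> {1..n}"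
  using ap_mem by blast

lemma ap_minus_ap [simp]: "ap (- g) (ap g a) = a" "ap g (ap (- g) a) = a"
  by (metis ap_plus ap_zero comp_apply id_apply left_minus) (metis ap_plus ap_zero comp_apply id_apply right_minus)

lemma sperm_eqI: "(\<And>a. ap g a = ap h a) \<Longrightarrow> g = h"
  by (simp add: ap_inject[symmetric] fun_eq_iff)

definition sgn_perm :: "sperm \<Rightarrow> complex" where "sgn_perm g = of_int (sign (ap g))"

lemma permutation_ap: "permutation (ap g)"
  using ap[of g] permutation_permutes by blast

lemma sgn_perm_add [simp]: "sgn_perm (g + h) = sgn_perm g * sgn_perm h"
  by (simp add: sgn_perm_def ap_plus sign_compose permutation_ap)

lemma sgn_perm_zero [simp]: "sgn_perm 0 = 1"
  by (simp add: sgn_perm_def)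

lemma sgn_perm_uminus [simp]: "sgn_perm (- g) = sgn_perm g"
  by (simp add: sgn_perm_def ap_uminus sign_inverse permutation_ap)

lemma sgn_perm_square [simp]: "sgn_perm g * sgn_perm g = 1"
  by (simp add: sgn_perm_def flip: of_int_mult)

text \<open>Row and column stabilizers are both groups of permutations preserving a labelling, by
  row index or by column index, and are treated together.\<close>

definition stab :: "nat \<Rightarrow> (nat \<Rightarrow> nat) \<Rightarrow> sperm set" where
  "stab n w = {g \<in> SG n. \<forall>a\<in>{1..n}. w (ap g a) = w a}"

lemma stab_finite_group: "finite_group (stab n w)"
proof
  show "finite (stab n w)" by (simp add: stab_def)
  show "0 \<in> stab n w" by (simp add: stab_def)
  fix g h assume gh: "g \<in> stab n w" "h \<in> stab n w"
  have "w (ap (g + h) a) = w a" if a: "a \<in> {1..n}" for a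
  proof -
    have "ap h a \<in> {1..n}" using gh(2) a by (intro ap_in) (simp_all add: stab_def)
    then show ?thesis using gh a by (simp add: stab_def ap_plus)
  qed
  then show "g + h \<in> stab n w" using gh by (simp add: stab_def)
  have "w (ap (- g) a) = w a" if "a \<in> {1..n}" for a
  proof -
    have "ap (- g) a \<in> {1..n}"
      using that gh(1) by (intro ap_in) (simp_all add: stab_def)
    then have "w (ap g (ap (- g) a)) = w (ap (- g) a)" using gh(1) unfolding stab_def by blast
    then show ?thesis by simp
  qed
  then show "- g \<in> stab n w" using gh(1) by (simp add: stab_def)
qed

interpretation stab: finite_group "stab n w" for n w
  by (rule stab_finite_group)

lemma stab_SG: "g \<in> stab n w \<Longrightarrow> g \<in> SG n"
  by (simp add: stab_def)

section \<open>Row symmetrizers, column antisymmetrizers and their product\<close>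

definition Rsum where "Rsum n w = (\<Sum>g\<in>stab n w. elt g)"
definition Csum where "Csum n w = (\<Sum>g\<in>stab n w. smult (sgn_perm g) (elt g))"
definition ysym where "ysym n rw cl = Rsum n rw * Csum n cl"

lemma lookup_Rsum: "Poly_Mapping.lookup (Rsum n w) g = (if g \<in> stab n w then 1 else 0)"
  by (simp add: Rsum_def lookup_sum lookup_single when_def)

lemma lookup_Csum: "Poly_Mapping.lookup (Csum n w) g = (if g \<in> stab n w then sgn_perm g else 0)"
  by (simp add: Csum_def lookup_sum lookup_single when_def if_distrib cong: if_cong)

lemma Rsum_mem [simp]: "Rsum n w \<in> galgebra (SG n)" and Csum_mem [simp]: "Csum n w \<in> galgebra (SG n)"
  by (auto simp: galgebra_iff lookup_Rsum lookup_Csum stab_SG)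

lemma ysym_mem [simp]: "ysym n rw cl \<in> galgebra (SG n)"
  by (simp add: ysym_def)

lemma stab_minus_add: "h \<in> stab n w \<Longrightarrow> - h + g \<in> stab n w \<longleftrightarrow> g \<in> stab n w"
  by (metis add_minus_cancel stab.add_mem stab.minus_mem)

lemma elt_Rsum: "h \<in> stab n w \<Longrightarrow> elt h * Rsum n w = Rsum n w"
  by (rule poly_mapping_eqI) (simp add: lookup_single_times lookup_Rsum stab_minus_add)

lemma elt_Csum: "h \<in> stab n w \<Longrightarrow> elt h * Csum n w = smult (sgn_perm h) (Csum n w)"
  by (rule poly_mapping_eqI) (simp add: lookup_single_times lookup_Csum stab_minus_add)

lemma ginv_Rsum: "ginv (Rsum n w) = Rsum n w" and ginv_Csum: "ginv (Csum n w) = Csum n w"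
proof -
  have *: "- g \<in> stab n w \<longleftrightarrow> g \<in> stab n w" for g by (metis minus_minus stab.minus_mem)
  show "ginv (Rsum n w) = Rsum n w" "ginv (Csum n w) = Csum n w"
    by (rule poly_mapping_eqI; simp add: lookup_ginv lookup_Rsum lookup_Csum *)+
qed

lemma ginv_elt: "ginv (elt h) = elt (- h)"
  by (rule poly_mapping_eqI) (auto simp: lookup_ginv lookup_single when_def)

lemma Rsum_elt: "h \<in> stab n w \<Longrightarrow> Rsum n w * elt h = Rsum n w"
  using elt_Rsum[of "- h" n w] ginv_times[of "elt (- h)" "Rsum n w"] by (simp add: ginv_Rsum ginv_elt)

lemma Rsum_Rsum: "Rsum n w * Rsum n w = smult (of_nat (card (stab n w))) (Rsum n w)"
proof -
  have "Rsum n w * Rsum n w = (\<Sum>g\<in>stab n w. elt g * Rsum n w)"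
    by (subst Rsum_def) (simp add: sum_distrib_right)
  also have "\<dots> = (\<Sum>g\<in>stab n w. smult 1 (Rsum n w))" by (intro sum.cong) (simp_all add: elt_Rsum)
  also have "\<dots> = smult (of_nat (card (stab n w))) (Rsum n w)"
    by (subst cvs.scale_sum_left[symmetric]) simp
  finally show ?thesis .
qed

lemma Csum_Csum: "Csum n w * Csum n w = smult (of_nat (card (stab n w))) (Csum n w)"
proof -
  have "Csum n w * Csum n w = (\<Sum>g\<in>stab n w. smult (sgn_perm g) (elt g) * Csum n w)"
    by (subst Csum_def) (simp add: sum_distrib_right)
  also have "\<dots> = (\<Sum>g\<in>stab n w. smult 1 (Csum n w))"
    by (intro sum.cong) (simp_all add: elt_Csum smult_simps)
  also have "\<dots> = smult (of_nat (card (stab n w))) (Csum n w)"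
    by (subst cvs.scale_sum_left[symmetric]) simp
  finally show ?thesis .
qed

text \<open>Removing the maximum M, which is at least card S - 1 because S lies in {..M}, gives the
  bound by induction; equality pins down M and then the rest. Applied row by row, this does the work
  usually done by the dominance order.\<close>

lemma sum_lessThan_card_le:
  fixes S :: "nat set"
  assumes "finite S"
  shows "\<Sum>{..<card S} \<le> \<Sum>S \<and> (\<Sum>S = \<Sum>{..<card S} \<longrightarrow> S = {..<card S})"
  using assms
proof (induction "card S" arbitrary: S)
  case 0
  then show ?case by simp
next
  case (Suc m)
  define M where "M = Max S"
  have ne: "S \<noteq> {}" using Suc by auto
  have M: "M \<in> S" using ne Suc by (simp add: M_def)
  have c: "card (S - {M}) = m" using M Suc by (simp add: card_Diff_singleton)
  have S: "\<Sum>S = M + \<Sum>(S - {M})" using M Suc by (simp add: sum.remove)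
  have "S \<subseteq> {..M}" using Suc by (auto simp: M_def)
  then have "card S \<le> Suc M" using card_mono[of "{..M}" S] by simp
  then have m: "m \<le> M" using Suc by simp
  have IH: "\<Sum>{..<m} \<le> \<Sum>(S - {M})" "\<Sum>(S - {M}) = \<Sum>{..<m} \<Longrightarrow> S - {M} = {..<m}"
    using Suc.hyps(1)[of "S - {M}"] c Suc by auto
  show ?case
  proof (intro conjI impI)
    show "\<Sum>{..<card S} \<le> \<Sum>S" using Suc(2)[symmetric] S m IH by simp
    assume "\<Sum>S = \<Sum>{..<card S}"
    then have "M = m" "\<Sum>(S - {M}) = \<Sum>{..<m}" using Suc(2)[symmetric] S m IH(1) by simp_all
    then have "S - {m} = {..<m}" "m \<in> S" using IH(2) M by simp_all
    then show "S = {..<card S}" unfolding Suc(2)[symmetric] by (auto simp: lessThan_Suc)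
  qed
qed

text \<open>\<open>rw a\<close> and \<open>cl a\<close> are the row and column, counted from 0, of
  the entry \<open>a\<close> in a diagram with row lengths \<open>L\<close>. Only positions are
  recorded, since they determine the Young symmetrizer.\<close>

locale filling =
  fixes n :: nat and rw cl :: "nat \<Rightarrow> nat" and L :: "nat \<Rightarrow> nat"
  assumes bij: "bij_betw (\<lambda>a. (rw a, cl a)) {1..n} {(r, c). c < L r}"
begin

lemma inj: "a \<in> {1..n} \<Longrightarrow> b \<in> {1..n} \<Longrightarrow> rw a = rw b \<Longrightarrow> cl a = cl b \<Longrightarrow> a = b"
  using bij unfolding bij_betw_def inj_on_def by blast

lemma cl_less: "a \<in> {1..n} \<Longrightarrow> cl a < L (rw a)"
  using bij unfolding bij_betw_def by blast

lemma cl_row: "bij_betw cl {a \<in> {1..n}. rw a = r} {..<L r}"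
proof -
  have "\<exists>a\<in>{1..n}. rw a = r \<and> cl a = c" if "c < L r" for c
  proof -
    have "(r, c) \<in> (\<lambda>a. (rw a, cl a)) ` {1..n}"
      using bij that unfolding bij_betw_def by blast
    then show ?thesis by blast
  qed
  then show ?thesis using inj cl_less unfolding bij_betw_def inj_on_def by blast
qed

text \<open>In each row, \<open>cl\<close> takes the smallest possible distinct values \<open>0, \<dots>, L r - 1\<close>.\<close>

lemma row_sums:
  assumes cinj: "\<And>a b. a \<in> {1..n} \<Longrightarrow> b \<in> {1..n} \<Longrightarrow> rw a = rw b \<Longrightarrow> c a = c b \<Longrightarrow> a = b"
  shows "(\<Sum>a\<in>{1..n}. cl a) \<le> (\<Sum>a\<in>{1..n}. (c a :: nat))"
    and "(\<Sum>a\<in>{1..n}. cl a) = (\<Sum>a\<in>{1..n}. c a) \<Longrightarrow> a \<in> {1..n} \<Longrightarrow> c a < L (rw a)"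
proof -
  define B where "B r = {a \<in> {1..n}. rw a = r}" for r
  have card: "card (c ` B r) = L r" for r
  proof -
    have "card (c ` B r) = card (B r)" by (rule card_image) (use cinj in \<open>auto simp: B_def inj_on_def\<close>)
    also have "\<dots> = L r" using bij_betw_same_card[OF cl_row[of r]] by (simp add: B_def)
    finally show ?thesis .
  qed
  have cs: "sum cl (B r) = \<Sum>{..<L r}" for r
    using sum.reindex_bij_betw[OF cl_row[of r], of id] by (simp add: B_def)
  have c's: "sum c (B r) = \<Sum>(c ` B r)" for r
    by (subst sum.reindex) (use cinj in \<open>auto simp: B_def inj_on_def\<close>)
  have le: "sum cl (B r) \<le> sum c (B r)" for r
    using sum_lessThan_card_le[of "c ` B r"] unfolding cs c's card by (simp add: B_def)
  have tot: "sum f {1..n} = (\<Sum>r\<in>rw ` {1..n}. sum f (B r))" for f :: "nat \<Rightarrow> nat"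
    unfolding B_def by (rule sum.image_gen) simp
  show "(\<Sum>a\<in>{1..n}. cl a) \<le> (\<Sum>a\<in>{1..n}. c a)"
    unfolding tot by (rule sum_mono) (rule le)
  assume eq: "(\<Sum>a\<in>{1..n}. cl a) = (\<Sum>a\<in>{1..n}. c a)" and a: "a \<in> {1..n}"
  have "sum cl (B (rw a)) = sum c (B (rw a))"
    using eq a unfolding tot by (intro sum_mono_inv[OF _ le]) auto
  then have "c ` B (rw a) = {..<L (rw a)}"
    using sum_lessThan_card_le[of "c ` B (rw a)"] unfolding cs c's card by (simp add: B_def)
  moreover have "c a \<in> c ` B (rw a)" using a by (auto simp: B_def)
  ultimately show "c a < L (rw a)" by blast
qed

abbreviation "R \<equiv> Rsum n rw"
abbreviation "C \<equiv> Csum n cl"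
abbreviation "E \<equiv> ysym n rw cl"

text \<open>The transposition of \<open>a\<close> and \<open>b\<close> is absorbed by \<open>R\<close>; moved past \<open>g\<close> it changes the sign of the
  column antisymmetrizer.\<close>

lemma R_elt_C_eq_0:
  assumes g: "g \<in> SG n" and ab: "a \<in> {1..n}" "b \<in> {1..n}" "a \<noteq> b" "rw a = rw b"
    "cl' (ap (- g) a) = cl' (ap (- g) b)"
  shows "R * elt g * Csum n cl' = 0"
proof -
  define t where "t = Sp (transpose a b)"
  have ap_t: "ap t = transpose a b" unfolding t_def
    by (rule ap_Sp[OF permutes_swap_id[OF ab(1,2)]])
  have tn: "t \<in> SG n" using permutes_swap_id[OF ab(1,2)] by (simp add: SG_iff ap_t)
  have t: "t \<in> stab n rw" using tn ab by (auto simp: stab_def ap_t transpose_def)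
  \<comment> \<open>The conjugate is the transposition of the preimages of \<open>a\<close> and
    \<open>b\<close> under \<open>g\<close>, which carry the same label \<open>cl'\<close>.\<close>
  have s: "- g + t + g \<in> stab n cl'"
  proof -
    have "cl' (ap (- g + t + g) x) = cl' x" for x
    proof -
      have "ap g x = a \<Longrightarrow> x = ap (- g) a" "ap g x = b \<Longrightarrow> x = ap (- g) b" by auto
      then show ?thesis using ab by (auto simp: ap_plus ap_t transpose_def)
    qed
    then show ?thesis using g tn by (simp add: stab_def)
  qed
  have sg: "sgn_perm (- g + t + g) = -1"
  proof -
    have "sgn_perm t = -1" using ab by (simp add: sgn_perm_def ap_t sign_swap_id)
    then show ?thesis by (simp add: mult.commute)
  qed
  have "R * elt g * Csum n cl' = R * elt t * elt g * Csum n cl'" by (simp add: Rsum_elt[OF t])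
  also have "\<dots> = R * elt g * (elt (- g + t + g) * Csum n cl')"
    by (simp add: mult.assoc[symmetric] mult_single) (simp add: mult.assoc mult_single add.assoc)
  also have "\<dots> = smult (- 1) (R * elt g * Csum n cl')"
    by (simp only: elt_Csum[OF s] sg smult_simps)
  finally have "smult 2 (R * elt g * Csum n cl') = 0"
    by (metis add.commute add.right_inverse one_add_one smult_add_left smult_one smult_zero)
  then show ?thesis by (simp add: smult_eq_0)
qed

text \<open>If a term with \<open>g\<close> survives, the labels \<open>cl'\<close> moved by
  \<open>g\<close> are distinct within every row, so their total is at least that of
  \<open>cl\<close>; but moving labels does not change their total.\<close>

lemma R_C_orth:
  assumes cl': "(\<Sum>a\<in>{1..n}. cl' a) < (\<Sum>a\<in>{1..n}. cl a)" and x: "x \<in> galgebra (SG n)"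
  shows "R * x * Csum n cl' = 0"
proof -
  have z: "R * elt g * Csum n cl' = 0" if g: "g \<in> SG n" for g
  proof (rule ccontr)
    assume nz: "R * elt g * Csum n cl' \<noteq> 0"
    then have "(\<Sum>a\<in>{1..n}. cl a) \<le> (\<Sum>a\<in>{1..n}. cl' (ap (- g) a))"
      using R_elt_C_eq_0[OF g] by (intro row_sums(1)) blast
    also have "\<dots> = (\<Sum>a\<in>{1..n}. cl' a)"
      by (rule sum.permute[symmetric, unfolded comp_def]) (use SG.minus_mem[OF g] in \<open>simp add: SG_iff\<close>)
    finally show False using cl' by simp
  qed
  have "R * x * Csum n cl' = (\<Sum>g\<in>SG n. smult (Poly_Mapping.lookup x g) (R * elt g * Csum n cl'))"
    by (subst SG.expand[OF x]) (simp add: sum_distrib_left sum_distrib_right smult_simps)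
  also have "\<dots> = 0" by (rule sum.neutral) (simp add: z)
  finally show ?thesis .
qed

text \<open>If the product is nonzero, the column labels moved by \<open>g\<close> are distinct
  within each row and have the same total as \<open>cl\<close>, so each row carries exactly its own
  column indices. A row permutation P puts them in order, P g then preserves columns, and the
  product is sgn(P g) E.\<close>

lemma R_elt_C_ex:
  assumes g: "g \<in> SG n"
  shows "\<exists>c. R * elt g * C = smult c E"
proof (cases "R * elt g * C = 0")
  case True
  then show ?thesis by (intro exI[of _ 0]) simp
next
  case False
  define c where "c a = cl (ap (- g) a)" for a
  have mg: "- g \<in> SG n" using g by simp
  have cinj: "a = b" if "a \<in> {1..n}" "b \<in> {1..n}" "rw a = rw b" "c a = c b" for a b
    using R_elt_C_eq_0[OF g] False that by (auto simp: c_def)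
  have "(\<Sum>a\<in>{1..n}. cl a) = (\<Sum>a\<in>{1..n}. c a)" unfolding c_def
    by (rule sum.permute[unfolded comp_def]) (use mg in \<open>simp add: SG_iff\<close>)
  then have c_less: "c a < L (rw a)" if "a \<in> {1..n}" for a
    using row_sums(2)[of c, OF cinj] that by blast
  have ex: "\<exists>b. b \<in> {1..n} \<and> rw b = rw a \<and> cl b = c a" if "a \<in> {1..n}" for a
  proof -
    have "(rw a, c a) \<in> (\<lambda>a. (rw a, cl a)) ` {1..n}"
      using bij c_less[OF that] unfolding bij_betw_def by blast
    then obtain b where "(rw a, c a) = (rw b, cl b)" "b \<in> {1..n}" by (rule imageE)
    then show ?thesis by (intro exI[of _ b]) simp
  qed
  \<comment> \<open>\<open>p a\<close> is the entry in the row of \<open>a\<close> that stands in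
    column \<open>c a\<close>.\<close>
  define p where "p a = (if a \<in> {1..n} then SOME b. b \<in> {1..n} \<and> rw b = rw a \<and> cl b = c a else a)" for a
  have p: "p a \<in> {1..n}" "rw (p a) = rw a" "cl (p a) = c a" if "a \<in> {1..n}" for a
    using someI_ex[OF ex[OF that]] that unfolding p_def by simp_all
  have inj: "inj_on p {1..n}"
    by (rule inj_onI) (metis cinj p(2,3))
  have perm: "p permutes {1..n}"
  proof (rule bij_imp_permutes)
    show "bij_betw p {1..n} {1..n}"
      unfolding bij_betw_def using inj p(1) by (meson endo_inj_surj finite_atLeastAtMost image_subsetI)
  qed (auto simp: p_def)
  define P where "P = Sp p"
  have P: "ap P = p" using perm by (simp add: P_def ap_Sp)
  have Pr: "P \<in> stab n rw" using perm p by (auto simp: stab_def SG_iff P)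
  have Pg: "P + g \<in> stab n cl"
  proof -
    have "cl (ap (P + g) a) = cl a" if "a \<in> {1..n}" for a
    proof -
      have "ap g a \<in> {1..n}" using that g by (rule ap_in[rotated])
      then show ?thesis using p(3) by (simp add: ap_plus P c_def)
    qed
    then show ?thesis using Pr g by (simp add: stab_def)
  qed
  have "R * elt g * C = R * elt P * elt g * C" by (simp add: Rsum_elt[OF Pr])
  also have "\<dots> = R * (elt (P + g) * C)" by (simp add: mult.assoc[symmetric]) (simp add: mult.assoc mult_single)
  also have "\<dots> = smult (sgn_perm (P + g)) E" by (simp only: elt_Csum[OF Pg] smult_simps ysym_def)
  finally show ?thesis by blast
qed

text \<open>An entry is determined by its row and column, so the row and column stabilizers meet
  only in the identity, which therefore arises exactly once in the product.\<close>

lemma tau_E: "tau E = 1"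
proof -
  have triv: "g = 0" if "g \<in> stab n rw" "g \<in> stab n cl" for g
  proof (rule sperm_eqI)
    fix a show "ap g a = ap 0 a"
    proof (cases "a \<in> {1..n}")
      case True
      then have "ap g a \<in> {1..n}" using that(1) by (intro ap_in) (simp_all add: stab_def)
      moreover have "rw (ap g a) = rw a" "cl (ap g a) = cl a" using True that unfolding stab_def by blast+
      ultimately show ?thesis using inj[of "ap g a" a] True by simp
    next
      case False
      then show ?thesis using that(1) by (auto simp: stab_def SG_iff permutes_def)
    qed
  qed
  have "tau E = (\<Sum>g\<in>stab n rw. Poly_Mapping.lookup R g * Poly_Mapping.lookup C (- g))"
    unfolding ysym_def by (rule tau_times) (auto simp: in_keys_iff lookup_Rsum split: if_splits)
  also have "\<dots> = (\<Sum>g\<in>stab n rw. if g = 0 then 1 else 0)"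
  proof (intro sum.cong refl)
    fix g assume g: "g \<in> stab n rw"
    have "- g \<in> stab n cl \<Longrightarrow> g = 0" using triv[OF g] stab.minus_mem[of "- g" n cl] by simp
    then show "Poly_Mapping.lookup R g * Poly_Mapping.lookup C (- g) = (if g = 0 then 1 else 0)"
      using g by (auto simp: lookup_Rsum lookup_Csum)
  qed
  also have "\<dots> = 1" by simp
  finally show ?thesis .
qed

text \<open>The case of a single group element extends by linearity; as \<open>tau E = 1\<close>,
  applying \<open>tau\<close> reads off the scalar.\<close>

lemma R_C_sandwich:
  assumes x: "x \<in> galgebra (SG n)"
  shows "R * x * C = smult (tau (R * x * C)) E"
proof -
  obtain c where c: "\<And>g. g \<in> SG n \<Longrightarrow> R * elt g * C = smult (c g) E"
    using R_elt_C_ex by metis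
  have "R * x * C = (\<Sum>g\<in>SG n. smult (Poly_Mapping.lookup x g) (R * elt g * C))"
    by (subst SG.expand[OF x]) (simp add: sum_distrib_left sum_distrib_right smult_simps)
  also have "\<dots> = smult (\<Sum>g\<in>SG n. Poly_Mapping.lookup x g * c g) E"
    by (simp add: c cvs.scale_sum_left)
  finally show ?thesis using tau_E by (metis mult.right_neutral tau_smult)
qed

definition kappa where "kappa = tau (E * E)"

lemma E_square: "E * E = smult kappa E"
  using R_C_sandwich[of "C * R"] by (simp add: kappa_def ysym_def mult.assoc)

text \<open>The element between the outer R and C is now C x R; cyclicity of the trace then exposes
  the square of \<open>E\<close>.\<close>

lemma E_sandwich:
  assumes x: "x \<in> galgebra (SG n)"
  shows "E * x * E = smult (kappa * tau (x * E)) E"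
proof -
  have "E * x * E = smult (tau (E * x * E)) E"
    using R_C_sandwich[of "C * x * R"] x by (simp add: ysym_def mult.assoc)
  also have "tau (E * x * E) = tau (x * (E * E))"
    using tau_commute[of E "x * E"] by (simp add: mult.assoc)
  also have "\<dots> = kappa * tau (x * E)" by (simp add: E_square smult_simps)
  finally show ?thesis .
qed

text \<open>If \<open>kappa = 0\<close>, then the self-adjoint element \<open>R C R\<close> squares to zero, hence vanishes, hence
  so does \<open>(R C) (R C)\<^sup>*\<close>.\<close>

lemma kappa_nz: "kappa \<noteq> 0"
proof
  assume "kappa = 0"
  then have 0: "R * C * R * C = 0" using E_square by (simp add: ysym_def mult.assoc)
  have real: "real_coeffs R" "real_coeffs C"
    by (auto simp: real_coeffs_def lookup_Rsum lookup_Csum sgn_perm_def)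
  have "(R * C * R) * ginv (R * C * R) = R * C * (R * R) * C * R"
    by (simp add: ginv_times ginv_Rsum ginv_Csum mult.assoc)
  also have "\<dots> = smult (of_nat (card (stab n rw))) (R * C * R * C * R)"
    by (simp add: Rsum_Rsum smult_simps)
  also have "\<dots> = 0" by (simp add: 0)
  finally have W: "R * C * R = 0"
    using real by (intro tau_times_ginv_eq_0) (simp_all add: real_coeffs_times)
  have "E * ginv E = R * (C * C) * R"
    by (simp add: ysym_def ginv_times ginv_Rsum ginv_Csum mult.assoc)
  also have "\<dots> = 0" by (simp add: Csum_Csum smult_simps W)
  finally have "E = 0"
    using real by (intro tau_times_ginv_eq_0) (simp_all add: real_coeffs_times ysym_def)
  then show False using tau_E by simp
qed

end

text \<open>If the second filling has the smaller column total, the product already vanishes between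
  R and C'. Otherwise the inner factor C x R' is zero: it pairs to zero with every group element, by
  cyclicity of the trace and the vanishing of R' g C.\<close>

lemma filling_E_orth:
  assumes "filling n rw cl L" "filling n rw' cl' L'"
    and ne: "(\<Sum>a\<in>{1..n}. cl a) \<noteq> (\<Sum>a\<in>{1..n}. cl' a)" and x: "x \<in> galgebra (SG n)"
  shows "ysym n rw cl * x * ysym n rw' cl' = 0"
proof -
  interpret f: filling n rw cl L by fact
  interpret f': filling n rw' cl' L' by fact
  have eq: "f.E * x * f'.E = f.R * (f.C * x * f'.R) * f'.C" by (simp add: ysym_def mult.assoc)
  show ?thesis
  proof (cases "(\<Sum>a\<in>{1..n}. cl' a) < (\<Sum>a\<in>{1..n}. cl a)")
    case True
    then show ?thesis unfolding eq using x by (intro f.R_C_orth) simp_all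
  next
    case False
    have "f.C * x * f'.R = 0"
    proof (rule ccontr)
      assume "f.C * x * f'.R \<noteq> 0"
      then obtain g where g: "g \<in> SG n" "tau (elt g * (f.C * x * f'.R)) \<noteq> 0"
        using SG.tau_nondegenerate[of "f.C * x * f'.R" n] x by auto
      have "tau (elt g * (f.C * x * f'.R)) = tau ((f'.R * elt g * f.C) * x)"
        using tau_commute[of "elt g * f.C * x" "f'.R"] by (simp add: mult.assoc)
      moreover have "f'.R * elt g * f.C = 0"
        using False ne g by (intro f'.R_C_orth) simp_all
      ultimately show False using g by simp
    qed
    then show ?thesis unfolding eq by simp
  qed
qed

lemma lookup_conj: "Poly_Mapping.lookup (elt g * x * elt (- g)) h = Poly_Mapping.lookup x (- g + h + g)"
proof -
  have "Poly_Mapping.lookup (elt g * x * elt (- g)) h = tau (elt (- h) * (elt g * x * elt (- g)))"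
    by (simp only: tau_elt_times minus_minus)
  also have "\<dots> = tau (elt (- g) * (elt (- h) * elt g) * x)"
    using tau_commute[of "elt (- h) * elt g * x" "elt (- g)"] by (simp add: mult.assoc)
  also have "\<dots> = Poly_Mapping.lookup x (- g + h + g)"
    by (simp add: mult_single tau_elt_times minus_add add.assoc del: add_uminus_conv_diff)
  finally show ?thesis .
qed

text \<open>The permutation taking each entry to the entry in the same box of the other filling
  conjugates the row and column stabilizers into one another and preserves signs.\<close>

lemma filling_E_conj:
  assumes "filling n rw cl L" "filling n rw' cl' L"
  shows "\<exists>g\<in>SG n. ysym n rw' cl' = elt g * ysym n rw cl * elt (- g)"
proof -
  interpret f: filling n rw cl L by fact
  interpret f': filling n rw' cl' L by fact
  define p where "p a = (if a \<in> {1..n} then the_inv_into {1..n} (\<lambda>a. (rw' a, cl' a)) (rw a, cl a) else a)" for a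
  have "bij_betw (the_inv_into {1..n} (\<lambda>a. (rw' a, cl' a)) \<circ> (\<lambda>a. (rw a, cl a))) {1..n} {1..n}"
    using f.bij bij_betw_the_inv_into[OF f'.bij] by (rule bij_betw_trans)
  then have perm: "p permutes {1..n}"
    by (intro bij_imp_permutes) (subst bij_betw_cong, auto simp: p_def)
  define g where "g = Sp p"
  have ag: "ap g = p" using perm by (simp add: g_def ap_Sp)
  have g: "g \<in> SG n" using perm by (simp add: SG_iff ag)
  have pa: "rw' (ap g a) = rw a \<and> cl' (ap g a) = cl a" if "a \<in> {1..n}" for a
    using f_the_inv_into_f_bij_betw[OF f'.bij, of "(rw a, cl a)"] f.cl_less[OF that] that
    by (simp add: ag p_def)
  have st: "h \<in> stab n w' \<longleftrightarrow> - g + h + g \<in> stab n w"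
    if w: "\<And>a. a \<in> {1..n} \<Longrightarrow> w' (ap g a) = w a" for w w' :: "nat \<Rightarrow> nat" and h
  proof -
    have "h \<in> SG n \<longleftrightarrow> - g + h + g \<in> SG n"
    proof
      assume "- g + h + g \<in> SG n"
      then have "g + (- g + h + g) + - g \<in> SG n" using g by (meson SG.add_mem SG.minus_mem)
      moreover have "g + (- g + h + g) + - g = h" by (simp add: add.assoc)
      ultimately show "h \<in> SG n" by metis
    qed (use g in simp)
    moreover have "(\<forall>a\<in>{1..n}. w' (ap h a) = w' a) \<longleftrightarrow> (\<forall>a\<in>{1..n}. w (ap (- g + h + g) a) = w a)"
      if h: "h \<in> SG n"
    proof -
      have 1: "w (ap (- g + h + g) a) = w' (ap h (ap g a))" if a: "a \<in> {1..n}" for a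
      proof -
        have "ap (- g + h + g) a \<in> {1..n}"
          using g h a by (intro ap_in) simp_all
        from w[OF this] show ?thesis by (simp add: ap_plus)
      qed
      have 2: "(\<forall>a\<in>{1..n}. Q a) \<longleftrightarrow> (\<forall>a\<in>{1..n}. Q (ap g a))" for Q
        using g by (metis ap_mem ap_minus_ap(2))
      show ?thesis unfolding 2[of "\<lambda>a. w' (ap h a) = w' a"] using 1 w by simp
    qed
    ultimately show ?thesis unfolding stab_def by blast
  qed
  have stR: "h \<in> stab n rw' \<longleftrightarrow> - g + h + g \<in> stab n rw" for h by (rule st) (use pa in blast)
  have stC: "h \<in> stab n cl' \<longleftrightarrow> - g + h + g \<in> stab n cl" for h by (rule st) (use pa in blast)
  have R: "f'.R = elt g * f.R * elt (- g)"
    by (rule poly_mapping_eqI) (simp add: lookup_conj lookup_Rsum stR)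
  have C: "f'.C = elt g * f.C * elt (- g)"
    by (rule poly_mapping_eqI) (simp add: lookup_conj lookup_Csum stC mult.commute)
  have "f'.E = elt g * f.R * (elt (- g) * elt g) * f.C * elt (- g)"
    by (simp only: ysym_def R C mult.assoc)
  also have "\<dots> = elt g * f.E * elt (- g)"
    by (simp add: mult_single ysym_def mult.assoc)
  finally show ?thesis using g by blast
qed

text \<open>If k fixes n + 1 and k = p q with p preserving rows and q preserving columns, the
  preimage of n + 1 under p has both the row and the column of n + 1. So p and q fix n + 1, and the
  factorization takes place in the smaller group.\<close>

lemma lookup_ysym_Suc:
  assumes inj: "inj_on (\<lambda>a. (rw a, cl a)) {1..Suc n}" and k: "k \<in> SG n"
  shows "Poly_Mapping.lookup (ysym (Suc n) rw cl) k = Poly_Mapping.lookup (ysym n rw cl) k"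
proof -
  have st: "h \<in> stab (Suc n) w \<longleftrightarrow> h \<in> stab n w" if h: "h \<in> SG n" for h w
  proof -
    have "ap h (Suc n) = Suc n" using h by (auto simp: SG_iff permutes_def)
    then show ?thesis using h SG_mono[of n "Suc n"] by (auto simp: stab_def atLeastAtMostSuc_conv)
  qed
  have *: "p \<in> SG n" if p: "p \<in> stab (Suc n) rw" and q: "- p + k \<in> stab (Suc n) cl" for p
  proof -
    have kS: "ap k (Suc n) = Suc n" using k by (auto simp: SG_iff permutes_def)
    have mp: "- p \<in> stab (Suc n) rw" using p by simp
    let ?b = "ap (- p) (Suc n)"
    have b: "?b \<in> {1..Suc n}" using stab_SG[OF mp] by (intro ap_in) simp_all
    have "rw ?b = rw (Suc n)" using mp by (simp add: stab_def)
    moreover have "cl ?b = cl (Suc n)"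
    proof -
      have "cl (ap (- p + k) (Suc n)) = cl (Suc n)" using q by (simp add: stab_def)
      then show ?thesis by (simp add: ap_plus kS)
    qed
    ultimately have "?b = Suc n" using inj b by (auto simp: inj_on_def)
    then have "ap p (Suc n) = Suc n" by (metis ap_minus_ap(2))
    then have "\<And>x. x \<in> {1..Suc n} - {1..n} \<Longrightarrow> ap p x = x" by (auto simp: le_Suc_eq)
    with stab_SG[OF p] have "ap p permutes {1..n}"
      unfolding SG_iff by (rule permutes_superset)
    then show ?thesis by (simp add: SG_iff)
  qed
  have look: "Poly_Mapping.lookup (ysym m rw cl) k =
     (\<Sum>p\<in>stab m rw. if - p + k \<in> stab m cl then sgn_perm (- p + k) else 0)" for m
    unfolding ysym_def
    by (subst lookup_times[of "stab m rw"]) (auto simp: in_keys_iff lookup_Rsum lookup_Csum split: if_splits)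
  show ?thesis unfolding look
  proof (rule sum.mono_neutral_cong_right)
    show "stab n rw \<subseteq> stab (Suc n) rw" using st stab_SG by blast
    show "\<forall>p\<in>stab (Suc n) rw - stab n rw. (if - p + k \<in> stab (Suc n) cl then sgn_perm (- p + k) else 0) = 0"
      using * st by (metis DiffE)
    fix p assume "p \<in> stab n rw"
    then have "- p + k \<in> SG n" using k stab_SG by simp
    then show "(if - p + k \<in> stab (Suc n) cl then sgn_perm (- p + k) else 0) =
      (if - p + k \<in> stab n cl then sgn_perm (- p + k) else 0)" by (simp add: st)
  qed simp
qed

lemma tau_times_ysym_Suc:
  assumes inj: "inj_on (\<lambda>a. (rw a, cl a)) {1..Suc n}" and x: "x \<in> galgebra (SG n)"
  shows "tau (x * ysym (Suc n) rw cl) = tau (x * ysym n rw cl)"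
  using x by (subst (1 2) tau_times[of "SG n"]) (auto simp: galgebra_def lookup_ysym_Suc[OF inj])

section \<open>Standard tableaux\<close>

text \<open>Rows are padded with \<open>[]\<close>, so that adding a box to an existing row and opening a new row are
  the same update of \<open>rf\<close>.\<close>

definition rf :: "tableau \<Rightarrow> nat \<Rightarrow> nat list" where
  "rf T r = (if r < length T then T ! r else [])"

text \<open>No shape is prescribed. The column condition also bounds each row by the length of the
  row above, so that it forces the row lengths to decrease weakly.\<close>

definition syt :: "nat \<Rightarrow> tableau \<Rightarrow> bool" where
  "syt n T \<longleftrightarrow> [] \<notin> set T
     \<and> (\<forall>r c. Suc c < length (rf T r) \<longrightarrow> rf T r ! c < rf T r ! Suc c)
     \<and> (\<forall>r c. c < length (rf T (Suc r)) \<longrightarrow> c < length (rf T r) \<and> rf T r ! c < rf T (Suc r) ! c)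
     \<and> (\<Union>r. set (rf T r)) = {1..n}
     \<and> (\<forall>r r'. r \<noteq> r' \<longrightarrow> set (rf T r) \<inter> set (rf T r') = {})"

lemma sytD:
  assumes "syt n T"
  shows "[] \<notin> set T"
    "Suc c < length (rf T r) \<Longrightarrow> rf T r ! c < rf T r ! Suc c"
    "c < length (rf T (Suc r)) \<Longrightarrow> c < length (rf T r)"
    "c < length (rf T (Suc r)) \<Longrightarrow> rf T r ! c < rf T (Suc r) ! c"
    "(\<Union>r. set (rf T r)) = {1..n}"
    "a \<in> set (rf T r) \<Longrightarrow> a \<in> set (rf T r') \<Longrightarrow> r = r'"
  using assms unfolding syt_def by (simp_all add: disjoint_iff) blast

lemma rf_nth [simp]: "r < length T \<Longrightarrow> rf T r = T ! r" and rf_out [simp]: "length T \<le> r \<Longrightarrow> rf T r = []"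
  by (auto simp: rf_def)

lemma rf_Nil_iff: "[] \<notin> set T \<Longrightarrow> rf T r = [] \<longleftrightarrow> length T \<le> r"
  by (metis linorder_not_le nth_mem rf_nth rf_out)

lemma length_eq_rf: "[] \<notin> set T \<Longrightarrow> length T = (LEAST r. rf T r = [])"
  by (rule Least_equality[symmetric]) (auto simp: rf_Nil_iff)

lemma rf_inject: "[] \<notin> set S \<Longrightarrow> [] \<notin> set T \<Longrightarrow> rf S = rf T \<Longrightarrow> S = T"
proof -
  assume a: "[] \<notin> set S" "[] \<notin> set T" "rf S = rf T"
  have l: "length S = length T" 
    by (simp only: length_eq_rf[OF a(1)] length_eq_rf[OF a(2)] a(3))
  show "S = T"
  proof (rule nth_equalityI[OF l])
    fix i assume "i < length S"
    moreover have "rf S i = rf T i" by (simp only: a(3))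
    ultimately show "S ! i = T ! i" using l by simp
  qed
qed

lemma set_rf: "(\<Union>r. set (rf T r)) = set (concat T)"
proof -
  have "a \<in> (\<Union>r. set (rf T r)) \<longleftrightarrow> a \<in> set (concat T)" for a
    unfolding set_concat set_conv_nth[of T] by (auto simp: rf_def split: if_splits)
  then show ?thesis by blast
qed

lemma len_mono:
  assumes "syt n T" "r \<le> r'"
  shows "length (rf T r') \<le> length (rf T r)"
  using assms(2)
proof (induction rule: dec_induct)
  case (step m)
  have "length (rf T (Suc m)) \<le> length (rf T m)"
    using sytD(3)[OF assms(1)] by (meson linorder_not_le nat_less_le)
  then show ?case using step by simp
qed simp

lemma row_strict:
  assumes "syt n T"
  shows "sorted_wrt (<) (rf T r)"
  by (simp add: sorted_wrt_iff_nth_Suc_transp sytD(2)[OF assms])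

lemma row_distinct: "syt n T \<Longrightarrow> distinct (rf T r)"
  using row_strict strict_sorted_iff by blast

lemma syt_distinct_concat:
  assumes T: "syt n T"
  shows "distinct (concat T)"
  unfolding distinct_concat_iff
proof (intro conjI allI ballI impI)
  have "T ! r \<noteq> T ! r'" if r: "r < length T" "r' < length T" "r \<noteq> r'" for r r'
  proof
    assume eq: "T ! r = T ! r'"
    have "T ! r \<noteq> []" using sytD(1)[OF T] r(1) nth_mem by fastforce
    then have "hd (T ! r) \<in> set (rf T r)" "hd (T ! r) \<in> set (rf T r')" using eq r by simp_all
    then show False using sytD(6)[OF T] r(3) by blast
  qed
  then have "distinct T" by (auto simp: distinct_conv_nth)
  then show "distinct (removeAll [] T)" by (rule distinct_removeAll)
  fix ys assume "ys \<in> set T"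
  then show "distinct ys" using row_distinct[OF T] by (metis in_set_conv_nth rf_nth)
next
  fix ys zs assume "ys \<in> set T \<and> zs \<in> set T \<and> ys \<noteq> zs"
  then obtain r r' where r: "ys = rf T r" "zs = rf T r'" "r \<noteq> r'"
    by (metis in_set_conv_nth rf_nth)
  show "set ys \<inter> set zs = {}" using sytD(6)[OF T] r by blast
qed

lemma syt_set_concat: "syt n T \<Longrightarrow> set (concat T) = {1..n}"
  using sytD(5)[of n T] unfolding set_rf by blast

lemma SYT_eq:
  assumes "is_partition n \<rho>"
  shows "SYT \<rho> = {T. syt n T \<and> shape T = \<rho>}"
proof -
  have n: "sum_mset \<rho> = n" and z: "0 \<notin># \<rho>" using assms by (auto simp: is_partition_def)
  have "T \<in> SYT \<rho> \<longleftrightarrow> syt n T \<and> shape T = \<rho>" for T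
  proof
    assume T: "T \<in> SYT \<rho>"
    then have ml: "map length T = rev (sorted_list_of_multiset \<rho>)" and d: "distinct (concat T)"
      and s: "set (concat T) = {1..n}"
      and r: "\<And>r c. r < length T \<Longrightarrow> Suc c < length (T ! r) \<Longrightarrow> T ! r ! c < T ! r ! Suc c"
      and c: "\<And>r c. Suc r < length T \<Longrightarrow> c < length (T ! Suc r) \<Longrightarrow> T ! r ! c < T ! Suc r ! c"
      by (auto simp: SYT_def n)
    have sh: "shape T = \<rho>" using ml by (simp add: shape_def)
    have ne: "[] \<notin> set T" using z sh by (force simp: shape_def)
    have "sorted (rev (map length T))" by (simp add: ml)
    then have len: "length (T ! Suc r) \<le> length (T ! r)" if "Suc r < length T" for r
      using that sorted_rev_nth_mono[of "map length T" r "Suc r"] by simp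
    have disj: "set (rf T r) \<inter> set (rf T r') = {}" if "r < length T" "r' < length T" "r \<noteq> r'" for r r'
    proof -
      have dl: "distinct T" using d ne by (simp add: distinct_concat_iff removeAll_id)
      then have "T ! r \<noteq> T ! r'" using that by (simp add: nth_eq_iff_index_eq)
      then show ?thesis using d that by (simp add: distinct_concat_iff)
    qed
    have "syt n T" unfolding syt_def set_rf
    proof (intro conjI allI impI)
      fix r c assume "Suc c < length (rf T r)"
      then show "rf T r ! c < rf T r ! Suc c" using r by (simp add: rf_def split: if_splits)
    next
      fix r c assume "c < length (rf T (Suc r))"
      then show "c < length (rf T r)" "rf T r ! c < rf T (Suc r) ! c"
        using c len[of r] by (auto simp: rf_def split: if_splits)
    next
      fix r r' :: nat assume "r \<noteq> r'"
      then show "set (rf T r) \<inter> set (rf T r') = {}"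
        using disj[of r r'] by (cases "r < length T"; cases "r' < length T") auto
    qed (use ne s in auto)
    then show "syt n T \<and> shape T = \<rho>" using sh by blast
  next
    assume T: "syt n T \<and> shape T = \<rho>"
    then have T: "syt n T" "shape T = \<rho>" by simp_all
    have "sorted (rev (map length T))"
      unfolding sorted_rev_iff_nth_mono
    proof (intro allI impI)
      fix i j assume ij: "i \<le> j" "j < length (map length T)"
      then show "map length T ! j \<le> map length T ! i" using len_mono[OF T(1) ij(1)] by simp
    qed
    then have "sort (map length T) = rev (map length T)"
      by (intro properties_for_sort) simp_all
    then have "rev (map length T) = sorted_list_of_multiset \<rho>"
      using T(2) by (metis shape_def sorted_list_of_multiset_mset)
    then have ml: "map length T = rev (sorted_list_of_multiset \<rho>)" by (metis rev_rev_ident)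
    show "T \<in> SYT \<rho>"
      unfolding SYT_def n mem_Collect_eq
    proof (intro conjI ml allI impI)
      show "distinct (concat T)" "set (concat T) = {1..n}"
        using T(1) syt_distinct_concat syt_set_concat by blast+
      fix r c assume "r < length T" "Suc c < length (T ! r)"
      then show "T ! r ! c < T ! r ! Suc c" using sytD(2)[OF T(1), of c r] by simp
    next
      fix r c assume "Suc r < length T" "c < length (T ! Suc r)"
      then show "T ! r ! c < T ! Suc r ! c" using sytD(4)[OF T(1), of c r] by simp
    qed
  qed
  then show ?thesis by blast
qed

lemma syt_is_partition:
  assumes T: "syt n T"
  shows "is_partition n (shape T)"
proof -
  have "length (concat T) = n"
    using distinct_card[OF syt_distinct_concat[OF T]] by (simp only: syt_set_concat[OF T]) simp
  then have "sum_mset (shape T) = n" 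
    by (simp add: shape_def length_concat sum_mset_sum_list del: mset_map)
  moreover have "0 \<notin># shape T" using sytD(1)[OF T] by (auto simp: shape_def)
  ultimately show ?thesis by (simp add: is_partition_def)
qed

section \<open>Adding and removing the largest entry\<close>

definition add_entry :: "nat \<Rightarrow> tableau \<Rightarrow> nat \<Rightarrow> tableau" where
  "add_entry x S r = (if r < length S then S[r := S ! r @ [x]] else S @ [[x]])"

lemma rf_add_entry: "r \<le> length S \<Longrightarrow> rf (add_entry x S r) = (rf S)(r := rf S r @ [x])"
  by (auto simp: rf_def add_entry_def fun_eq_iff nth_append nth_list_update)

text \<open>The rows where a box can be added; \<open>r = length S\<close> stands for a new row,
  which has length 0 because of the padding.\<close>

definition addable :: "tableau \<Rightarrow> nat \<Rightarrow> bool" where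
  "addable S r \<longleftrightarrow> r \<le> length S \<and> (\<forall>q<r. length (rf S r) < length (rf S q))"

lemma add_entry_no_Nil: "[] \<notin> set S \<Longrightarrow> [] \<notin> set (add_entry x S r)"
  by (auto simp: add_entry_def dest!: set_update_subset_insert[THEN subsetD])

lemma syt_mem: "syt n S \<Longrightarrow> a \<in> set (rf S r) \<Longrightarrow> a \<in> {1..n}"
  using sytD(5)[of n S] by blast

lemma syt_less: "syt n S \<Longrightarrow> a \<in> set (rf S r) \<Longrightarrow> a < Suc n"
  using syt_mem[of n S a r] by simp

lemma add_entry_syt:
  assumes S: "syt n S" and r: "addable S r"
  shows "syt (Suc n) (add_entry (Suc n) S r)"
proof -
  have rl: "r \<le> length S" using r by (simp add: addable_def)
  have lt: "c < length (rf S q) \<Longrightarrow> rf S q ! c < Suc n" for c q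
    using syt_less[OF S] nth_mem by blast
  have D: "\<And>c r. Suc c < length (rf S r) \<Longrightarrow> rf S r ! c < rf S r ! Suc c"
    "\<And>c r. c < length (rf S (Suc r)) \<Longrightarrow> c < length (rf S r)"
    "\<And>c r. c < length (rf S (Suc r)) \<Longrightarrow> rf S r ! c < rf S (Suc r) ! c"
    using sytD[OF S] by simp_all
  show ?thesis unfolding syt_def rf_add_entry[OF rl]
  proof (intro conjI allI impI)
    show "[] \<notin> set (add_entry (Suc n) S r)" using sytD(1)[OF S] by (rule add_entry_no_Nil)
  next
    fix q c assume "Suc c < length (((rf S)(r := rf S r @ [Suc n])) q)"
    then show "((rf S)(r := rf S r @ [Suc n])) q ! c < ((rf S)(r := rf S r @ [Suc n])) q ! Suc c"
      using D(1) lt by (auto simp: nth_append less_Suc_eq split: if_splits)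
  next
    fix q c assume c: "c < length (((rf S)(r := rf S r @ [Suc n])) (Suc q))"
    show "c < length (((rf S)(r := rf S r @ [Suc n])) q)"
    proof (cases "Suc q = r")
      case True
      then have "length (rf S r) < length (rf S q)" using r by (auto simp: addable_def simp del: rf_nth)
      then show ?thesis using True c by auto
    qed (use c D(2)[of c q] in \<open>auto split: if_splits\<close>)
    show "((rf S)(r := rf S r @ [Suc n])) q ! c < ((rf S)(r := rf S r @ [Suc n])) (Suc q) ! c"
    proof (cases "Suc q = r")
      case True
      then have "length (rf S r) < length (rf S q)" using r by (auto simp: addable_def simp del: rf_nth)
      then show ?thesis using True c D(3)[of c q] lt[of c q] by (auto simp: nth_append)
    qed (use c D(2)[of c q] D(3)[of c q] in \<open>auto simp: nth_append split: if_splits\<close>)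
  next
    have "(\<Union>q. set (((rf S)(r := rf S r @ [Suc n])) q)) = insert (Suc n) (\<Union>q. set (rf S q))"
      by (auto split: if_splits)
    then show "(\<Union>q. set (((rf S)(r := rf S r @ [Suc n])) q)) = {1..Suc n}"
      using sytD(5)[OF S] by auto
  next
    fix q q' :: nat assume "q \<noteq> q'"
    then show "set (((rf S)(r := rf S r @ [Suc n])) q) \<inter> set (((rf S)(r := rf S r @ [Suc n])) q') = {}"
      using sytD(6)[OF S] syt_less[OF S] by (auto split: if_splits) blast+
  qed
qed

lemma remove_add_entry:
  assumes S: "syt n S" and r: "r \<le> length S"
  shows "remove_entry (Suc n) (add_entry (Suc n) S r) = S"
proof -
  have f: "filter (\<lambda>x. x \<noteq> Suc n) row = row" if "row \<in> set S" for row
    using that syt_set_concat[OF S] by (intro filter_True) (force simp: set_concat)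
  have m: "map (filter (\<lambda>x. x \<noteq> Suc n)) S = S" using f by (simp add: map_idI)
  have ne: "filter (\<lambda>row. row \<noteq> []) S = S" using sytD(1)[OF S] by (intro filter_True) auto
  show ?thesis
    using r f[of "S ! r"] by (auto simp: remove_entry_def add_entry_def map_update m ne)
qed

text \<open>Entries increase along rows and down columns, so the largest one ends its row and has no
  box below it.\<close>

lemma ex_add_entry:
  assumes T: "syt (Suc n) T"
  shows "\<exists>S r. syt n S \<and> addable S r \<and> T = add_entry (Suc n) S r"
proof -
  obtain r where r: "Suc n \<in> set (rf T r)" using sytD(5)[OF T] by (auto simp: set_eq_iff)
  then obtain us where us: "rf T r = us @ [Suc n]"
  proof -
    obtain us vs where uv: "rf T r = us @ Suc n # vs" using r by (meson split_list)
    have "v \<le> Suc n" if "v \<in> set vs" for v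
      using syt_mem[OF T, of v r] that uv by simp
    moreover have "Suc n < v" if "v \<in> set vs" for v
      using row_strict[OF T, of r] that by (auto simp: uv sorted_wrt_append)
    ultimately have "vs = []" by (metis hd_in_set linorder_not_le)
    then show thesis using uv that by simp
  qed
  have rT: "r < length T" using us by (metis append_is_Nil_conv linorder_not_le not_Cons_self2 rf_out)
  have nx: "rf T q = us' \<Longrightarrow> q \<noteq> r \<Longrightarrow> Suc n \<notin> set us'" for q us' using sytD(6)[OF T _ r] by blast
  have dist: "Suc n \<notin> set us" using row_distinct[OF T, of r] by (simp add: us)
  have below: "length (rf T (Suc r)) \<le> length us"
  proof (rule ccontr)
    assume "\<not> ?thesis"
    then have c: "length us < length (rf T (Suc r))" by simp
    then have "rf T r ! length us < rf T (Suc r) ! length us" by (rule sytD(4)[OF T])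
    then have "Suc n < rf T (Suc r) ! length us" by (simp add: us)
    moreover have "rf T (Suc r) ! length us \<in> {1..Suc n}" using syt_mem[OF T nth_mem[OF c]] .
    ultimately show False by simp
  qed
  \<comment> \<open>A row consisting of the largest entry alone is the last row; it is dropped, as
    empty rows are excluded.\<close>
  define S where "S = (if us = [] then butlast T else T[r := us])"
  have lS: "r \<le> length S" and rS: "rf S = (rf T)(r := us)"
  proof -
    have *: "length T = Suc r" if "us = []"
      using below that rT rf_Nil_iff[OF sytD(1)[OF T], of "Suc r"] by simp
    show "r \<le> length S" using * rT by (auto simp: S_def)
    show "rf S = (rf T)(r := us)" using * rT
      by (auto simp: S_def rf_def fun_eq_iff nth_butlast nth_list_update)
  qed
  have nS: "[] \<notin> set S"
  proof (cases "us = []")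
    case True
    then show ?thesis using sytD(1)[OF T] by (auto simp: S_def dest: in_set_butlastD)
  next
    case False
    then show ?thesis using sytD(1)[OF T]
      by (auto simp: S_def dest!: set_update_subset_insert[THEN subsetD])
  qed
  have Teq: "T = add_entry (Suc n) S r"
    by (rule rf_inject) (use sytD(1)[OF T] nS us in \<open>auto simp: add_entry_no_Nil rf_add_entry[OF lS] rS fun_eq_iff\<close>)
  have add: "addable S r" unfolding addable_def
  proof (intro conjI allI impI lS)
    fix q assume q: "q < r"
    have "length (rf T r) \<le> length (rf T q)" using len_mono[OF T] q by simp
    then show "length (rf S r) < length (rf S q)" using q by (simp add: rS us)
  qed
  have D: "\<And>c r. Suc c < length (rf T r) \<Longrightarrow> rf T r ! c < rf T r ! Suc c"
    "\<And>c r. c < length (rf T (Suc r)) \<Longrightarrow> c < length (rf T r)"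
    "\<And>c r. c < length (rf T (Suc r)) \<Longrightarrow> rf T r ! c < rf T (Suc r) ! c"
    using sytD[OF T] by simp_all
  have "syt n S" unfolding syt_def rS
  proof (intro conjI allI impI nS)
    fix q c assume "Suc c < length (((rf T)(r := us)) q)"
    then show "((rf T)(r := us)) q ! c < ((rf T)(r := us)) q ! Suc c"
      using D(1)[of c q] by (auto simp: us nth_append split: if_splits)
  next
    fix q c assume c: "c < length (((rf T)(r := us)) (Suc q))"
    show "c < length (((rf T)(r := us)) q)"
      using c below D(2)[of c q] by (auto simp: us split: if_splits)
    show "((rf T)(r := us)) q ! c < ((rf T)(r := us)) (Suc q) ! c"
      using c below D(3)[of c q] by (auto simp: us nth_append split: if_splits)
  next
    have "(\<Union>q. set (((rf T)(r := us)) q)) = (\<Union>q. set (rf T q)) - {Suc n}"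
      using nx dist us by (auto split: if_splits) (metis UnE empty_iff insert_iff list.set(1,2) set_append us)+
    then show "(\<Union>q. set (((rf T)(r := us)) q)) = {1..n}" using sytD(5)[OF T] by auto
  next
    fix q q' :: nat assume qq: "q \<noteq> q'"
    have sub: "set (((rf T)(r := us)) q) \<subseteq> set (rf T q)" for q by (auto simp: us)
    show "set (((rf T)(r := us)) q) \<inter> set (((rf T)(r := us)) q') = {}"
      using sytD(6)[OF T] sub qq by blast
  qed
  then show ?thesis using add Teq by blast
qed

section \<open>Counting standard tableaux\<close>

text \<open>For \<open>l = 0\<close> this adds a new part \<open>1\<close>, as a partition has no part \<open>0\<close>.\<close>

definition inc_part :: "nat \<Rightarrow> nat multiset \<Rightarrow> nat multiset" where
  "inc_part l \<sigma> = add_mset (Suc l) (\<sigma> - {#l#})"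

text \<open>The lengths of rows that can be extended, with 0 for the empty row. Among rows of equal
  length only the top one can grow, so distinct lengths correspond to the addable boxes.\<close>

definition parts0 :: "nat multiset \<Rightarrow> nat set" where
  "parts0 \<sigma> = insert 0 (set_mset \<sigma>)"

lemma finite_parts0 [simp]: "finite (parts0 \<sigma>)"
  by (simp add: parts0_def)

lemma inc_part_partition: "is_partition n \<sigma> \<Longrightarrow> l \<in> parts0 \<sigma> \<Longrightarrow> is_partition (Suc n) (inc_part l \<sigma>)"
  by (auto simp: is_partition_def inc_part_def parts0_def diff_single_trivial sum_mset.remove dest: in_diffD)

lemma dec_part_partition: "is_partition (Suc n) \<rho> \<Longrightarrow> k \<in># \<rho> \<Longrightarrow> is_partition n (dec_part k \<rho>)"
  by (cases k) (auto simp: is_partition_def dec_part_def sum_mset.remove dest: in_diffD)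

lemma dec_inc_part: "0 \<notin># \<sigma> \<Longrightarrow> l \<in> parts0 \<sigma> \<Longrightarrow> dec_part (Suc l) (inc_part l \<sigma>) = \<sigma>"
  by (auto simp: dec_part_def inc_part_def parts0_def diff_single_trivial)

lemma inc_dec_part:
  assumes "0 \<notin># \<rho>" "Suc l \<in># \<rho>"
  shows "inc_part l (dec_part (Suc l) \<rho>) = \<rho>" "l \<in> parts0 (dec_part (Suc l) \<rho>)"
proof -
  have "0 \<notin># \<rho> - {#Suc 0#}" using assms by (auto dest: in_diffD)
  then show "inc_part l (dec_part (Suc l) \<rho>) = \<rho>"
    using assms by (auto simp: dec_part_def inc_part_def diff_single_trivial)
  show "l \<in> parts0 (dec_part (Suc l) \<rho>)" by (auto simp: dec_part_def parts0_def)
qed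

text \<open>The condition on \<open>l\<close> says that a row of length \<open>l\<close> is still
  there after one row of length \<open>k\<close> has been taken away, so the two operations act on
  different rows.\<close>

lemma dec_inc_commute:
  assumes "0 \<notin># \<sigma>" "k \<in># \<sigma>" "l = 0 \<or> l \<in># \<sigma> - {#k#}" "k \<noteq> Suc l"
  shows "dec_part k (inc_part l \<sigma>) = inc_part l (dec_part k \<sigma>)"
proof -
  obtain m where k: "k = Suc m" using assms by (cases k) auto
  obtain \<tau> where \<tau>: "\<sigma> = add_mset k \<tau>" using assms(2) by (metis insert_DiffM)
  have 0: "0 \<notin># \<tau>" using assms \<tau> by auto
  show ?thesis
  proof (cases "l = 0")
    case True
    then show ?thesis using assms 0 by (auto simp: \<tau> k dec_part_def inc_part_def diff_single_trivial)
  next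
    case False
    then obtain \<upsilon> where "\<tau> = add_mset l \<upsilon>" using assms \<tau> by (metis add_mset_remove_trivial insert_DiffM)
    then show ?thesis using assms by (auto simp: \<tau> k dec_part_def inc_part_def)
  qed
qed

lemma shape_add_entry:
  assumes "[] \<notin> set S" "r \<le> length S"
  shows "shape (add_entry x S r) = inc_part (length (rf S r)) (shape S)"
proof (cases "r < length S")
  case True
  then show ?thesis
    by (simp add: shape_def add_entry_def inc_part_def map_update mset_update del: mset_map)
next
  case False
  moreover have "0 \<notin># shape S" using assms by (auto simp: shape_def)
  ultimately show ?thesis
    using assms by (simp add: shape_def add_entry_def inc_part_def diff_single_trivial)
qed

text \<open>For \<open>l\<close> in \<open>parts0\<close> this is the top row of length
  \<open>l\<close>, the one of that length that can be extended.\<close>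

definition rix :: "tableau \<Rightarrow> nat \<Rightarrow> nat" where
  "rix S l = (LEAST r. length (rf S r) \<le> l)"

lemma rix:
  assumes S: "syt n S" and l: "l \<in> parts0 (shape S)"
  shows "length (rf S (rix S l)) = l" "addable S (rix S l)"
proof -
  obtain r0 where r0: "length (rf S r0) = l" "r0 \<le> length S"
  proof (cases "l = 0")
    case True
    then show thesis using that[of "length S"] by simp
  next
    case False
    then obtain row where "row \<in> set S" "length row = l" using l by (auto simp: parts0_def shape_def)
    then obtain i where "i < length S" "length (S ! i) = l" by (auto simp: in_set_conv_nth)
    then show thesis using that[of i] by simp
  qed
  have le: "length (rf S (rix S l)) \<le> l" unfolding rix_def by (rule LeastI[of _ r0]) (simp add: r0)
  have min: "l < length (rf S q)" if "q < rix S l" for q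
    using not_less_Least[of q "\<lambda>r. length (rf S r) \<le> l"] that unfolding rix_def by simp
  have "rix S l \<le> r0" unfolding rix_def by (rule Least_le) (simp add: r0)
  then have "l \<le> length (rf S (rix S l))" using len_mono[OF S, of "rix S l" r0] r0 by simp
  then show *: "length (rf S (rix S l)) = l" using le by simp
  show "addable S (rix S l)"
    unfolding addable_def using \<open>rix S l \<le> r0\<close> r0 min * by auto
qed

lemma addable_rix:
  assumes "addable S r" "[] \<notin> set S"
  shows "r = rix S (length (rf S r))" "length (rf S r) \<in> parts0 (shape S)"
proof -
  show "r = rix S (length (rf S r))" unfolding rix_def
  proof (rule Least_equality[symmetric])
    fix y assume "length (rf S y) \<le> length (rf S r)"
    then show "r \<le> y" using assms(1) unfolding addable_def by (meson linorder_not_le)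
  qed simp
  show "length (rf S r) \<in> parts0 (shape S)"
    by (cases "r < length S") (auto simp: parts0_def shape_def)
qed

text \<open>Children are indexed by the length of the extended row, which is what the shape records;
  it is also the column, counted from 0, of the new box.\<close>

definition child :: "nat \<Rightarrow> tableau \<Rightarrow> nat \<Rightarrow> tableau" where
  "child n S l = add_entry (Suc n) S (rix S l)"

context
  fixes n S l assumes S: "syt n S" and l: "l \<in> parts0 (shape S)"
begin

lemma rix_le: "rix S l \<le> length S"
  using rix(2)[OF S l] by (simp add: addable_def)

lemma child_syt: "syt (Suc n) (child n S l)"
  unfolding child_def using S rix(2)[OF S l] by (rule add_entry_syt)

lemma remove_child: "remove_entry (Suc n) (child n S l) = S"
  unfolding child_def using S rix_le by (rule remove_add_entry)

lemma shape_child: "shape (child n S l) = inc_part l (shape S)"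
  unfolding child_def using shape_add_entry[OF sytD(1)[OF S] rix_le] rix(1)[OF S l] by simp

lemma rf_child: "rf (child n S l) = (rf S)(rix S l := rf S (rix S l) @ [Suc n])"
  unfolding child_def by (rule rf_add_entry[OF rix_le])

lemma child_end: "(\<exists>row\<in>set (child n S l). length row = k \<and> last row = Suc n) \<longleftrightarrow> k = Suc l"
proof
  assume "\<exists>row\<in>set (child n S l). length row = k \<and> last row = Suc n"
  then obtain row where row: "row \<in> set (child n S l)" "length row = k" "last row = Suc n" by blast
  then obtain q where q: "row = rf (child n S l) q" by (metis in_set_conv_nth rf_nth)
  have "row \<noteq> []" using row(1) sytD(1)[OF child_syt] by blast
  then have mem: "Suc n \<in> set (rf (child n S l) q)" using row q by (metis last_in_set)
  have "q = rix S l"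
  proof (rule ccontr)
    assume "q \<noteq> rix S l"
    then have "Suc n \<in> set (rf S q)" using mem by (simp add: rf_child)
    then show False using syt_less[OF S] by blast
  qed
  then show "k = Suc l" using row(2) q rix(1)[OF S l] by (simp add: rf_child)
next
  assume k: "k = Suc l"
  let ?row = "rf (child n S l) (rix S l)"
  have row: "?row = rf S (rix S l) @ [Suc n]" by (simp add: rf_child)
  have "?row \<in> set (child n S l)"
    by (metis append_is_Nil_conv linorder_not_le not_Cons_self2 nth_mem rf_nth rf_out row)
  then show "\<exists>row\<in>set (child n S l). length row = k \<and> last row = Suc n"
    using row k rix(1)[OF S l] by (intro bexI[of _ ?row]) simp_all
qed

end

lemma ex_child:
  assumes "syt (Suc n) T"
  shows "\<exists>S l. syt n S \<and> l \<in> parts0 (shape S) \<and> T = child n S l"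
proof -
  obtain S r where S: "syt n S" "addable S r" "T = add_entry (Suc n) S r"
    using ex_add_entry[OF assms] by blast
  then show ?thesis using addable_rix[OF S(2) sytD(1)[OF S(1)]] unfolding child_def by metis
qed

lemma child_inj:
  assumes "syt n S" "l \<in> parts0 (shape S)" "syt n S'" "l' \<in> parts0 (shape S')" "child n S l = child n S' l'"
  shows "S = S' \<and> l = l'"
proof -
  have "S = S'" using remove_child[OF assms(1,2)] remove_child[OF assms(3,4)] assms(5) by simp
  moreover have "Suc l = Suc l'"
    using child_end[OF assms(1,2), of "Suc l"] child_end[OF assms(3,4), of "Suc l"] assms(5) by simp
  ultimately show ?thesis by simp
qed

lemma syt_0: "syt 0 T \<longleftrightarrow> T = []"
proof
  assume T: "syt 0 T"
  show "T = []"
  proof (rule ccontr)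
    assume "T \<noteq> []"
    then have "hd T \<in> set T" by simp
    then show False using syt_set_concat[OF T] sytD(1)[OF T] by (auto simp: set_concat)
  qed
qed (simp add: syt_def rf_def)

definition TT :: "nat \<Rightarrow> tableau set" where "TT n = {T. syt n T}"

lemma child_bij: "bij_betw (\<lambda>(S, l). child n S l) (SIGMA S:TT n. parts0 (shape S)) (TT (Suc n))"
proof (rule bij_betwI')
  fix p q assume "p \<in> (SIGMA S:TT n. parts0 (shape S))" "q \<in> (SIGMA S:TT n. parts0 (shape S))"
  then show "((case p of (S, l) \<Rightarrow> child n S l) = (case q of (S, l) \<Rightarrow> child n S l)) = (p = q)"
    using child_inj by (auto simp: TT_def)
next
  fix p assume "p \<in> (SIGMA S:TT n. parts0 (shape S))"
  then show "(case p of (S, l) \<Rightarrow> child n S l) \<in> TT (Suc n)" using child_syt by (auto simp: TT_def)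
next
  fix T assume "T \<in> TT (Suc n)"
  then show "\<exists>p\<in>SIGMA S:TT n. parts0 (shape S). T = (case p of (S, l) \<Rightarrow> child n S l)"
    using ex_child[of n T] by (auto simp: TT_def)
qed

lemma finite_TT [simp]: "finite (TT n)"
proof (induction n)
  case 0
  then show ?case by (simp add: TT_def syt_0)
next
  case (Suc n)
  then have "finite (SIGMA S:TT n. parts0 (shape S))" by simp
  then show ?case using bij_betw_finite[OF child_bij] by blast
qed

lemma SYT_TT: "is_partition n \<rho> \<Longrightarrow> SYT \<rho> = {T \<in> TT n. shape T = \<rho>}"
  by (simp add: SYT_eq TT_def)

lemma finite_SYT: "is_partition n \<rho> \<Longrightarrow> finite (SYT \<rho>)"
  by (simp add: SYT_TT)

text \<open>Deleting the largest entry inverts the map. Parts are positive, so \<open>k - 1\<close>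
  is the length of the row before its last box was added.\<close>

lemma SYT_end_eq:
  assumes \<rho>: "is_partition (Suc n) \<rho>" and k: "k \<in># \<rho>"
  shows "SYT_end (Suc n) \<rho> k = (\<lambda>S. child n S (k - 1)) ` SYT (dec_part k \<rho>)"
    and "inj_on (\<lambda>S. child n S (k - 1)) (SYT (dec_part k \<rho>))"
proof -
  have 0: "0 \<notin># \<rho>" using \<rho> by (simp add: is_partition_def)
  then obtain l where kl: "k = Suc l" using k by (cases k) auto
  have dp: "is_partition n (dec_part k \<rho>)" by (rule dec_part_partition[OF \<rho> k])
  have l: "syt n S \<Longrightarrow> shape S = dec_part k \<rho> \<Longrightarrow> l \<in> parts0 (shape S)" for S
    using inc_dec_part(2)[OF 0, of l] k kl by simp
  show "inj_on (\<lambda>S. child n S (k - 1)) (SYT (dec_part k \<rho>))"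
  proof (rule inj_onI)
    fix S S' assume SS: "S \<in> SYT (dec_part k \<rho>)" "S' \<in> SYT (dec_part k \<rho>)" "child n S (k - 1) = child n S' (k - 1)"
    then have S: "syt n S" "syt n S'" "l \<in> parts0 (shape S)" "l \<in> parts0 (shape S')"
      using l[of S] l[of S'] by (simp_all add: SYT_eq[OF dp])
    show "S = S'" using child_inj[OF S(1,3,2,4)] SS(3) kl by simp
  qed
  show "SYT_end (Suc n) \<rho> k = (\<lambda>S. child n S (k - 1)) ` SYT (dec_part k \<rho>)"
  proof (intro equalityI subsetI)
    fix T assume T: "T \<in> SYT_end (Suc n) \<rho> k"
    then have "syt (Suc n) T" "shape T = \<rho>" by (auto simp: SYT_end_def SYT_eq[OF \<rho>])
    then obtain S m where S: "syt n S" "m \<in> parts0 (shape S)" "T = child n S m" using ex_child by blast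
    then have "k = Suc m" using T child_end[OF S(1,2), of k] by (simp add: SYT_end_def)
    moreover have "shape S = dec_part (Suc m) \<rho>"
      using \<open>shape T = \<rho>\<close> S shape_child[OF S(1,2)] dec_inc_part[OF _ S(2)] syt_is_partition[OF S(1)]
      by (simp add: is_partition_def)
    ultimately have "S \<in> SYT (dec_part k \<rho>)" "T = child n S (k - 1)"
      unfolding SYT_eq[OF dp] using S by simp_all
    then show "T \<in> (\<lambda>S. child n S (k - 1)) ` SYT (dec_part k \<rho>)" by blast
  next
    fix T assume "T \<in> (\<lambda>S. child n S (k - 1)) ` SYT (dec_part k \<rho>)"
    then obtain S where S: "syt n S" "shape S = dec_part k \<rho>" "T = child n S l"
      unfolding SYT_eq[OF dp] using kl by auto
    note lS = l[OF S(1,2)]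
    have "shape T = \<rho>" using shape_child[OF S(1) lS] S inc_dec_part(1)[OF 0, of l] k kl by simp
    then show "T \<in> SYT_end (Suc n) \<rho> k"
      using child_syt[OF S(1) lS] child_end[OF S(1) lS, of k] S kl by (simp add: SYT_end_def SYT_eq[OF \<rho>])
  qed
qed

lemma card_SYT_end:
  "is_partition (Suc n) \<rho> \<Longrightarrow> k \<in># \<rho> \<Longrightarrow> card (SYT_end (Suc n) \<rho> k) = num_SYT (dec_part k \<rho>)"
  using SYT_end_eq[of n \<rho> k] by (simp add: card_image num_SYT_def)

lemma SYT_UN_end:
  assumes \<rho>: "is_partition (Suc n) \<rho>"
  shows "SYT \<rho> = (\<Union>k\<in>set_mset \<rho>. SYT_end (Suc n) \<rho> k)"
proof (intro equalityI subsetI)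
  fix T assume T: "T \<in> SYT \<rho>"
  then obtain S m where S: "syt n S" "m \<in> parts0 (shape S)" "T = child n S m"
    using ex_child[of n T] by (auto simp: SYT_eq[OF \<rho>])
  have "shape T = \<rho>" using T by (simp add: SYT_eq[OF \<rho>])
  then have "Suc m \<in># \<rho>" using S shape_child[OF S(1,2)] by (auto simp: inc_part_def)
  moreover have "T \<in> SYT_end (Suc n) \<rho> (Suc m)"
    using T S child_end[OF S(1,2), of "Suc m"] by (simp add: SYT_end_def)
  ultimately show "T \<in> (\<Union>k\<in>set_mset \<rho>. SYT_end (Suc n) \<rho> k)" by blast
qed (auto simp: SYT_end_def)

lemma SYT_end_disjoint:
  assumes \<rho>: "is_partition (Suc n) \<rho>" and "k \<noteq> k'"
  shows "SYT_end (Suc n) \<rho> k \<inter> SYT_end (Suc n) \<rho> k' = {}"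
proof (rule ccontr)
  assume "SYT_end (Suc n) \<rho> k \<inter> SYT_end (Suc n) \<rho> k' \<noteq> {}"
  then obtain T where T: "T \<in> SYT_end (Suc n) \<rho> k" "T \<in> SYT_end (Suc n) \<rho> k'" by blast
  then have "syt (Suc n) T" by (simp add: SYT_end_def SYT_eq[OF \<rho>])
  then obtain S m where S: "syt n S" "m \<in> parts0 (shape S)" "T = child n S m" using ex_child by blast
  show False
    using T child_end[OF S(1,2), of k] child_end[OF S(1,2), of k'] S(3) assms(2) by (simp add: SYT_end_def)
qed

lemma num_SYT_rec:
  assumes \<rho>: "is_partition (Suc n) \<rho>"
  shows "num_SYT \<rho> = (\<Sum>k\<in>set_mset \<rho>. num_SYT (dec_part k \<rho>))"
proof -
  have "num_SYT \<rho> = (\<Sum>k\<in>set_mset \<rho>. card (SYT_end (Suc n) \<rho> k))"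
    unfolding num_SYT_def SYT_UN_end[OF \<rho>]
  proof (rule card_UN_disjoint)
    show "\<forall>k\<in>set_mset \<rho>. finite (SYT_end (Suc n) \<rho> k)"
      using finite_SYT[OF \<rho>] by (simp add: SYT_end_def)
  qed (use SYT_end_disjoint[OF \<rho>] in auto)
  then show ?thesis using card_SYT_end[OF \<rho>] by simp
qed

text \<open>The commutation of adding and removing a box, \<open>D U - U D = 1\<close> in Young's lattice: the two
  orders agree except when the box removed is the box added.\<close>

lemma num_SYT_up:
  "is_partition n \<sigma> \<Longrightarrow> (\<Sum>l\<in>parts0 \<sigma>. num_SYT (inc_part l \<sigma>)) = Suc n * num_SYT \<sigma>"
proof (induction n arbitrary: \<sigma> rule: less_induct)
  case (less n)
  note \<sigma> = less.prems
  have 0: "0 \<notin># \<sigma>" using \<sigma> by (simp add: is_partition_def)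
  \<comment> \<open>\<open>P\<close> lists the ways to add to a row of length \<open>l\<close> and
    then remove from a row of length \<open>k\<close>, \<open>Q\<close> those in the other order;
    both omit the case in which the second step undoes the first.\<close>
  define P where "P = {(l, k). l \<in> parts0 \<sigma> \<and> k \<in># inc_part l \<sigma> \<and> k \<noteq> Suc l}"
  define Q where "Q = {(l, k). k \<in># \<sigma> \<and> l \<in> parts0 (dec_part k \<sigma>) \<and> k \<noteq> Suc l}"
  have Pc: "(l, k) \<in> P \<longleftrightarrow> k \<in># \<sigma> \<and> (l = 0 \<or> l \<in># \<sigma> - {#k#}) \<and> k \<noteq> Suc l" for l k
  proof -
    have "l \<in># \<sigma> \<and> k \<in># \<sigma> - {#l#} \<longleftrightarrow> k \<in># \<sigma> \<and> l \<in># \<sigma> - {#k#}"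
      by (cases "k = l") (auto simp: in_diff_count dest: in_diffD)
    then show ?thesis using 0 by (auto simp: P_def parts0_def inc_part_def diff_single_trivial)
  qed
  have Qc: "(l, k) \<in> Q \<longleftrightarrow> k \<in># \<sigma> \<and> (l = 0 \<or> l \<in># \<sigma> - {#k#}) \<and> k \<noteq> Suc l" for l k
    using 0 by (cases k) (auto simp: Q_def parts0_def dec_part_def)
  have PQ: "P = Q" using Pc Qc by auto
  have fin: "finite P" "finite Q"
  proof -
    have "P \<subseteq> (SIGMA l:parts0 \<sigma>. set_mset (inc_part l \<sigma>))" by (auto simp: P_def)
    then show "finite P" by (rule finite_subset) simp
    then show "finite Q" by (simp add: PQ)
  qed
  have "(\<Sum>l\<in>parts0 \<sigma>. num_SYT (inc_part l \<sigma>)) =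
      (\<Sum>l\<in>parts0 \<sigma>. \<Sum>k\<in>set_mset (inc_part l \<sigma>). num_SYT (dec_part k (inc_part l \<sigma>)))"
    by (intro sum.cong refl num_SYT_rec[OF inc_part_partition[OF \<sigma>]])
  also have "\<dots> = (\<Sum>l\<in>parts0 \<sigma>. num_SYT \<sigma> +
      (\<Sum>k\<in>set_mset (inc_part l \<sigma>) - {Suc l}. num_SYT (dec_part k (inc_part l \<sigma>))))"
  proof (intro sum.cong refl)
    fix l assume l: "l \<in> parts0 \<sigma>"
    have "Suc l \<in> set_mset (inc_part l \<sigma>)" by (simp add: inc_part_def)
    then show "(\<Sum>k\<in>set_mset (inc_part l \<sigma>). num_SYT (dec_part k (inc_part l \<sigma>))) = num_SYT \<sigma> +
      (\<Sum>k\<in>set_mset (inc_part l \<sigma>) - {Suc l}. num_SYT (dec_part k (inc_part l \<sigma>)))"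
      by (subst sum.remove[of _ "Suc l"]) (simp_all add: dec_inc_part[OF 0 l])
  qed
  also have "\<dots> = card (parts0 \<sigma>) * num_SYT \<sigma> + (\<Sum>(l, k)\<in>P. num_SYT (dec_part k (inc_part l \<sigma>)))"
  proof -
    have "P = (SIGMA l:parts0 \<sigma>. set_mset (inc_part l \<sigma>) - {Suc l})" by (auto simp: P_def)
    then show ?thesis by (simp add: sum.distrib sum.Sigma)
  qed
  also have "(\<Sum>(l, k)\<in>P. num_SYT (dec_part k (inc_part l \<sigma>))) =
      (\<Sum>(l, k)\<in>Q. num_SYT (inc_part l (dec_part k \<sigma>)))"
    using Pc dec_inc_commute[OF 0] by (intro sum.cong) (auto simp: PQ[symmetric])
  \<comment> \<open>There is one more way to add a box than to remove one, as \<open>parts0\<close>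
    also contains 0: this is the 1 in the commutation relation.\<close>
  also have "card (parts0 \<sigma>) * num_SYT \<sigma> + (\<Sum>(l, k)\<in>Q. num_SYT (inc_part l (dec_part k \<sigma>))) =
      num_SYT \<sigma> + (\<Sum>k\<in>set_mset \<sigma>. num_SYT \<sigma> +
        (\<Sum>l\<in>parts0 (dec_part k \<sigma>) - {k - 1}. num_SYT (inc_part l (dec_part k \<sigma>))))"
  proof -
    have "prod.swap ` Q = (SIGMA k:set_mset \<sigma>. parts0 (dec_part k \<sigma>) - {k - 1})"
      using 0 by (auto simp: Q_def image_iff) (metis Suc_pred neq0_conv)+
    then have "(\<Sum>(l, k)\<in>Q. num_SYT (inc_part l (dec_part k \<sigma>))) =
        (\<Sum>(k, l)\<in>(SIGMA k:set_mset \<sigma>. parts0 (dec_part k \<sigma>) - {k - 1}). num_SYT (inc_part l (dec_part k \<sigma>)))"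
      by (metis (no_types, lifting) sum.swap_restrict sum.reindex_cong[OF inj_swap] inj_on_def case_prod_unfold fst_swap snd_swap sum.cong)
    then show ?thesis using 0 by (simp add: sum.distrib sum.Sigma parts0_def)
  qed
  also have "\<dots> = num_SYT \<sigma> + (\<Sum>k\<in>set_mset \<sigma>. \<Sum>l\<in>parts0 (dec_part k \<sigma>). num_SYT (inc_part l (dec_part k \<sigma>)))"
  proof -
    have "num_SYT \<sigma> + (\<Sum>l\<in>parts0 (dec_part k \<sigma>) - {k - 1}. num_SYT (inc_part l (dec_part k \<sigma>))) =
      (\<Sum>l\<in>parts0 (dec_part k \<sigma>). num_SYT (inc_part l (dec_part k \<sigma>)))" if k: "k \<in># \<sigma>" for k
    proof -
      obtain m where m: "k = Suc m" using k 0 by (cases k) auto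
      show ?thesis using inc_dec_part[OF 0, of m] k
        by (subst (2) sum.remove[of _ m]) (simp_all add: m)
    qed
    then show ?thesis by simp
  qed
  also have "\<dots> = num_SYT \<sigma> + n * num_SYT \<sigma>"
  proof (cases n)
    case 0
    then have "\<sigma> = {#}" using \<sigma> by (cases \<sigma>) (auto simp: is_partition_def)
    then show ?thesis by (simp add: 0)
  next
    case (Suc m)
    have "(\<Sum>l\<in>parts0 (dec_part k \<sigma>). num_SYT (inc_part l (dec_part k \<sigma>))) = n * num_SYT (dec_part k \<sigma>)"
      if "k \<in># \<sigma>" for k
      using less.IH[of m "dec_part k \<sigma>"] dec_part_partition[of m \<sigma> k] \<sigma> that Suc by simp
    then show ?thesis
      using num_SYT_rec[of m \<sigma>] \<sigma> Suc by (simp add: sum_distrib_left)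
  qed
  finally show ?case by simp
qed

lemma card_same_shape: "T \<in> TT n \<Longrightarrow> card {U \<in> TT n. shape U = shape T} = num_SYT (shape T)"
  using SYT_TT[OF syt_is_partition] by (simp add: TT_def num_SYT_def)

text \<open>This is the sum of d_rho^2, written as a sum of d over tableaux. Passing to children and
  summing over the added box, \<open>num_SYT_up\<close> makes the sum for n + 1 boxes n + 1 times
  that for n.\<close>

lemma card_pairs_same_shape: "card {(T, U). T \<in> TT n \<and> U \<in> TT n \<and> shape T = shape U} = fact n"
proof -
  have *: "card {(T, U). T \<in> TT n \<and> U \<in> TT n \<and> shape T = shape U} = (\<Sum>T\<in>TT n. num_SYT (shape T))" for n
  proof -
    have "{(T, U). T \<in> TT n \<and> U \<in> TT n \<and> shape T = shape U} = (SIGMA T:TT n. {U \<in> TT n. shape U = shape T})"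
      by auto
    then show ?thesis by (simp add: card_same_shape)
  qed
  have "(\<Sum>T\<in>TT n. num_SYT (shape T)) = fact n"
  proof (induction n)
    case 0
    have "is_partition 0 {#}" by (simp add: is_partition_def)
    then show ?case by (simp add: TT_def syt_0 shape_def num_SYT_def SYT_eq)
  next
    case (Suc n)
    have "(\<Sum>T\<in>TT (Suc n). num_SYT (shape T)) =
      (\<Sum>(S, l)\<in>(SIGMA S:TT n. parts0 (shape S)). num_SYT (shape (child n S l)))"
      using sum.reindex_bij_betw[OF child_bij, of "\<lambda>T. num_SYT (shape T)" n] by (simp add: case_prod_unfold)
    also have "\<dots> = (\<Sum>S\<in>TT n. \<Sum>l\<in>parts0 (shape S). num_SYT (inc_part l (shape S)))"
      by (subst sum.Sigma[symmetric]) (simp_all add: shape_child TT_def[symmetric] cong: sum.cong, simp add: TT_def shape_child)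
    also have "\<dots> = (\<Sum>S\<in>TT n. Suc n * num_SYT (shape S))"
      by (intro sum.cong refl num_SYT_up syt_is_partition) (simp add: TT_def)
    also have "\<dots> = Suc n * fact n" by (simp only: sum_distrib_left[symmetric] Suc)
    also have "\<dots> = fact (Suc n)" by simp
    finally show ?case .
  qed
  then show ?thesis by (simp add: *)
qed

section \<open>Seminormal units\<close>

definition rowof :: "tableau \<Rightarrow> nat \<Rightarrow> nat" where
  "rowof T a = (THE r. a \<in> set (rf T r))"

definition colof :: "tableau \<Rightarrow> nat \<Rightarrow> nat" where
  "colof T a = (THE c. c < length (rf T (rowof T a)) \<and> rf T (rowof T a) ! c = a)"

lemma rowof_eq: "syt n T \<Longrightarrow> a \<in> set (rf T r) \<Longrightarrow> rowof T a = r"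
  unfolding rowof_def using sytD(6)[of n T a] by (intro the_equality) blast+

lemma rowof_nth:
  assumes "syt n T" "c < length (rf T r)"
  shows "rowof T (rf T r ! c) = r"
  using assms by (intro rowof_eq[of n]) simp_all

lemma colof_nth:
  assumes T: "syt n T" and c: "c < length (rf T r)"
  shows "colof T (rf T r ! c) = c"
  unfolding colof_def rowof_nth[OF T c]
  by (rule the_equality) (use c nth_eq_iff_index_eq[OF row_distinct[OF T]] in auto)

lemma syt_pos:
  assumes T: "syt n T" and a: "a \<in> {1..n}"
  shows "colof T a < length (rf T (rowof T a))" "rf T (rowof T a) ! colof T a = a"
proof -
  obtain r where "a \<in> set (rf T r)" using sytD(5)[OF T] a by blast
  then obtain c where c: "c < length (rf T r)" "a = rf T r ! c" by (auto simp: in_set_conv_nth)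
  then show "colof T a < length (rf T (rowof T a))" "rf T (rowof T a) ! colof T a = a"
    using rowof_nth[OF T c(1)] colof_nth[OF T c(1)] by simp_all
qed

lemma syt_filling: "syt n T \<Longrightarrow> filling n (rowof T) (colof T) (\<lambda>r. length (rf T r))"
proof
  assume T: "syt n T"
  show "bij_betw (\<lambda>a. (rowof T a, colof T a)) {1..n} {(r, c). c < length (rf T r)}"
  proof (rule bij_betw_byWitness[where f' = "\<lambda>(r, c). rf T r ! c"])
    show "\<forall>a\<in>{1..n}. (case (rowof T a, colof T a) of (r, c) \<Rightarrow> rf T r ! c) = a"
      using syt_pos[OF T] by simp
    show "\<forall>p\<in>{(r, c). c < length (rf T r)}. (rowof T (case p of (r, c) \<Rightarrow> rf T r ! c),
        colof T (case p of (r, c) \<Rightarrow> rf T r ! c)) = p"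
      using rowof_nth[OF T] colof_nth[OF T] by auto
    show "(\<lambda>a. (rowof T a, colof T a)) ` {1..n} \<subseteq> {(r, c). c < length (rf T r)}"
      using syt_pos[OF T] by blast
    show "(\<lambda>(r, c). rf T r ! c) ` {(r, c). c < length (rf T r)} \<subseteq> {1..n}"
      using syt_mem[OF T nth_mem] by (force simp del: atLeastAtMost_iff One_nat_def)
  qed
qed

lemma len_eq_of_shape:
  assumes "syt n T" "syt n U" "shape T = shape U"
  shows "(\<lambda>r. length (rf T r)) = (\<lambda>r. length (rf U r))"
proof -
  have "T \<in> SYT (shape T)" "U \<in> SYT (shape T)"
    using assms SYT_eq[OF syt_is_partition[OF assms(1)]] by simp_all
  then have m: "map length T = map length U" by (simp add: SYT_def)
  then have l: "length T = length U" by (rule map_eq_imp_length_eq)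
  have "length (rf V r) = (if r < length V then map length V ! r else 0)" for V :: tableau and r
    by simp
  then show ?thesis using m l by presburger
qed

lemma pos_child:
  assumes S: "syt n S" and l: "l \<in> parts0 (shape S)"
  shows "a \<in> {1..n} \<Longrightarrow> rowof (child n S l) a = rowof S a"
    and "a \<in> {1..n} \<Longrightarrow> colof (child n S l) a = colof S a"
    and "colof (child n S l) (Suc n) = l"
proof -
  note T = child_syt[OF S l]
  let ?r = "rix S l"
  have "l < length (rf (child n S l) ?r)" "rf (child n S l) ?r ! l = Suc n"
    using rix(1)[OF S l] by (simp_all add: rf_child[OF S l] nth_append)
  then show "colof (child n S l) (Suc n) = l" using colof_nth[OF T, of l ?r] by simp
  assume a: "a \<in> {1..n}"
  let ?q = "rowof S a" and ?c = "colof S a"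
  note p = syt_pos[OF S a]
  have *: "?c < length (rf (child n S l) ?q)" "rf (child n S l) ?q ! ?c = a"
    using p by (auto simp: rf_child[OF S l] nth_append)
  show "rowof (child n S l) a = ?q" "colof (child n S l) a = ?c"
    using rowof_nth[OF T *(1)] colof_nth[OF T *(1)] * by simp_all
qed

lemma stab_cong: "(\<And>a. a \<in> {1..n} \<Longrightarrow> w a = w' a) \<Longrightarrow> stab n w = stab n w'"
  unfolding stab_def using ap_in by (metis (no_types, lifting))

lemma ysym_cong:
  assumes "\<And>a. a \<in> {1..n} \<Longrightarrow> rw a = rw' a" "\<And>a. a \<in> {1..n} \<Longrightarrow> cl a = cl' a"
  shows "ysym n rw cl = ysym n rw' cl'"
  unfolding ysym_def Rsum_def Csum_def using stab_cong[of n rw rw'] stab_cong[of n cl cl'] assms by simp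

section \<open>From coefficient functions to the formal group algebra\<close>

definition Y :: "nat \<Rightarrow> tableau \<Rightarrow> (sperm \<Rightarrow>\<^sub>0 complex)" where
  "Y n T = ysym n (rowof T) (colof T)"

lemma Y_mem [simp]: "Y n T \<in> galgebra (SG n)"
  by (simp add: Y_def)

text \<open>Only values on \<open>Sym n\<close> are kept, just as the sum in
  \<open>galg_mult\<close> runs over \<open>Sym n\<close>; hence \<open>emb n\<close> is
  multiplicative on arbitrary functions.\<close>

definition emb :: "nat \<Rightarrow> galg \<Rightarrow> (sperm \<Rightarrow>\<^sub>0 complex)" where
  "emb n f = (\<Sum>g\<in>SG n. smult (f (ap g)) (elt g))"

lemma lookup_emb: "Poly_Mapping.lookup (emb n f) g = (if g \<in> SG n then f (ap g) else 0)"
  by (simp add: emb_def lookup_sum lookup_single when_def if_distrib cong: if_cong)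

lemma emb_mem [simp]: "emb n f \<in> galgebra (SG n)"
  by (simp add: galgebra_iff lookup_emb)

lemma ap_Sym: "g \<in> SG n \<Longrightarrow> ap g \<in> Sym n"
  by (simp add: SG_def)

lemma emb_mult: "emb n (galg_mult n f h) = emb n f * emb n h"
proof (rule poly_mapping_eqI)
  fix k
  show "Poly_Mapping.lookup (emb n (galg_mult n f h)) k = Poly_Mapping.lookup (emb n f * emb n h) k"
  proof (cases "k \<in> SG n")
    case True
    have "(\<Sum>(p, q)\<in>{(p, q). p \<in> Sym n \<and> q \<in> Sym n \<and> p \<circ> q = ap k}. f p * h q) =
        (\<Sum>g\<in>SG n. f (ap g) * h (ap (- g + k)))"
    proof (rule sum.reindex_bij_witness[of _ "\<lambda>g. (ap g, ap (- g + k))" "\<lambda>(p, q). Sp p"])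
      fix pq assume "pq \<in> {(p, q). p \<in> Sym n \<and> q \<in> Sym n \<and> p \<circ> q = ap k}"
      then obtain p q where pq: "pq = (p, q)" "p \<in> Sym n" "q \<in> Sym n" "p \<circ> q = ap k" by blast
      have "k = Sp p + Sp q" using pq by (simp add: ap_inject[symmetric] ap_plus ap_Sp'[OF pq(2)] ap_Sp'[OF pq(3)])
      then have q: "- Sp p + k = Sp q" by simp
      show "(ap (case pq of (p, q) \<Rightarrow> Sp p), ap (- (case pq of (p, q) \<Rightarrow> Sp p) + k)) = pq"
        using pq q by (simp add: ap_Sp'[OF pq(2)] ap_Sp'[OF pq(3)])
      show "(case pq of (p, q) \<Rightarrow> Sp p) \<in> SG n" using pq Sp_SG by simp
      show "f (ap (case pq of (p, q) \<Rightarrow> Sp p)) * h (ap (- (case pq of (p, q) \<Rightarrow> Sp p) + k)) = (case pq of (p, q) \<Rightarrow> f p * h q)"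
        using pq q by (simp add: ap_Sp'[OF pq(2)] ap_Sp'[OF pq(3)])
    next
      fix g assume g: "g \<in> SG n"
      show "(case (ap g, ap (- g + k)) of (p, q) \<Rightarrow> Sp p) = g" by (simp add: ap_inverse)
      have "- g + k \<in> SG n" using g True by simp
      moreover have "ap g \<circ> ap (- g + k) = ap k" by (simp add: ap_plus[symmetric])
      ultimately show "(ap g, ap (- g + k)) \<in> {(p, q). p \<in> Sym n \<and> q \<in> Sym n \<and> p \<circ> q = ap k}"
        using g ap_Sym by blast
    qed
    moreover have "Poly_Mapping.lookup (emb n f * emb n h) k = (\<Sum>g\<in>SG n. f (ap g) * h (ap (- g + k)))"
      using True by (subst lookup_times[of "SG n"]) (auto simp: lookup_emb in_keys_iff split: if_splits intro!: sum.cong)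
    ultimately show ?thesis using True by (simp add: lookup_emb galg_mult_def)
  next
    case False
    have "emb n f * emb n h \<in> galgebra (SG n)" by simp
    then show ?thesis using False by (simp add: lookup_emb galgebra_iff)
  qed
qed

lemma emb_scale: "emb n (galg_scale c f) = smult c (emb n f)"
  by (rule poly_mapping_eqI) (simp add: lookup_emb galg_scale_def)

lemma emb_sum: "emb n (galg_sum f I) = (\<Sum>i\<in>I. emb n (f i))"
  by (rule poly_mapping_eqI) (simp add: lookup_emb galg_sum_def lookup_sum)

text \<open>A function vanishing off \<open>Sym m\<close> has the same image under
  \<open>emb n\<close> for every n from m on. The recursion relies on this where a unit for n boxes
  is multiplied inside the algebra for n + 1.\<close>

definition supp_on :: "nat \<Rightarrow> galg \<Rightarrow> bool" where
  "supp_on n f \<longleftrightarrow> (\<forall>p. p \<notin> Sym n \<longrightarrow> f p = 0)"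

lemma supp_galg_mult: "supp_on n (galg_mult n f h)"
proof -
  have "galg_mult n f h s = 0" if "s \<notin> Sym n" for s
  proof -
    have e: "{(p, q). p \<in> Sym n \<and> q \<in> Sym n \<and> p \<circ> q = s} = {}"
      using that permutes_compose by (auto simp: Sym_def)
    show ?thesis unfolding galg_mult_def e by simp
  qed
  then show ?thesis by (simp add: supp_on_def)
qed

lemma supp_seminormal: "supp_on n (seminormal_unit n T)"
proof (cases n)
  case 0
  then show ?thesis by (simp add: supp_on_def galg_one_def Sym_def permutes_id)
next
  case (Suc m)
  then show ?thesis using supp_galg_mult[of n] by (simp add: supp_on_def galg_scale_def Let_def)
qed

lemma emb_mono:
  assumes "supp_on m f" "m \<le> n"
  shows "emb n f = emb m f"
proof (rule poly_mapping_eqI)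
  fix g show "Poly_Mapping.lookup (emb n f) g = Poly_Mapping.lookup (emb m f) g"
    using assms SG_mono[OF assms(2)] by (auto simp: lookup_emb supp_on_def SG_def)
qed

text \<open>An injective map of a finite fibre into itself is onto. This identifies the setwise
  stabilizers of rows and columns with \<open>stab\<close>.\<close>

lemma image_fibers_iff:
  assumes p: "p permutes {1..n::nat}" and w: "\<And>a. a \<in> {1..n} \<Longrightarrow> w a \<in> I"
  shows "(\<forall>r\<in>I. p ` {a \<in> {1..n}. w a = r} = {a \<in> {1..n}. w a = r}) \<longleftrightarrow> (\<forall>a\<in>{1..n}. w (p a) = w a)"
proof (intro iffI ballI)
  fix a assume *: "\<forall>r\<in>I. p ` {a \<in> {1..n}. w a = r} = {a \<in> {1..n}. w a = r}" and a: "a \<in> {1..n}"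
  then have "p a \<in> p ` {b \<in> {1..n}. w b = w a}" by blast
  then show "w (p a) = w a" using * w[OF a] by blast
next
  fix r assume *: "\<forall>a\<in>{1..n}. w (p a) = w a"
  let ?B = "{a \<in> {1..n}. w a = r}"
  have pin: "p a \<in> {1..n}" if "a \<in> {1..n}" for a using permutes_in_image[OF p, of a] that by simp
  have "p ` ?B \<subseteq> ?B" using * pin by auto
  moreover have "inj_on p ?B" using permutes_inj_on[OF p] .
  ultimately show "p ` ?B = ?B" by (intro endo_inj_surj) simp_all
qed

lemma row_stab_iff:
  assumes T: "syt n T" and g: "g \<in> SG n"
  shows "ap g \<in> row_stab n T \<longleftrightarrow> g \<in> stab n (rowof T)"
proof -
  have p: "ap g permutes {1..n}" using g by (simp add: SG_iff)
  have fib: "set (rf T r) = {a \<in> {1..n}. rowof T a = r}" for r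
  proof (intro equalityI subsetI)
    fix a assume "a \<in> set (rf T r)"
    then show "a \<in> {a \<in> {1..n}. rowof T a = r}" using rowof_eq[OF T] syt_mem[OF T] by simp
  next
    fix a assume "a \<in> {a \<in> {1..n}. rowof T a = r}"
    then show "a \<in> set (rf T r)" using syt_pos[OF T, of a] by (auto simp: in_set_conv_nth)
  qed
  have "(\<forall>row\<in>set T. ap g ` set row = set row) \<longleftrightarrow> (\<forall>r. ap g ` set (rf T r) = set (rf T r))"
    unfolding in_set_conv_nth Ball_def by (auto simp: rf_def)
  also have "\<dots> \<longleftrightarrow> (\<forall>a\<in>{1..n}. rowof T (ap g a) = rowof T a)"
    unfolding fib using image_fibers_iff[OF p, of "rowof T" UNIV] by simp
  finally show ?thesis using g ap_Sym by (simp add: row_stab_def stab_def)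
qed

lemma col_stab_iff:
  assumes T: "syt n T" and g: "g \<in> SG n"
  shows "ap g \<in> col_stab n T \<longleftrightarrow> g \<in> stab n (colof T)"
proof -
  have p: "ap g permutes {1..n}" using g by (simp add: SG_iff)
  have fib: "column T c = {a \<in> {1..n}. colof T a = c}" for c
  proof (intro equalityI subsetI)
    fix a assume "a \<in> column T c"
    then obtain row where "row \<in> set T" "c < length row" "a = row ! c" by (auto simp: column_def)
    then obtain r where "c < length (rf T r)" "a = rf T r ! c" by (metis in_set_conv_nth rf_nth)
    then show "a \<in> {a \<in> {1..n}. colof T a = c}" using colof_nth[OF T] syt_mem[OF T nth_mem] by simp
  next
    fix a assume a: "a \<in> {a \<in> {1..n}. colof T a = c}"
    then have *: "c < length (rf T (rowof T a))" "rf T (rowof T a) ! c = a" using syt_pos[OF T, of a] by auto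
    then have "rowof T a < length T" by (metis length_0_conv linorder_not_le not_less_zero rf_out)
    then show "a \<in> column T c" using * by (auto simp: column_def intro!: exI[of _ "T ! rowof T a"])
  qed
  have "(\<forall>c. ap g ` column T c = column T c) \<longleftrightarrow> (\<forall>a\<in>{1..n}. colof T (ap g a) = colof T a)"
    unfolding fib using image_fibers_iff[OF p, of "colof T" UNIV] by simp
  then show ?thesis using g ap_Sym by (simp add: col_stab_def stab_def)
qed

lemma emb_young:
  assumes T: "syt n T"
  shows "emb n (young_symmetrizer n T) = Y n T"
proof -
  have R: "emb n (\<lambda>p. if p \<in> row_stab n T then 1 else 0) = Rsum n (rowof T)"
    by (rule poly_mapping_eqI) (auto simp: lookup_emb lookup_Rsum row_stab_iff[OF T] stab_SG)
  have C: "emb n (\<lambda>q. if q \<in> col_stab n T then of_int (sign q) else 0) = Csum n (colof T)"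
    by (rule poly_mapping_eqI) (auto simp: lookup_emb lookup_Csum sgn_perm_def col_stab_iff[OF T] stab_SG)
  show ?thesis by (simp add: young_symmetrizer_def emb_mult R C Y_def ysym_def)
qed

section \<open>Induction establishing the seminormal idempotents\<close>

definition eT :: "nat \<Rightarrow> tableau \<Rightarrow> (sperm \<Rightarrow>\<^sub>0 complex)" where
  "eT n T = emb n (seminormal_unit n T)"

lemma eT_mem [simp]: "eT n T \<in> galgebra (SG n)"
  by (simp add: eT_def)

lemma eT_0: "eT 0 T = 1"
  by (rule poly_mapping_eqI)
    (auto simp: eT_def lookup_emb galg_one_def lookup_one when_def SG_iff ap_inject[symmetric] fun_eq_iff)

lemma eT_Suc:
  assumes "syt (Suc n) T"
  shows "eT (Suc n) T = smult (of_nat (num_SYT (shape T)) / fact (Suc n))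
    (eT n (remove_entry (Suc n) T) * Y (Suc n) T * eT n (remove_entry (Suc n) T))"
  using emb_mono[OF supp_seminormal[of n "remove_entry (Suc n) T"], of "Suc n"]
  by (simp add: eT_def Let_def emb_scale emb_mult emb_young[OF assms] mult.assoc)

definition kapT :: "nat \<Rightarrow> tableau \<Rightarrow> complex" where
  "kapT n T = tau (Y n T * Y n T)"

text \<open>Tableaux with the same \<open>f\<close> are children of one tableau, and different
  places for the new box give different column totals; this is what \<open>E_orth\<close> comes down
  to.\<close>

lemma block_data_Suc:
  assumes orth: "\<And>S S'. S \<in> TT n \<Longrightarrow> S' \<in> TT n \<Longrightarrow> eT n S * eT n S' = (if S = S' then eT n S else 0)"
    and tauE: "\<And>S. S \<in> TT n \<Longrightarrow> tau (eT n S * Y n S) = 1"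
  shows "block_data (SG (Suc n)) (TT (Suc n)) shape (\<lambda>T. eT n (remove_entry (Suc n) T)) (Y (Suc n)) (kapT (Suc n))"
proof
  let ?f = "\<lambda>T. eT n (remove_entry (Suc n) T)"
  have rem: "remove_entry (Suc n) T \<in> TT n" if "T \<in> TT (Suc n)" for T
    using that ex_child[of n T] remove_child by (auto simp: TT_def)
  show tau_f: "tau (?f T * Y (Suc n) T) = 1" if "T \<in> TT (Suc n)" for T
  proof -
    obtain S l where S: "syt n S" "l \<in> parts0 (shape S)" "T = child n S l"
      using \<open>T \<in> TT (Suc n)\<close> ex_child[of n T] by (auto simp: TT_def)
    interpret filling "Suc n" "rowof T" "colof T" "\<lambda>r. length (rf T r)"
      using \<open>T \<in> TT (Suc n)\<close> syt_filling by (simp add: TT_def)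
    have inj: "inj_on (\<lambda>a. (rowof T a, colof T a)) {1..Suc n}" using bij by (simp add: bij_betw_def)
    have "tau (eT n S * Y (Suc n) T) = tau (eT n S * ysym n (rowof T) (colof T))"
      unfolding Y_def using inj by (rule tau_times_ysym_Suc) simp
    also have "ysym n (rowof T) (colof T) = Y n S"
      unfolding Y_def S(3) using pos_child[OF S(1,2)] by (intro ysym_cong) simp_all
    finally show ?thesis using S remove_child[OF S(1,2)] tauE[of S] by (simp add: TT_def)
  qed
  show "?f T \<in> SG.A (Suc n)" for T
    using galgebra_mono[OF SG_mono[of n "Suc n"]] by simp
  show "?f T * ?f T = ?f T" if "T \<in> TT (Suc n)" for T using orth rem that by simp
  show "?f T * ?f U = 0" if "T \<in> TT (Suc n)" "U \<in> TT (Suc n)" "?f T \<noteq> ?f U" for T U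
    using orth rem that by auto
  show "Y (Suc n) T * x * Y (Suc n) T = smult (kapT (Suc n) T * tau (x * Y (Suc n) T)) (Y (Suc n) T)"
    if "T \<in> TT (Suc n)" "x \<in> SG.A (Suc n)" for T x
  proof -
    interpret filling "Suc n" "rowof T" "colof T" "\<lambda>r. length (rf T r)"
      using that syt_filling by (simp add: TT_def)
    show ?thesis using E_sandwich[OF that(2)] by (simp add: Y_def kapT_def kappa_def)
  qed
  show "kapT (Suc n) T \<noteq> 0" if "T \<in> TT (Suc n)" for T
  proof -
    interpret filling "Suc n" "rowof T" "colof T" "\<lambda>r. length (rf T r)"
      using that syt_filling by (simp add: TT_def)
    show ?thesis using kappa_nz by (simp add: Y_def kapT_def kappa_def)
  qed
  show "Y (Suc n) T * x * Y (Suc n) U = 0"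
    if TU: "T \<in> TT (Suc n)" "U \<in> TT (Suc n)" "T \<noteq> U" "?f T = ?f U" "x \<in> SG.A (Suc n)" for T U x
  proof -
    \<comment> \<open>Orthogonal idempotents that are nonzero and equal must belong to the same
      smaller tableau.\<close>
    have "?f T \<noteq> 0" using tau_f[OF TU(1)] by auto
    moreover have "?f T * ?f U = ?f T"
      using orth[OF rem[OF TU(1)] rem[OF TU(1)]] by (simp only: TU(4)[symmetric] if_True refl)
    ultimately have "remove_entry (Suc n) T = remove_entry (Suc n) U"
      using orth[OF rem[OF TU(1)] rem[OF TU(2)]] by metis
    moreover obtain S l where S: "syt n S" "l \<in> parts0 (shape S)" "T = child n S l"
      using TU(1) ex_child[of n T] by (auto simp: TT_def)
    moreover obtain S' l' where S': "syt n S'" "l' \<in> parts0 (shape S')" "U = child n S' l'"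
      using TU(2) ex_child[of n U] by (auto simp: TT_def)
    ultimately have SS: "S' = S" using remove_child by simp
    then have ll: "l \<noteq> l'" using TU(3) S S' by auto
    \<comment> \<open>The new box lies in column \<open>m\<close>, counted from 0, and the other
      entries keep their columns.\<close>
    have cs: "(\<Sum>a\<in>{1..Suc n}. colof (child n S m) a) = (\<Sum>a\<in>{1..n}. colof S a) + m"
      if "m \<in> parts0 (shape S)" for m
      using pos_child[OF S(1) that] by simp
    have "(\<Sum>a\<in>{1..Suc n}. colof T a) \<noteq> (\<Sum>a\<in>{1..Suc n}. colof U a)"
      using cs[of l] cs[of l'] S S' SS ll by simp
    then show ?thesis unfolding Y_def
      using filling_E_orth[OF syt_filling syt_filling] TU by (simp add: TT_def)
  qed
  show "\<exists>g\<in>SG (Suc n). Y (Suc n) U = elt g * Y (Suc n) T * elt (- g)"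
    if "T \<in> TT (Suc n)" "U \<in> TT (Suc n)" "shape T = shape U" for T U
  proof -
    have s: "syt (Suc n) T" "syt (Suc n) U" using that by (simp_all add: TT_def)
    show ?thesis unfolding Y_def
      using filling_E_conj[OF syt_filling[OF s(1)]] syt_filling[OF s(2)] len_eq_of_shape[OF s that(3)] by simp
  qed
  show "card {(T, U). T \<in> TT (Suc n) \<and> U \<in> TT (Suc n) \<and> shape T = shape U} = card (SG (Suc n))"
    by (simp add: card_pairs_same_shape card_SG del: fact_Suc)
qed simp_all

text \<open>Here the constant in the definition of the seminormal unit meets the one forced by
  idempotency: 1 / kappa is the number of tableaux of the shape divided by the group order.\<close>

lemma eT_eq_e:
  assumes "block_data (SG (Suc n)) (TT (Suc n)) shape (\<lambda>T. eT n (remove_entry (Suc n) T)) (Y (Suc n)) (kapT (Suc n))"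
    and T: "T \<in> TT (Suc n)"
  shows "block_data.e (\<lambda>T. eT n (remove_entry (Suc n) T)) (Y (Suc n)) (kapT (Suc n)) T = eT (Suc n) T"
proof -
  interpret block_data "SG (Suc n)" "TT (Suc n)" shape "\<lambda>T. eT n (remove_entry (Suc n) T)" "Y (Suc n)" "kapT (Suc n)"
    by fact
  have "1 / kapT (Suc n) T = of_nat (num_SYT (shape T)) / fact (Suc n)"
    using kap_eq[OF T] by (simp add: card_same_shape[OF T] card_SG del: fact_Suc)
  then show ?thesis using T by (simp add: e_def eT_Suc TT_def del: fact_Suc)
qed

lemma eT_invariant:
  "(\<forall>S\<in>TT n. \<forall>S'\<in>TT n. eT n S * eT n S' = (if S = S' then eT n S else 0)) \<and>
   (\<forall>S\<in>TT n. tau (eT n S * Y n S) = 1)"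
proof (induction n)
  case 0
  have "tau (Y 0 []) = 1"
  proof -
    interpret filling 0 "rowof []" "colof []" "\<lambda>r. length (rf [] r)"
      using syt_filling[of 0 "[]"] by (simp add: syt_0)
    show ?thesis using tau_E by (simp add: Y_def)
  qed
  then show ?case by (simp add: TT_def syt_0 eT_0)
next
  case (Suc n)
  have bd: "block_data (SG (Suc n)) (TT (Suc n)) shape (\<lambda>T. eT n (remove_entry (Suc n) T)) (Y (Suc n)) (kapT (Suc n))"
    by (rule block_data_Suc) (use Suc in auto)
  interpret block_data "SG (Suc n)" "TT (Suc n)" shape "\<lambda>T. eT n (remove_entry (Suc n) T)" "Y (Suc n)" "kapT (Suc n)"
    by (rule bd)
  show ?case using e_e tau_e_E eT_eq_e[OF bd] by simp
qed

lemma block_data_eT: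
  "block_data (SG (Suc n)) (TT (Suc n)) shape (\<lambda>T. eT n (remove_entry (Suc n) T)) (Y (Suc n)) (kapT (Suc n))"
  by (rule block_data_Suc) (use eT_invariant[of n] in auto)

interpretation bd: block_data "SG (Suc n)" "TT (Suc n)" shape "\<lambda>T. eT n (remove_entry (Suc n) T)" "Y (Suc n)" "kapT (Suc n)"
  for n by (rule block_data_eT)

lemma eT_eT: "S \<in> TT n \<Longrightarrow> S' \<in> TT n \<Longrightarrow> eT n S * eT n S' = (if S = S' then eT n S else 0)"
  using eT_invariant[of n] by blast

lemma sum_eT: "(\<Sum>T\<in>TT n. eT n T) = 1"
proof (cases n)
  case 0
  then show ?thesis by (simp add: TT_def syt_0 eT_0)
next
  case (Suc m)
  then show ?thesis using bd.sum_e[of m] eT_eq_e[OF block_data_eT[of m]] by simp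
qed

lemma eT_diff_shape:
  "T \<in> TT n \<Longrightarrow> U \<in> TT n \<Longrightarrow> shape T \<noteq> shape U \<Longrightarrow> x \<in> galgebra (SG n) \<Longrightarrow> eT n T * x * eT n U = 0"
  using bd.e_diff_shape eT_eq_e[OF block_data_eT] by (cases n) (auto simp: TT_def syt_0)

lemma eT_link:
  assumes "T \<in> TT n" "U \<in> TT n" "shape T = shape U"
  shows "\<exists>y\<in>galgebra (SG n). \<exists>z\<in>galgebra (SG n). eT n T * y * eT n U * z * eT n T = eT n T"
proof (cases n)
  case 0
  then show ?thesis using SG.one_mem[of 0] by (intro bexI[of _ 1]) (simp_all add: eT_0)
next
  case (Suc m)
  have T: "T \<in> TT (Suc m)" and U: "U \<in> TT (Suc m)" using assms Suc by simp_all
  show ?thesis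
    using bd.link[OF T U assms(3)]
    unfolding eT_eq_e[OF block_data_eT[of m] T] eT_eq_e[OF block_data_eT[of m] U] Suc .
qed

lemma eT_sandwich:
  assumes "T \<in> TT (Suc n)" "x \<in> galgebra (SG (Suc n))"
  shows "\<exists>c. eT (Suc n) T * x * eT (Suc n) T = smult c (eT (Suc n) T)"
  using bd.e_sandwich[OF assms] eT_eq_e[OF block_data_eT[of n] assms(1)] by auto

lemma eT_nz: "T \<in> TT (Suc n) \<Longrightarrow> eT (Suc n) T \<noteq> 0"
  using bd.e_nz[of T n] eT_eq_e[OF block_data_eT[of n]] by auto

lemma tau_eT: "T \<in> TT (Suc n) \<Longrightarrow> tau (eT (Suc n) T) = of_nat (num_SYT (shape T)) / fact (Suc n)"
  using bd.tau_e[of T n] bd.kap_eq[of T n] eT_eq_e[OF block_data_eT[of n]]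
  by (simp add: card_same_shape card_SG del: fact_Suc)

lemma eT_remove:
  assumes "T \<in> TT (Suc n)"
  shows "eT n (remove_entry (Suc n) T) * eT (Suc n) T = eT (Suc n) T"
    "eT (Suc n) T * eT n (remove_entry (Suc n) T) = eT (Suc n) T"
  using bd.f_e[OF assms] bd.e_f[OF assms] eT_eq_e[OF block_data_eT[of n] assms] by simp_all

section \<open>Near-conjugacy classes\<close>

lemma Sym_permutation: "p \<in> Sym n \<Longrightarrow> permutation p"
  unfolding Sym_def permutation_permutes by (rule CollectE, assumption) (rule exI[of _ "{1..n}"], simp)

lemma funpow_eq_iff:
  assumes p: "permutation p"
  shows "(p ^^ a) x = (p ^^ b) x \<longleftrightarrow> a mod card (orbit p x) = b mod card (orbit p x)"
proof -
  have x: "x \<in> orbit p x" by (rule permutation_self_in_orbit[OF p])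
  let ?L = "funpow_dist1 p x x"
  have inj: "inj_on (\<lambda>n. (p ^^ n) x) {0..<?L}" by (rule inj_on_funpow_dist1[OF x])
  have cL: "card (orbit p x) = ?L"
    by (subst orbit_conv_funpow_dist1[OF x]) (subst card_image[OF inj], simp)
  have pL: "(p ^^ ?L) x = x" by (rule funpow_dist1_prop[OF x])
  have "(p ^^ a) x = (p ^^ b) x \<longleftrightarrow> (p ^^ (a mod ?L)) x = (p ^^ (b mod ?L)) x"
    by (simp only: funpow_mod_eq[OF pL])
  also have "\<dots> \<longleftrightarrow> a mod ?L = b mod ?L"
    by (rule inj_on_eq_iff[OF inj]) simp_all
  finally show ?thesis by (simp only: cL)
qed

lemma orbit_eq:
  assumes p: "permutation p" and y: "y \<in> orbit p x"
  shows "orbit p y = orbit p x"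
  using orbit_cyclic_eq3[OF cyclic_on_orbit'[OF p] y] .

lemma orbit_conj:
  assumes "bij s"
  shows "orbit (s \<circ> p \<circ> inv s) (s x) = s ` orbit p x"
proof -
  have "((s \<circ> p \<circ> inv s) ^^ k) (s x) = s ((p ^^ k) x)" for k
    using assms by (induction k) (simp_all add: bij_is_inj)
  then show ?thesis by (auto simp: orbit_altdef)
qed

lemma ex_bij_of_image_mset_eq:
  assumes "finite A" "finite B" "image_mset f (mset_set A) = image_mset g (mset_set B)"
  shows "\<exists>\<phi>. bij_betw \<phi> A B \<and> (\<forall>a\<in>A. g (\<phi> a) = f a)"
  using assms
proof (induction A arbitrary: B rule: finite_induct)
  case empty
  then have "B = {}" by (simp add: mset_set_empty_iff)
  then show ?case by (simp add: bij_betw_def)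
next
  case (insert a A)
  have "f a \<in># image_mset g (mset_set B)" using insert by (metis image_mset_add_mset mset_set.insert union_single_eq_member)
  then obtain b where b: "b \<in> B" "g b = f a" using insert.prems by auto
  have "image_mset f (mset_set A) = image_mset g (mset_set (B - {b}))"
    using insert b by (simp add: mset_set.remove)
  then obtain \<phi> where \<phi>: "bij_betw \<phi> A (B - {b})" "\<forall>a\<in>A. g (\<phi> a) = f a"
    using insert.IH[of "B - {b}"] insert.prems by auto
  have "bij_betw (\<phi>(a := b)) A (B - {b})"
    using \<phi>(1) insert(2) by (subst bij_betw_cong[of A _ \<phi>]) auto
  then have "bij_betw (\<phi>(a := b)) (insert a A) (insert b (B - {b}))"
    using insert(2) bij_betw_combine[of "\<phi>(a := b)" "{a}" "{b}" A "B - {b}"] by simp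
  then have "bij_betw (\<phi>(a := b)) (insert a A) B" using b by (simp add: insert_absorb)
  moreover have "\<forall>x\<in>insert a A. g ((\<phi>(a := b)) x) = f x" using b \<phi>(2) by simp
  ultimately show ?case by blast
qed

text \<open>The usual conjugation of permutations of equal cycle type, arranged to fix n: cycles are
  matched by length, those of n with each other; each gets a base point, n in its own; and the k-th
  image of a base point under \<open>p\<close> is sent to the k-th image of the matching one under
  \<open>q\<close>.\<close>

lemma ex_conjugator:
  fixes n :: nat
  assumes n: "n \<ge> 1" and p: "p \<in> near_class n lam i" and q: "q \<in> near_class n lam i"
  shows "\<exists>s\<in>Sym (n - 1). s \<circ> p = q \<circ> s"
proof -
  have pp: "p permutes {1..n}" and qp: "q permutes {1..n}" using p q by (auto simp: near_class_def Sym_def)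
  have pP: "permutation p" and qP: "permutation q" using p q Sym_permutation by (auto simp: near_class_def)
  let ?A = "orbit p ` {1..n}" and ?B = "orbit q ` {1..n}"
  have nA: "orbit p n \<in> ?A" and nB: "orbit q n \<in> ?B" using n by auto
  have ct: "image_mset card (mset_set ?A) = image_mset card (mset_set ?B)"
    and cn: "card (orbit p n) = card (orbit q n)"
    using p q by (auto simp: near_class_def cycle_type_def)
  \<comment> \<open>The cycles of n are set aside in both permutations; the remaining lengths still
    agree.\<close>
  have "image_mset card (mset_set (?A - {orbit p n})) = image_mset card (mset_set (?B - {orbit q n}))"
    using ct cn mset_set.remove[of ?A, OF _ nA] mset_set.remove[of ?B, OF _ nB] by simp
  then obtain \<phi>0 where \<phi>0: "bij_betw \<phi>0 (?A - {orbit p n}) (?B - {orbit q n})"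
    "\<forall>Ob\<in>?A - {orbit p n}. card (\<phi>0 Ob) = card Ob"
    using ex_bij_of_image_mset_eq[of "?A - {orbit p n}" "?B - {orbit q n}" card card] by auto
  define \<phi> where "\<phi> = \<phi>0(orbit p n := orbit q n)"
  have "bij_betw \<phi> (?A - {orbit p n}) (?B - {orbit q n})"
    using \<phi>0(1) unfolding \<phi>_def by (subst bij_betw_cong[of _ _ \<phi>0]) auto
  then have "bij_betw \<phi> ({orbit p n} \<union> (?A - {orbit p n})) ({orbit q n} \<union> (?B - {orbit q n}))"
    by (intro bij_betw_combine) (auto simp: \<phi>_def)
  then have \<phi>: "bij_betw \<phi> ?A ?B" using nA nB by (simp add: insert_absorb)
  have \<phi>c: "card (\<phi> Ob) = card Ob" if "Ob \<in> ?A" for Ob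
    using \<phi>0(2) that cn by (auto simp: \<phi>_def)
  define rp where "rp Ob = (if Ob = orbit p n then n else SOME x. x \<in> {1..n} \<and> orbit p x = Ob)" for Ob
  define rq where "rq Ob = (if Ob = orbit q n then n else SOME x. x \<in> {1..n} \<and> orbit q x = Ob)" for Ob
  have rp: "orbit p (rp Ob) = Ob" if "Ob \<in> ?A" for Ob
  proof (cases "Ob = orbit p n")
    case False
    obtain x where "x \<in> {1..n} \<and> orbit p x = Ob" using \<open>Ob \<in> ?A\<close> by auto
    then have "(SOME x. x \<in> {1..n} \<and> orbit p x = Ob) \<in> {1..n} \<and> orbit p (SOME x. x \<in> {1..n} \<and> orbit p x = Ob) = Ob"
      by (rule someI)
    then show ?thesis using False by (simp add: rp_def)
  qed (simp add: rp_def)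
  have rq: "orbit q (rq Ob) = Ob \<and> rq Ob \<in> {1..n}" if "Ob \<in> ?B" for Ob
  proof (cases "Ob = orbit q n")
    case False
    obtain x where "x \<in> {1..n} \<and> orbit q x = Ob" using \<open>Ob \<in> ?B\<close> by auto
    then have "(SOME x. x \<in> {1..n} \<and> orbit q x = Ob) \<in> {1..n} \<and> orbit q (SOME x. x \<in> {1..n} \<and> orbit q x = Ob) = Ob"
      by (rule someI)
    then show ?thesis using False by (simp add: rq_def)
  qed (use n in \<open>simp add: rq_def\<close>)
  define k where "k x = (SOME k. (p ^^ k) (rp (orbit p x)) = x)" for x
  have k: "(p ^^ k x) (rp (orbit p x)) = x" if x: "x \<in> {1..n}" for x
  proof -
    have "x \<in> orbit p (rp (orbit p x))" using rp[of "orbit p x"] permutation_self_in_orbit[OF pP] x by simp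
    then have "x \<in> {(p ^^ n) (rp (orbit p x)) |n. True}"
      by (simp only: orbit_altdef_permutation[OF pP, of "rp (orbit p x)", symmetric])
    then obtain k where "x = (p ^^ k) (rp (orbit p x))" by (rule CollectE) (elim exE conjE)
    then have "\<exists>k. (p ^^ k) (rp (orbit p x)) = x" by (intro exI[of _ k]) (rule sym)
    then show ?thesis unfolding k_def by (rule someI_ex)
  qed
  define s where "s x = (if x \<in> {1..n} then (q ^^ k x) (rq (\<phi> (orbit p x))) else x)" for x
  have \<phi>B: "\<phi> (orbit p x) \<in> ?B" if "x \<in> {1..n}" for x
    using \<phi> that by (meson bij_betwE imageI)
  have orb_s: "orbit q (s x) = \<phi> (orbit p x)" if x: "x \<in> {1..n}" for x
  proof -
    have "s x \<in> orbit q (rq (\<phi> (orbit p x)))"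
      using x unfolding orbit_altdef_permutation[OF qP] s_def by auto
    from orbit_eq[OF qP this] show ?thesis using rq[OF \<phi>B[OF x]] by simp
  qed
  \<comment> \<open>Matched cycles have equal length, so two powers coincide at the base point for
    \<open>p\<close> exactly when they do for \<open>q\<close>. Hence the choice of exponent does
    not affect \<open>s\<close>, and \<open>s\<close> is injective.\<close>
  have transfer: "(p ^^ a) (rp Ob) = (p ^^ b) (rp Ob) \<longleftrightarrow> (q ^^ a) (rq (\<phi> Ob)) = (q ^^ b) (rq (\<phi> Ob))"
    if Ob: "Ob \<in> ?A" for Ob a b
  proof -
    have "\<phi> Ob \<in> ?B" using \<phi> Ob by (meson bij_betwE)
    then show ?thesis using rp[OF Ob] rq[of "\<phi> Ob"] \<phi>c[OF Ob] by (simp add: funpow_eq_iff[OF pP] funpow_eq_iff[OF qP])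
  qed
  have sn: "s n = n"
  proof -
    have "(p ^^ k n) (rp (orbit p n)) = (p ^^ 0) (rp (orbit p n))" using k[of n] n by (simp add: rp_def)
    then have "(q ^^ k n) (rq (\<phi> (orbit p n))) = (q ^^ 0) (rq (\<phi> (orbit p n)))" using transfer[OF nA] by blast
    then show ?thesis using n by (simp add: s_def \<phi>_def rq_def)
  qed
  have s_in: "s x \<in> {1..n}" if x: "x \<in> {1..n}" for x
  proof -
    have "s x \<in> orbit q (s x)" by (rule permutation_self_in_orbit[OF qP])
    then have "s x \<in> orbit q (rq (\<phi> (orbit p x)))" using orb_s[OF x] rq[OF \<phi>B[OF x]] by simp
    then show ?thesis using permutes_orbit_subset[OF qp] rq[OF \<phi>B[OF x]] by blast
  qed
  have s_inj: "inj_on s {1..n}"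
  proof (rule inj_onI)
    fix x y assume xy: "x \<in> {1..n}" "y \<in> {1..n}" "s x = s y"
    have "\<phi> (orbit p x) = \<phi> (orbit p y)" using orb_s xy by metis
    then have Ob: "orbit p x = orbit p y" using \<phi> xy unfolding bij_betw_def inj_on_def by blast
    then have "(q ^^ k x) (rq (\<phi> (orbit p x))) = (q ^^ k y) (rq (\<phi> (orbit p x)))"
      using xy by (simp add: s_def)
    then have pk: "(p ^^ k x) (rp (orbit p x)) = (p ^^ k y) (rp (orbit p x))" using transfer xy(1) by blast
    have "x = (p ^^ k x) (rp (orbit p x))" by (rule k[OF xy(1), symmetric])
    also note pk
    also have "(p ^^ k y) (rp (orbit p x)) = (p ^^ k y) (rp (orbit p y))" by (simp only: Ob)
    also have "\<dots> = y" by (rule k[OF xy(2)])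
    finally show "x = y" .
  qed
  have sp: "s permutes {1..n}"
  proof (rule bij_imp_permutes)
    show "bij_betw s {1..n} {1..n}" unfolding bij_betw_def
      using s_inj s_in endo_inj_surj[of "{1..n}" s] by blast
  qed (auto simp: s_def)
  have "s (p x) = q (s x)" for x
  proof (cases "x \<in> {1..n}")
    case True
    have px: "p x \<in> {1..n}" using permutes_in_image[OF pp] True by blast
    have Ob: "orbit p (p x) = orbit p x" by (rule permutation_orbit_step[OF pP])
    have "(p ^^ k (p x)) (rp (orbit p x)) = (p ^^ Suc (k x)) (rp (orbit p x))"
      using k[OF px] k[OF True] by (simp only: Ob funpow.simps comp_apply)
    then have "(q ^^ k (p x)) (rq (\<phi> (orbit p x))) = (q ^^ Suc (k x)) (rq (\<phi> (orbit p x)))"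
      using transfer True by blast
    then show ?thesis using px True Ob by (simp add: s_def)
  next
    case False
    then show ?thesis using permutes_not_in[OF pp] permutes_not_in[OF qp] by (auto simp: s_def)
  qed
  moreover have "s \<in> Sym (n - 1)"
  proof -
    have "s permutes {1..n - 1}"
    proof (rule permutes_superset[OF sp])
      fix x assume "x \<in> {1..n} - {1..n - 1}"
      then have "x = n" by auto
      then show "s x = x" using sn by simp
    qed
    then show ?thesis by (simp add: Sym_def)
  qed
  ultimately show ?thesis by (intro bexI[of _ s]) (auto simp: fun_eq_iff)
qed

lemma cycle_type_conj:
  assumes s: "s \<in> Sym n"
  shows "cycle_type n (s \<circ> p \<circ> inv s) = cycle_type n p"
proof -
  have sp: "s permutes {1..n}" using s by (simp add: Sym_def)
  have bij: "bij s" by (rule permutes_bij[OF sp])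
  have "orbit (s \<circ> p \<circ> inv s) ` {1..n} = orbit (s \<circ> p \<circ> inv s) ` s ` {1..n}"
    by (simp only: permutes_image[OF sp])
  also have "\<dots> = (\<lambda>Ob. s ` Ob) ` orbit p ` {1..n}"
    by (simp only: image_image orbit_conj[OF bij])
  finally have eq: "orbit (s \<circ> p \<circ> inv s) ` {1..n} = (\<lambda>Ob. s ` Ob) ` orbit p ` {1..n}" .
  have inj: "inj_on (\<lambda>Ob. s ` Ob) (orbit p ` {1..n})"
    using bij by (meson bij_is_inj inj_image_eq_iff inj_onI)
  have "card (s ` Ob) = card Ob" for Ob
    by (rule card_image) (use bij in \<open>auto intro: inj_on_subset[OF bij_is_inj]\<close>)
  then show ?thesis unfolding cycle_type_def eq image_mset_mset_set[OF inj, symmetric]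
    by (simp add: image_mset.compositionality comp_def)
qed

lemma near_class_conj:
  assumes s: "s \<in> Sym (n - 1)" and p: "p \<in> near_class n lam i" and n: "n \<ge> 1"
  shows "s \<circ> p \<circ> inv s \<in> near_class n lam i"
proof -
  have sp: "s permutes {1..n - 1}" using s by (simp add: Sym_def)
  have sp': "s permutes {1..n}" by (rule permutes_subset[OF sp]) auto
  have sn: "s n = n" using n by (intro permutes_not_in[OF sp]) auto
  have pp: "p permutes {1..n}" using p by (simp add: near_class_def Sym_def)
  have "(s \<circ> p \<circ> inv s) permutes {1..n}"
    by (intro permutes_compose permutes_inv sp' pp)
  moreover have "orbit (s \<circ> p \<circ> inv s) n = s ` orbit p n"
    using orbit_conj[OF permutes_bij[OF sp'], of p n] sn by simp
  then have "card (orbit (s \<circ> p \<circ> inv s) n) = card (orbit p n)"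
    using permutes_inj_on[OF sp'] by (simp add: card_image)
  ultimately show ?thesis
    using p cycle_type_conj[of s n p] sp' by (simp add: near_class_def Sym_def)
qed

lemma near_class_inv: "p \<in> near_class n lam i \<Longrightarrow> inv p \<in> near_class n lam i"
  using orbit_inv_eq[OF Sym_permutation[of p n]] permutes_inv[of p "{1..n}"]
  by (simp add: near_class_def cycle_type_def Sym_def)

lemma type_marked:
  assumes n: "n \<ge> 1" and p: "p \<in> Sym n"
  shows "(cycle_type n p, card (orbit p n)) \<in> marked_partitions n"
proof -
  have pP: "permutation p" by (rule Sym_permutation[OF p])
  have pp: "p permutes {1..n}" using p by (simp add: Sym_def)
  have U: "\<Union>(orbit p ` {1..n}) = {1..n}"
    using permutes_orbit_subset[OF pp] permutation_self_in_orbit[OF pP] by blast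
  have fin: "finite (orbit p x)" for x by (rule finite_orbit[OF permutation_self_in_orbit[OF pP]])
  have "sum card (orbit p ` {1..n}) = card (\<Union>(orbit p ` {1..n}))"
  proof (rule card_Union_disjoint[symmetric])
    show "pairwise disjnt (orbit p ` {1..n})"
    proof (rule pairwiseI)
      fix A B assume AB: "A \<in> orbit p ` {1..n}" "B \<in> orbit p ` {1..n}" "A \<noteq> B"
      then obtain x y where "A = orbit p x" "B = orbit p y" by blast
      then show "disjnt A B" using AB(3) orbit_eq[OF pP] unfolding disjnt_iff by metis
    qed
  qed (use fin in auto)
  then have "sum_mset (cycle_type n p) = n"
    unfolding U cycle_type_def by (simp add: sum_unfold_sum_mset)
  moreover have "0 \<notin># cycle_type n p"
    using fin orbit_nonempty[of p] by (auto simp: cycle_type_def card_eq_0_iff)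
  moreover have "card (orbit p n) \<in># cycle_type n p"
    using n by (auto simp: cycle_type_def)
  ultimately show ?thesis by (simp add: marked_partitions_def is_partition_def)
qed

text \<open>For each part \<open>k\<close>, a set of \<open>k\<close> points is split off and a
  single cycle is put on it.\<close>

lemma ex_perm_orbits:
  fixes A :: "nat set"
  assumes "finite A" "sum_mset lam = card A" "0 \<notin># lam"
  shows "\<exists>p. p permutes A \<and> image_mset card (mset_set (orbit p ` A)) = lam"
  using assms
proof (induction lam arbitrary: A)
  case empty
  then have "A = {}" by simp
  then show ?case using permutes_id[of A] by (intro exI[of _ id] conjI) (assumption, simp)
next
  case (add k lam)
  have "k \<le> card A" using add.prems by simp
  then obtain B where B: "B \<subseteq> A" "card B = k" by (meson obtain_subset_with_card_n)
  have fB: "finite B" using B(1) add.prems(1) by (rule finite_subset)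
  have "sum_mset lam = card (A - B)" using add.prems B fB by (simp add: card_Diff_subset)
  then obtain p where p: "p permutes A - B" "image_mset card (mset_set (orbit p ` (A - B))) = lam"
    using add.IH[of "A - B"] add.prems by auto
  have pP: "permutation p" using p(1) add.prems(1) by (auto simp: permutation_permutes)
  obtain cs where cs: "set cs = B" "distinct cs" using fB finite_distinct_list by blast
  define c where "c = cycle_of_list cs"
  have c: "c permutes B" using cycle_permutes[of cs] cs by (simp add: c_def)
  have cP: "permutation c" by (simp add: c_def permutation_of_cycle)
  have kB: "B \<noteq> {}" using B add.prems by auto
  have orb_c: "orbit c x = B" if x: "x \<in> B" for x
  proof -
    have ne: "cs \<noteq> []" using kB cs by auto
    have "B \<subseteq> orbit c (hd cs)"
    proof
      fix y assume "y \<in> B"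
      then obtain j where j: "j < length cs" "y = cs ! j" using cs by (metis in_set_conv_nth)
      have "(c ^^ j) (hd cs) = hd (map (c ^^ j) cs)" using ne by (simp add: hd_map)
      also have "\<dots> = hd (rotate j cs)" using cyclic_rotation[OF cs(2), of j] by (simp add: c_def)
      also have "\<dots> = y" using j ne by (simp add: hd_rotate_conv_nth)
      finally show "y \<in> orbit c (hd cs)" unfolding orbit_altdef_permutation[OF cP] by blast
    qed
    then have "orbit c x = orbit c (hd cs)" using orbit_eq[OF cP] x by blast
    moreover have "orbit c x \<subseteq> B" by (rule permutes_orbit_subset[OF c x])
    ultimately show ?thesis using \<open>B \<subseteq> orbit c (hd cs)\<close> by blast
  qed
  define q where "q = c \<circ> p"
  have q: "q permutes A" unfolding q_def
    by (intro permutes_compose permutes_subset[OF p(1)] permutes_subset[OF c]) (use B in auto)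
  have qB: "orbit q x = B" if x: "x \<in> B" for x
  proof -
    have "orbit q x = orbit c x"
    proof (rule orbit_cong)
      show "x \<in> orbit c x" by (rule permutation_self_in_orbit[OF cP])
      fix s assume "s \<in> orbit c x"
      then show "q s = c s" using orb_c[OF x] permutes_not_in[OF p(1), of s] by (simp add: q_def)
    qed
    then show ?thesis using orb_c[OF x] by simp
  qed
  have qA: "orbit q x = orbit p x" if x: "x \<in> A - B" for x
  proof (rule orbit_cong)
    show "x \<in> orbit p x" by (rule permutation_self_in_orbit[OF pP])
    fix s assume "s \<in> orbit p x"
    then have "s \<in> A - B" using permutes_orbit_subset[OF p(1) x] by blast
    then have "p s \<in> A - B" using permutes_in_image[OF p(1)] by blast
    then show "q s = p s" using permutes_not_in[OF c, of "p s"] by (simp add: q_def)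
  qed
  have "orbit q ` A = insert B (orbit p ` (A - B))"
  proof -
    have "A = B \<union> (A - B)" using B by blast
    then have "orbit q ` A = orbit q ` B \<union> orbit q ` (A - B)" by (metis image_Un)
    also have "orbit q ` B = {B}" using qB kB by auto
    also have "orbit q ` (A - B) = orbit p ` (A - B)" using qA by (rule image_cong[OF refl])
    finally show ?thesis by simp
  qed
  moreover have "B \<notin> orbit p ` (A - B)"
    using permutes_orbit_subset[OF p(1)] kB by blast
  ultimately have "image_mset card (mset_set (orbit q ` A)) = add_mset k lam"
    using p(2) B(2) add.prems(1) by simp
  then show ?case using q by blast
qed

lemma near_class_nonempty:
  assumes "(lam, i) \<in> marked_partitions n"
  shows "near_class n lam i \<noteq> {}"
proof -
  have lam: "sum_mset lam = n" "0 \<notin># lam" "i \<in># lam" using assms by (auto simp: marked_partitions_def is_partition_def)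
  obtain p where p: "p permutes {1..n}" "image_mset card (mset_set (orbit p ` {1..n})) = lam"
    using ex_perm_orbits[of "{1..n}" lam] lam by auto
  obtain a where a: "a \<in> {1..n}" "card (orbit p a) = i"
  proof -
    have "i \<in># image_mset card (mset_set (orbit p ` {1..n}))" using p lam by simp
    then show thesis using that by auto
  qed
  have n: "n \<in> {1..n}" using a by simp
  \<comment> \<open>Conjugation by this transposition places n on a cycle of length
    \<open>i\<close>.\<close>
  let ?s = "transpose a n"
  have s: "?s permutes {1..n}" by (rule permutes_swap_id[OF a(1) n])
  have "(?s \<circ> p \<circ> inv ?s) permutes {1..n}" by (intro permutes_compose permutes_inv s p(1))
  moreover have "orbit (?s \<circ> p \<circ> inv ?s) n = ?s ` orbit p a"
    using orbit_conj[OF permutes_bij[OF s], of p a] by simp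
  then have "card (orbit (?s \<circ> p \<circ> inv ?s) n) = i"
    using permutes_inj_on[OF s] a by (simp add: card_image)
  moreover have "cycle_type n (?s \<circ> p \<circ> inv ?s) = lam"
    using cycle_type_conj[of ?s n p] s p by (simp add: Sym_def cycle_type_def)
  ultimately have "?s \<circ> p \<circ> inv ?s \<in> near_class n lam i" by (simp add: near_class_def Sym_def)
  then show ?thesis by blast
qed

lemma finite_marked_partitions: "finite (marked_partitions n)"
proof -
  have "marked_partitions n \<subseteq> (\<lambda>p. (cycle_type n p, card (orbit p n))) ` Sym n"
  proof
    fix x assume x: "x \<in> marked_partitions n"
    obtain p where "p \<in> near_class n (fst x) (snd x)" using near_class_nonempty[of "fst x" "snd x" n] x by auto
    then show "x \<in> (\<lambda>p. (cycle_type n p, card (orbit p n))) ` Sym n"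
      by (intro image_eqI[of _ _ p]) (auto simp: near_class_def)
  qed
  then show ?thesis by (rule finite_subset) simp
qed

section \<open>Coefficients with respect to the near-class sums\<close>

lemma K_comb_eval:
  assumes n: "n \<ge> 1"
  shows "K_comb n c p = (if p \<in> Sym n then c (cycle_type n p) (card (orbit p n)) else 0)"
proof -
  have "K_comb n c p = (\<Sum>(\<nu>, k)\<in>marked_partitions n. c \<nu> k * K_elem n \<nu> k p)"
    by (simp add: K_comb_def galg_sum_def galg_scale_def case_prod_unfold)
  also have "\<dots> = (\<Sum>x\<in>marked_partitions n. if x = (cycle_type n p, card (orbit p n)) then
      (if p \<in> Sym n then c (cycle_type n p) (card (orbit p n)) else 0) else 0)"
    by (intro sum.cong) (auto simp: K_elem_def near_class_def split: if_splits)
  also have "\<dots> = (if p \<in> Sym n then c (cycle_type n p) (card (orbit p n)) else 0)"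
    by (subst sum.delta[OF finite_marked_partitions]) (use type_marked[OF n, of p] in auto)
  finally show ?thesis .
qed

text \<open>By \<open>ex_conjugator\<close> an invariant function is constant on near classes. These
  are nonempty and disjoint, so its values are the coefficients, and the description in
  \<open>K_coeff\<close> has exactly one solution.\<close>

lemma K_coeff_eval:
  assumes n: "n \<ge> 1" and supp: "supp_on n g"
    and conj: "\<And>s p. s \<in> Sym (n - 1) \<Longrightarrow> p \<in> Sym n \<Longrightarrow> g (s \<circ> p \<circ> inv s) = g p"
  shows "g = K_comb n (K_coeff n g)"
    and "p \<in> near_class n \<nu> k \<Longrightarrow> K_coeff n g \<nu> k = g p"
proof -
  have const: "g q = g p" if pq: "p \<in> near_class n \<nu> k" "q \<in> near_class n \<nu> k" for p q \<nu> k
  proof -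
    obtain s where s: "s \<in> Sym (n - 1)" "s \<circ> p = q \<circ> s" using ex_conjugator[OF n pq] by blast
    have bij: "bij s" using s(1) permutes_bij by (auto simp: Sym_def)
    have "s \<circ> p \<circ> inv s = q \<circ> (s \<circ> inv s)" by (simp add: s(2) comp_assoc)
    also have "s \<circ> inv s = id" using bij by (simp add: bij_is_surj surj_iff[symmetric])
    finally have "q = s \<circ> p \<circ> inv s" by (simp only: comp_id)
    then show ?thesis using conj[OF s(1), of p] pq by (simp add: near_class_def)
  qed
  define c where "c \<nu> k = (if (\<nu>, k) \<in> marked_partitions n then g (SOME p. p \<in> near_class n \<nu> k) else 0)" for \<nu> k
  have c: "c \<nu> k = g p" if p: "p \<in> near_class n \<nu> k" for p \<nu> k
  proof -
    have m: "(\<nu>, k) \<in> marked_partitions n" using p type_marked[OF n, of p] by (auto simp: near_class_def)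
    have "(SOME p. p \<in> near_class n \<nu> k) \<in> near_class n \<nu> k" by (rule someI[of _ p]) (rule p)
    then show ?thesis using const[OF p] m by (simp add: c_def)
  qed
  have gc: "g = K_comb n c"
  proof
    fix p show "g p = K_comb n c p"
      using supp c[of p "cycle_type n p" "card (orbit p n)"]
      by (auto simp: K_comb_eval[OF n] supp_on_def near_class_def)
  qed
  have "K_coeff n g = c" unfolding K_coeff_def
  proof (rule the_equality)
    show "(\<forall>\<nu> k. (\<nu>, k) \<notin> marked_partitions n \<longrightarrow> c \<nu> k = 0) \<and> g = K_comb n c"
      using gc by (simp add: c_def)
    fix c' assume c': "(\<forall>\<nu> k. (\<nu>, k) \<notin> marked_partitions n \<longrightarrow> c' \<nu> k = 0) \<and> g = K_comb n c'"
    have "c' \<nu> k = c \<nu> k" for \<nu> k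
    proof (cases "(\<nu>, k) \<in> marked_partitions n")
      case True
      then obtain p where p: "p \<in> near_class n \<nu> k" using near_class_nonempty by blast
      have "g p = K_comb n c' p" using c' by simp
      then have "g p = c' \<nu> k" using p by (simp add: K_comb_eval[OF n] near_class_def)
      then show ?thesis using c[OF p] by simp
    next
      case False
      then show ?thesis using c' by (simp add: c_def)
    qed
    then show "c' = c" by (simp add: fun_eq_iff)
  qed
  then show "g = K_comb n (K_coeff n g)" "p \<in> near_class n \<nu> k \<Longrightarrow> K_coeff n g \<nu> k = g p"
    using gc c by simp_all
qed

section \<open>The centralizer and its idempotents\<close>

lemma inc_part_inj:
  assumes "inc_part l \<sigma> = inc_part l' \<sigma>"
  shows "l = l'"
proof -
  have "\<not> l < l'" if "inc_part l \<sigma> = inc_part l' \<sigma>" for l l'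
  proof
    assume "l < l'"
    then have "count (inc_part l \<sigma>) (Suc l') = count \<sigma> (Suc l')"
      "count (inc_part l' \<sigma>) (Suc l') = Suc (count \<sigma> (Suc l'))"
      by (simp_all add: inc_part_def)
    then show False using that by simp
  qed
  from this[of l l'] this[of l' l] show ?thesis using assms by simp
qed

lemma num_SYT_pos: "is_partition n \<rho> \<Longrightarrow> num_SYT \<rho> > 0"
proof (induction n arbitrary: \<rho>)
  case 0
  then have "\<rho> = {#}" by (cases \<rho>) (auto simp: is_partition_def)
  then show ?case using SYT_eq[OF 0] by (simp add: num_SYT_def syt_0 shape_def)
next
  case (Suc n)
  then have "\<rho> \<noteq> {#}" by (auto simp: is_partition_def)
  then obtain k where k: "k \<in># \<rho>" by blast
  have "0 < num_SYT (dec_part k \<rho>)" using Suc.IH[OF dec_part_partition[OF Suc.prems k]] .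
  also have "\<dots> \<le> num_SYT \<rho>"
    unfolding num_SYT_rec[OF Suc.prems] by (rule member_le_sum) (use k in simp_all)
  finally show ?case .
qed

section \<open>Action of the centralizer on the seminormal units\<close>

context
  fixes m :: nat
begin

abbreviation rem where "rem T \<equiv> remove_entry (Suc m) T"
abbreviation N where "N \<equiv> Suc m"

lemma rem_TT: "T \<in> TT N \<Longrightarrow> rem T \<in> TT m"
  using ex_child[of m T] remove_child by (auto simp: TT_def)

text \<open>Branching is multiplicity free: comparing the two shapes tells the length of the row to
  which the largest entry was added.\<close>

lemma rem_shape_inj:
  assumes "T \<in> TT N" "U \<in> TT N" "rem T = rem U" "shape T = shape U"
  shows "T = U"
proof -
  obtain S l where S: "syt m S" "l \<in> parts0 (shape S)" "T = child m S l"
    using assms(1) ex_child[of m T] by (auto simp: TT_def)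
  obtain S' l' where S': "syt m S'" "l' \<in> parts0 (shape S')" "U = child m S' l'"
    using assms(2) ex_child[of m U] by (auto simp: TT_def)
  have "S = S'" using assms(3) S S' remove_child by simp
  moreover from this have "l = l'"
    using assms(4) S S' shape_child[OF S(1,2)] shape_child[OF S'(1,2)]
    by (intro inc_part_inj[of l "shape S"]) simp
  ultimately show ?thesis using S S' by simp
qed

lemma eT_Suc_mem [simp]: "eT m S \<in> galgebra (SG N)"
  by (rule galgebra_mono[OF SG_mono[of m N]]) simp_all

lemma eT_small_big:
  assumes "S \<in> TT m" "T \<in> TT N"
  shows "eT m S * eT N T = (if S = rem T then eT N T else 0)"
    "eT N T * eT m S = (if S = rem T then eT N T else 0)"
proof -
  have "eT m S * eT N T = eT m S * eT m (rem T) * eT N T"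
    using eT_remove(1)[OF assms(2)] by (simp add: mult.assoc)
  then show "eT m S * eT N T = (if S = rem T then eT N T else 0)"
    using eT_eT[OF assms(1) rem_TT[OF assms(2)]] eT_remove(1)[OF assms(2)] by auto
  have "eT N T * eT m S = eT N T * (eT m (rem T) * eT m S)"
    using eT_remove(2)[OF assms(2)] by (simp add: mult.assoc[symmetric])
  then show "eT N T * eT m S = (if S = rem T then eT N T else 0)"
    using eT_eT[OF rem_TT[OF assms(2)] assms(1)] eT_remove(2)[OF assms(2)] by auto
qed

lemma eT_branch:
  assumes "S \<in> TT m"
  shows "eT m S = (\<Sum>T\<in>{T \<in> TT N. rem T = S}. eT N T)"
proof -
  have "eT m S = (\<Sum>T\<in>TT N. eT m S * eT N T)"
    by (simp add: sum_distrib_left[symmetric] sum_eT)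
  also have "\<dots> = (\<Sum>T\<in>TT N. if rem T = S then eT N T else 0)"
    using eT_small_big(1)[OF assms] by (intro sum.cong) auto
  finally show ?thesis by (simp add: sum.If_cases Int_def)
qed

definition Z1 :: "(sperm \<Rightarrow>\<^sub>0 complex) \<Rightarrow> bool" where
  "Z1 x \<longleftrightarrow> x \<in> galgebra (SG N) \<and> (\<forall>y\<in>galgebra (SG m). x * y = y * x)"

definition coef :: "(sperm \<Rightarrow>\<^sub>0 complex) \<Rightarrow> tableau \<Rightarrow> complex" where
  "coef x T = (SOME c. eT N T * x * eT N T = smult c (eT N T))"

lemma coef: "T \<in> TT N \<Longrightarrow> x \<in> galgebra (SG N) \<Longrightarrow> eT N T * x * eT N T = smult (coef x T) (eT N T)"
  unfolding coef_def by (rule someI_ex) (rule eT_sandwich)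

text \<open>For equal shapes the smaller tableaux differ, and \<open>x\<close> can be moved past one
  of their orthogonal units; different shapes lie in different blocks.\<close>

lemma Z1_off_diagonal:
  assumes x: "Z1 x" and T: "T \<in> TT N" and U: "U \<in> TT N" and ne: "T \<noteq> U"
  shows "eT N T * x * eT N U = 0"
proof (cases "shape T = shape U")
  case True
  then have r: "rem T \<noteq> rem U" using rem_shape_inj[OF T U] ne by blast
  have "eT N T * x * eT N U = eT N T * (eT m (rem T) * x) * eT m (rem U) * eT N U"
    using eT_remove(2)[OF T] eT_remove(1)[OF U] by (metis mult.assoc)
  also have "eT m (rem T) * x = x * eT m (rem T)" using x by (simp add: Z1_def)
  also have "eT N T * (x * eT m (rem T)) * eT m (rem U) * eT N U = eT N T * x * (eT m (rem T) * eT m (rem U)) * eT N U"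
    by (simp only: mult.assoc)
  also have "\<dots> = 0" using eT_eT[OF rem_TT[OF T] rem_TT[OF U]] r by simp
  finally show ?thesis .
next
  case False
  then show ?thesis using eT_diff_shape[OF T U] x by (simp add: Z1_def)
qed

lemma Z1_eT:
  assumes x: "Z1 x" and T: "T \<in> TT N"
  shows "eT N T * x = smult (coef x T) (eT N T)" "x * eT N T = smult (coef x T) (eT N T)"
proof -
  have xA: "x \<in> galgebra (SG N)" using x by (simp add: Z1_def)
  have "eT N T * x = (\<Sum>U\<in>TT N. eT N T * x * eT N U)"
    by (simp add: sum_distrib_left[symmetric] sum_eT)
  also have "\<dots> = (\<Sum>U\<in>TT N. if U = T then smult (coef x T) (eT N T) else 0)"
    using Z1_off_diagonal[OF x T] coef[OF T xA] by (intro sum.cong) auto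
  finally show "eT N T * x = smult (coef x T) (eT N T)" using T by simp
  have "x * eT N T = (\<Sum>U\<in>TT N. eT N U * (x * eT N T))"
    by (simp add: sum_distrib_right[symmetric] sum_eT)
  also have "\<dots> = (\<Sum>U\<in>TT N. if U = T then smult (coef x T) (eT N T) else 0)"
    using Z1_off_diagonal[OF x _ T] coef[OF T xA] by (intro sum.cong) (auto simp: mult.assoc[symmetric])
  finally show "x * eT N T = smult (coef x T) (eT N T)" using T by simp
qed

text \<open>A link between the smaller tableaux, taken in the smaller group algebra, commutes with
  \<open>x\<close>. Cut down to \<open>T\<close> on the left and \<open>U\<close> on the right it
  stays nonzero, so \<open>x\<close> has the same eigenvalue on both.\<close>

lemma coef_cong:
  assumes x: "Z1 x" and T: "T \<in> TT N" and U: "U \<in> TT N"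
    and sh: "shape T = shape U" "shape (rem T) = shape (rem U)"
  shows "coef x T = coef x U"
proof -
  obtain y z where yz: "y \<in> galgebra (SG m)" "z \<in> galgebra (SG m)"
    "eT m (rem T) * y * eT m (rem U) * z * eT m (rem T) = eT m (rem T)"
    using eT_link[OF rem_TT[OF T] rem_TT[OF U] sh(2)] by blast
  have yz': "y \<in> galgebra (SG N)" "z \<in> galgebra (SG N)"
    using galgebra_mono[OF SG_mono[of m N]] yz(1,2) by simp_all
  \<comment> \<open>Of the extensions of \<open>rem U\<close> only \<open>U\<close> has the shape of
    \<open>T\<close>; the others drop out of the link.\<close>
  have 0: "eT N T * y * eT N W * z * eT N T = 0" if "W \<in> TT N" "rem W = rem U" "W \<noteq> U" for W
  proof -
    have "shape T \<noteq> shape W" using rem_shape_inj[OF that(1) U that(2)] that(3) sh(1) by auto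
    then show ?thesis using eT_diff_shape[OF T that(1) _ yz'(1)] by simp
  qed
  have "eT N T = eT N T * (eT m (rem T) * y * eT m (rem U) * z * eT m (rem T)) * eT N T"
    using eT_remove[OF T] eT_eT[OF T T] by (simp add: yz(3))
  also have "\<dots> = (eT N T * eT m (rem T)) * y * eT m (rem U) * z * (eT m (rem T) * eT N T)"
    by (simp only: mult.assoc)
  also have "\<dots> = eT N T * y * eT m (rem U) * z * eT N T"
    using eT_remove[OF T] by simp
  also have "\<dots> = (\<Sum>W\<in>{W \<in> TT N. rem W = rem U}. eT N T * y * eT N W * z * eT N T)"
    by (subst eT_branch[OF rem_TT[OF U]]) (simp add: sum_distrib_left sum_distrib_right)
  also have "\<dots> = (\<Sum>W\<in>{W \<in> TT N. rem W = rem U}. if W = U then eT N T * y * eT N U * z * eT N T else 0)"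
    using 0 by (intro sum.cong) auto
  also have "\<dots> = eT N T * y * eT N U * z * eT N T" using U by simp
  finally have nz: "eT N T * y * eT N U \<noteq> 0" using eT_nz[OF T] by auto
  have "smult (coef x T) (eT N T * y * eT N U) = eT N T * (x * y) * eT N U"
    using Z1_eT(1)[OF x T] by (simp add: mult.assoc[symmetric] smult_simps)
  also have "\<dots> = eT N T * y * (x * eT N U)"
    using x yz(1) by (simp add: Z1_def mult.assoc)
  also have "\<dots> = smult (coef x U) (eT N T * y * eT N U)"
    using Z1_eT(2)[OF x U] by (simp add: smult_simps)
  finally show ?thesis using nz cvs.scale_right_imp_eq by blast
qed

section \<open>The sums of units over a shape and a marked part\<close>

definition Gam :: "nat multiset \<Rightarrow> nat \<Rightarrow> (sperm \<Rightarrow>\<^sub>0 complex)" where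
  "Gam \<rho> l = (\<Sum>T\<in>SYT_end N \<rho> l. eT N T)"

lemma marked: "(\<rho>, l) \<in> marked_partitions N \<longleftrightarrow> is_partition N \<rho> \<and> l \<in># \<rho>"
  by (simp add: marked_partitions_def)

lemma SYT_end_TT: "(\<rho>, l) \<in> marked_partitions N \<Longrightarrow> T \<in> SYT_end N \<rho> l \<Longrightarrow> T \<in> TT N"
  using SYT_TT[of N \<rho>] by (simp add: marked SYT_end_def)

text \<open>The position of the largest entry becomes a condition on two shapes, the data on which
  \<open>coef x\<close> depends.\<close>

lemma SYT_end_iff:
  assumes "(\<rho>, l) \<in> marked_partitions N"
  shows "SYT_end N \<rho> l = {T \<in> TT N. shape T = \<rho> \<and> shape (rem T) = dec_part l \<rho>}"
proof -
  have \<rho>: "is_partition N \<rho>" and l: "l \<in># \<rho>" using assms by (simp_all add: marked)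
  have 0: "0 \<notin># \<rho>" using \<rho> by (simp add: is_partition_def)
  obtain k where k: "l = Suc k" using l 0 by (cases l) auto
  have dp: "is_partition m (dec_part l \<rho>)" by (rule dec_part_partition[OF \<rho> l])
  show ?thesis
  proof (intro equalityI subsetI)
    fix T assume T: "T \<in> SYT_end N \<rho> l"
    then obtain S where S: "S \<in> SYT (dec_part l \<rho>)" "T = child m S k"
      using SYT_end_eq(1)[OF \<rho> l] k by auto
    then have S': "syt m S" "shape S = dec_part l \<rho>" unfolding SYT_eq[OF dp] by auto
    have "k \<in> parts0 (shape S)" using inc_dec_part(2)[OF 0, of k] l S' k by simp
    then have "rem T = S" using remove_child[OF S'(1)] S(2) by simp
    moreover have "T \<in> TT N" "shape T = \<rho>" using T by (simp_all add: SYT_end_def SYT_TT[OF \<rho>])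
    ultimately show "T \<in> {T \<in> TT N. shape T = \<rho> \<and> shape (rem T) = dec_part l \<rho>}" using S' by simp
  next
    fix T assume T: "T \<in> {T \<in> TT N. shape T = \<rho> \<and> shape (rem T) = dec_part l \<rho>}"
    then obtain S j where S: "syt m S" "j \<in> parts0 (shape S)" "T = child m S j"
      using ex_child[of m T] by (auto simp: TT_def)
    have sS: "shape S = dec_part l \<rho>" using T S remove_child[OF S(1,2)] by simp
    have "inc_part j (dec_part l \<rho>) = \<rho>" using T S sS shape_child[OF S(1,2)] by simp
    also have "\<rho> = inc_part k (dec_part l \<rho>)" using inc_dec_part(1)[OF 0, of k] l k by simp
    finally have "j = k" by (rule inc_part_inj)
    moreover have "S \<in> SYT (dec_part l \<rho>)" unfolding SYT_eq[OF dp] using S sS by simp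
    ultimately show "T \<in> SYT_end N \<rho> l" unfolding SYT_end_eq(1)[OF \<rho> l] using S(3) k by simp
  qed
qed

lemma sum_TT_marked:
  "(\<Sum>T\<in>TT N. F T) = (\<Sum>(\<rho>, l)\<in>marked_partitions N. \<Sum>T\<in>SYT_end N \<rho> l. (F T :: 'b::comm_monoid_add))"
proof -
  have U: "TT N = (\<Union>x\<in>marked_partitions N. SYT_end N (fst x) (snd x))"
  proof (intro equalityI subsetI)
    fix T assume T: "T \<in> TT N"
    have p: "is_partition N (shape T)" using T syt_is_partition by (simp add: TT_def)
    have "T \<in> SYT (shape T)" using T by (simp add: SYT_TT[OF p])
    then obtain k where "k \<in># shape T" "T \<in> SYT_end N (shape T) k" using SYT_UN_end[OF p] by auto
    then show "T \<in> (\<Union>x\<in>marked_partitions N. SYT_end N (fst x) (snd x))"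
      using p by (intro UN_I[of "(shape T, k)"]) (simp_all add: marked)
  next
    fix T assume "T \<in> (\<Union>x\<in>marked_partitions N. SYT_end N (fst x) (snd x))"
    then obtain x where "x \<in> marked_partitions N" "T \<in> SYT_end N (fst x) (snd x)" by blast
    then show "T \<in> TT N" using SYT_end_TT[of "fst x" "snd x" T] by simp
  qed
  have "(\<Sum>T\<in>TT N. F T) = (\<Sum>x\<in>marked_partitions N. \<Sum>T\<in>SYT_end N (fst x) (snd x). F T)"
    unfolding U
  proof (rule sum.UNION_disjoint[OF finite_marked_partitions])
    show "\<forall>x\<in>marked_partitions N. finite (SYT_end N (fst x) (snd x))"
      using finite_SYT by (auto simp: SYT_end_def marked_partitions_def)
    show "\<forall>x\<in>marked_partitions N. \<forall>y\<in>marked_partitions N. x \<noteq> y \<longrightarrow>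
        SYT_end N (fst x) (snd x) \<inter> SYT_end N (fst y) (snd y) = {}"
    proof (intro ballI impI)
      fix x y assume xy: "x \<in> marked_partitions N" "y \<in> marked_partitions N" "x \<noteq> y"
      show "SYT_end N (fst x) (snd x) \<inter> SYT_end N (fst y) (snd y) = {}"
      proof (cases "fst x = fst y")
        case True
        then have "snd x \<noteq> snd y" using xy(3) by (simp add: prod_eq_iff)
        then show ?thesis using SYT_end_disjoint[of m "fst x" "snd x" "snd y"] xy(1) True
          by (cases x) (simp add: marked)
      next
        case False
        then show ?thesis using SYT_end_iff[of "fst x" "snd x"] SYT_end_iff[of "fst y" "snd y"] xy by auto
      qed
    qed
  qed
  then show ?thesis by (simp add: case_prod_unfold)
qed

lemma Gam_mem [simp]: "Gam \<rho> l \<in> galgebra (SG N)"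
  by (simp add: Gam_def)

lemma Z1_Gam_mult:
  assumes x: "Z1 x" and j: "(\<rho>, l) \<in> marked_partitions N"
  shows "\<exists>a. x * Gam \<rho> l = smult a (Gam \<rho> l)"
proof (cases "SYT_end N \<rho> l = {}")
  case True
  then show ?thesis by (simp add: Gam_def)
next
  case False
  then obtain T where T: "T \<in> SYT_end N \<rho> l" by blast
  have "x * eT N U = smult (coef x T) (eT N U)" if "U \<in> SYT_end N \<rho> l" for U
  proof -
    have "T \<in> TT N" "U \<in> TT N" "shape T = shape U" "shape (rem T) = shape (rem U)"
      using T that unfolding SYT_end_iff[OF j] by simp_all
    then show ?thesis using Z1_eT(2)[OF x] coef_cong[OF x] by metis
  qed
  then have "x * Gam \<rho> l = smult (coef x T) (Gam \<rho> l)"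
    by (simp add: Gam_def sum_distrib_left smult_sum)
  then show ?thesis by blast
qed

lemma sum_Gam: "(\<Sum>(\<rho>, l)\<in>marked_partitions N. Gam \<rho> l) = 1"
  unfolding Gam_def sum_TT_marked[symmetric] by (rule sum_eT)

lemma tau_Gam:
  assumes "(\<rho>, l) \<in> marked_partitions N"
  shows "tau (Gam \<rho> l) = of_nat (num_SYT (dec_part l \<rho>)) * of_nat (num_SYT \<rho>) / fact N"
proof -
  have "tau (Gam \<rho> l) = (\<Sum>T\<in>SYT_end N \<rho> l. of_nat (num_SYT \<rho>) / fact N)"
    unfolding Gam_def tau_sum using SYT_end_iff[OF assms] tau_eT[of _ m] by (intro sum.cong) auto
  then show ?thesis using card_SYT_end[of m \<rho> l] assms by (simp add: marked del: fact_Suc)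
qed

text \<open>Let z be the sum. When 1 is inserted on the other side of \<open>x\<close> as the sum of
  all units, only units of the same shape survive, so both products equal z x z.\<close>

lemma central_sum:
  assumes \<rho>: "is_partition n \<rho>" and x: "x \<in> galgebra (SG n)"
  shows "(\<Sum>T\<in>SYT \<rho>. eT n T) * x = x * (\<Sum>T\<in>SYT \<rho>. eT n T)"
proof -
  have z: "T \<in> SYT \<rho> \<Longrightarrow> U \<in> TT n - SYT \<rho> \<Longrightarrow> eT n T * x * eT n U = 0 \<and> eT n U * x * eT n T = 0" for T U
    using eT_diff_shape[of T n U x] eT_diff_shape[of U n T x] x by (auto simp: SYT_TT[OF \<rho>])
  have sub: "SYT \<rho> \<subseteq> TT n" by (auto simp: SYT_TT[OF \<rho>])
  have "(\<Sum>T\<in>SYT \<rho>. eT n T) * x = (\<Sum>T\<in>SYT \<rho>. eT n T * x * (\<Sum>U\<in>TT n. eT n U))"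
    by (simp add: sum_eT sum_distrib_right)
  also have "\<dots> = (\<Sum>T\<in>SYT \<rho>. \<Sum>U\<in>SYT \<rho>. eT n T * x * eT n U)"
    unfolding sum_distrib_left
    by (intro sum.cong refl sum.mono_neutral_right) (use sub z in auto)
  also have "\<dots> = (\<Sum>U\<in>SYT \<rho>. \<Sum>T\<in>SYT \<rho>. eT n T * x * eT n U)"
    by (rule sum.swap)
  also have "\<dots> = (\<Sum>U\<in>SYT \<rho>. (\<Sum>T\<in>TT n. eT n T) * (x * eT n U))"
    unfolding sum_distrib_right
    by (intro sum.cong refl sum.mono_neutral_cong_left) (use sub z in \<open>auto simp: mult.assoc\<close>)
  also have "\<dots> = x * (\<Sum>T\<in>SYT \<rho>. eT n T)" by (simp add: sum_eT sum_distrib_left)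
  finally show ?thesis .
qed

text \<open>A product of central idempotents, one of each group algebra. Both commute with the
  smaller algebra, which is how \<open>Gam\<close> is seen to lie in the centralizer.\<close>

lemma Gam_eq_product:
  assumes j: "(\<rho>, l) \<in> marked_partitions N"
  shows "Gam \<rho> l = (\<Sum>T\<in>SYT \<rho>. eT N T) * (\<Sum>S\<in>SYT (dec_part l \<rho>). eT m S)"
proof -
  have \<rho>: "is_partition N \<rho>" and l: "l \<in># \<rho>" using j by (simp_all add: marked)
  have dp: "is_partition m (dec_part l \<rho>)" by (rule dec_part_partition[OF \<rho> l])
  have "(\<Sum>T\<in>SYT \<rho>. eT N T) * (\<Sum>S\<in>SYT (dec_part l \<rho>). eT m S) =
      (\<Sum>T\<in>SYT \<rho>. \<Sum>S\<in>SYT (dec_part l \<rho>). if S = rem T then eT N T else 0)"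
    unfolding sum_product
    by (intro sum.cong refl eT_small_big(2)) (simp_all add: SYT_TT[OF dp] SYT_TT[OF \<rho>])
  also have "\<dots> = (\<Sum>T\<in>SYT \<rho>. if rem T \<in> SYT (dec_part l \<rho>) then eT N T else 0)"
    using finite_SYT[OF dp] by (intro sum.cong) (auto simp: sum.delta)
  also have "\<dots> = (\<Sum>T\<in>{T \<in> SYT \<rho>. rem T \<in> SYT (dec_part l \<rho>)}. eT N T)"
    using finite_SYT[OF \<rho>] by (simp add: sum.inter_filter)
  also have "{T \<in> SYT \<rho>. rem T \<in> SYT (dec_part l \<rho>)} = SYT_end N \<rho> l"
    unfolding SYT_end_iff[OF j] using rem_TT by (auto simp: SYT_TT[OF dp] SYT_TT[OF \<rho>])
  finally show ?thesis by (simp add: Gam_def)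
qed

lemma Z1_Gam:
  assumes j: "(\<rho>, l) \<in> marked_partitions N"
  shows "Z1 (Gam \<rho> l)"
  unfolding Z1_def
proof (intro conjI ballI)
  fix y assume y: "y \<in> galgebra (SG m)"
  have y': "y \<in> galgebra (SG N)" using galgebra_mono[OF SG_mono[of m N] y] by simp
  have \<rho>: "is_partition N \<rho>" and l: "l \<in># \<rho>" using j by (simp_all add: marked)
  note c1 = central_sum[OF \<rho> y'] and c2 = central_sum[OF dec_part_partition[OF \<rho> l] y]
  show "Gam \<rho> l * y = y * Gam \<rho> l"
    unfolding Gam_eq_product[OF j] by (metis c1 c2 mult.assoc)
qed simp

section \<open>Elements of the centralizer as functions on near classes\<close>

lemma Z1_conj:
  assumes x: "Z1 x" and s: "s \<in> SG m"
  shows "Poly_Mapping.lookup x (s + h + - s) = Poly_Mapping.lookup x h"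
proof -
  have c: "x * elt s = elt s * x" using x s by (simp add: Z1_def)
  have "elt s * x * elt (- s) = x * (elt s * elt (- s))"
    by (simp only: c[symmetric] mult.assoc)
  also have "\<dots> = x" by (simp add: mult_single)
  finally have "Poly_Mapping.lookup x (s + h + - s) = Poly_Mapping.lookup (elt s * x * elt (- s)) (s + h + - s)"
    by simp
  also have "\<dots> = Poly_Mapping.lookup x (- s + (s + h + - s) + s)" by (rule lookup_conj)
  also have "- s + (s + h + - s) + s = h" by (simp add: add.assoc)
  finally show ?thesis .
qed

lemma Z1_I:
  assumes x: "x \<in> galgebra (SG N)"
    and inv: "\<And>s h. s \<in> SG m \<Longrightarrow> h \<in> SG N \<Longrightarrow> Poly_Mapping.lookup x (s + h + - s) = Poly_Mapping.lookup x h"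
  shows "Z1 x"
proof -
  have c: "elt s * x = x * elt s" if s: "s \<in> SG m" for s
  proof -
    have sN: "s \<in> SG N" using s SG_mono[of m N] by auto
    have "elt s * x * elt (- s) = x"
    proof (rule poly_mapping_eqI)
      fix h
      show "Poly_Mapping.lookup (elt s * x * elt (- s)) h = Poly_Mapping.lookup x h"
      proof (cases "h \<in> SG N")
        case True
        then have "- s + h + s \<in> SG N" using sN by simp
        from inv[OF s this] show ?thesis by (simp add: lookup_conj add.assoc)
      next
        case False
        have "elt s * x * elt (- s) \<in> galgebra (SG N)" using x sN by simp
        then show ?thesis using False x by (simp add: galgebra_iff)
      qed
    qed
    then have "x * elt s = elt s * x * (elt (- s) * elt s)" by (simp only: mult.assoc[symmetric])
    then show ?thesis by (simp add: mult_single)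
  qed
  have "x * y = y * x" if y: "y \<in> galgebra (SG m)" for y
  proof -
    have "x * y = (\<Sum>g\<in>SG m. smult (Poly_Mapping.lookup y g) (x * elt g))"
      by (subst SG.expand[OF y]) (simp add: sum_distrib_left smult_simps)
    also have "\<dots> = (\<Sum>g\<in>SG m. smult (Poly_Mapping.lookup y g) (elt g * x))"
      using c by simp
    also have "\<dots> = y * x"
      by (subst (2) SG.expand[OF y]) (simp add: sum_distrib_right smult_simps)
    finally show ?thesis .
  qed
  then show ?thesis using x by (simp add: Z1_def)
qed

lemma K_coeff_Z1:
  assumes supp: "supp_on N g" and Z: "Z1 (emb N g)"
  shows "g = K_comb N (K_coeff N g)" "p \<in> near_class N \<nu> k \<Longrightarrow> K_coeff N g \<nu> k = g p"
proof -
  have conj: "g (s \<circ> p \<circ> inv s) = g p" if s: "s \<in> Sym (N - 1)" and p: "p \<in> Sym N" for s p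
  proof -
    have sm: "s \<in> Sym m" using s by simp
    have S: "Sp s \<in> SG m" "Sp s \<in> SG N" "Sp p \<in> SG N"
      using Sp_SG[OF sm] Sp_SG[OF p] SG_mono[of m N] by auto
    have "ap (Sp s + Sp p + - Sp s) = s \<circ> p \<circ> inv s"
      by (simp only: ap_plus ap_uminus ap_Sp'[OF sm] ap_Sp'[OF p])
    moreover have "Sp s + Sp p + - Sp s \<in> SG N" using S by (intro SG.add_mem SG.minus_mem)
    ultimately show ?thesis using Z1_conj[OF Z S(1), of "Sp p"] S ap_Sp'[OF p]
      by (simp add: lookup_emb del: add_uminus_conv_diff)
  qed
  show "g = K_comb N (K_coeff N g)" "p \<in> near_class N \<nu> k \<Longrightarrow> K_coeff N g \<nu> k = g p"
    using K_coeff_eval[of N g, OF _ supp conj] by simp_all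
qed

lemma Z1_K_elem: "Z1 (emb N (K_elem N lam i))"
proof (rule Z1_I)
  fix s h assume s: "s \<in> SG m" and h: "h \<in> SG N"
  have sN: "s \<in> SG N" using s SG_mono[of m N] by auto
  have mem: "s + h + - s \<in> SG N" using sN h by (intro SG.add_mem SG.minus_mem)
  have fwd: "ap (t + g + - t) \<in> near_class N lam i" if "t \<in> SG m" "ap g \<in> near_class N lam i" for t g
    using near_class_conj[of "ap t" N "ap g" lam i] that ap_Sym[of t m] by (simp add: ap_plus ap_uminus del: add_uminus_conv_diff)
  have "ap (s + h + - s) \<in> near_class N lam i \<longleftrightarrow> ap h \<in> near_class N lam i"
  proof
    assume "ap (s + h + - s) \<in> near_class N lam i"
    then have "ap (- s + (s + h + - s) + - (- s)) \<in> near_class N lam i" 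
      by (rule fwd[OF SG.minus_mem[OF s]])
    moreover have "- s + (s + h + - s) + - (- s) = h" by (simp add: add.assoc)
    ultimately show "ap h \<in> near_class N lam i" by metis
  qed (rule fwd[OF s])
  then show "Poly_Mapping.lookup (emb N (K_elem N lam i)) (s + h + - s) = Poly_Mapping.lookup (emb N (K_elem N lam i)) h"
    using mem h by (simp add: lookup_emb K_elem_def del: add_uminus_conv_diff)
qed simp

lemma emb_Gamma: "emb N (Gamma_elem N \<rho> l) = Gam \<rho> l"
  by (simp add: Gamma_elem_def emb_sum Gam_def eT_def)

lemma supp_Gamma: "supp_on N (Gamma_elem N \<rho> l)"
  using supp_seminormal[of N] by (auto simp: supp_on_def Gamma_elem_def galg_sum_def intro!: sum.neutral)

lemma gen_char_eval:
  assumes j: "(\<rho>, l) \<in> marked_partitions N" and p: "p \<in> near_class N lam i"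
  shows "Gamma_elem N \<rho> l p = gen_char N \<rho> l lam i * of_nat (num_SYT \<rho>) / fact N"
proof -
  have "num_SYT \<rho> \<noteq> 0" using num_SYT_pos[of N \<rho>] j by (simp add: marked)
  moreover have "K_coeff N (Gamma_elem N \<rho> l) lam i = Gamma_elem N \<rho> l p"
    using K_coeff_Z1(2)[OF supp_Gamma _ p] Z1_Gam[OF j] by (simp add: emb_Gamma)
  ultimately show ?thesis by (simp add: gen_char_def del: fact_Suc)
qed

lemma K_elem_Gam:
  assumes j: "(\<rho>, l) \<in> marked_partitions N"
  shows "emb N (K_elem N lam i) * Gam \<rho> l = smult (of_nat (card (near_class N lam i)) *
    gen_char N \<rho> l lam i / of_nat (num_SYT (dec_part l \<rho>))) (Gam \<rho> l)"
proof -
  obtain a where a: "emb N (K_elem N lam i) * Gam \<rho> l = smult a (Gam \<rho> l)"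
    using Z1_Gam_mult[OF Z1_K_elem j] by blast
  have nz: "num_SYT \<rho> \<noteq> 0" "num_SYT (dec_part l \<rho>) \<noteq> 0"
    using num_SYT_pos[of N \<rho>] num_SYT_pos[of m "dec_part l \<rho>"] dec_part_partition[of m \<rho> l] j
    by (auto simp: marked)
  have "tau (emb N (K_elem N lam i) * Gam \<rho> l) =
      (\<Sum>g\<in>SG N. Poly_Mapping.lookup (emb N (K_elem N lam i)) g * Poly_Mapping.lookup (Gam \<rho> l) (- g))"
    by (rule tau_times) (auto simp: in_keys_iff lookup_emb split: if_splits)
  also have "\<dots> = (\<Sum>g\<in>SG N. if ap g \<in> near_class N lam i then gen_char N \<rho> l lam i * of_nat (num_SYT \<rho>) / fact N else 0)"
  proof (intro sum.cong refl)
    fix g assume g: "g \<in> SG N"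
    \<comment> \<open>The trace of a product evaluates \<open>Gam\<close> at inverses; near classes
      are closed under inversion, so the value is still that of the class.\<close>
    have "Poly_Mapping.lookup (Gam \<rho> l) (- g) = Gamma_elem N \<rho> l (inv (ap g))"
      using g by (simp add: emb_Gamma[symmetric] lookup_emb ap_uminus)
    then show "Poly_Mapping.lookup (emb N (K_elem N lam i)) g * Poly_Mapping.lookup (Gam \<rho> l) (- g) =
      (if ap g \<in> near_class N lam i then gen_char N \<rho> l lam i * of_nat (num_SYT \<rho>) / fact N else 0)"
      using g gen_char_eval[OF j near_class_inv] by (simp add: lookup_emb K_elem_def del: fact_Suc)
  qed
  also have "\<dots> = of_nat (card {g \<in> SG N. ap g \<in> near_class N lam i}) * (gen_char N \<rho> l lam i * of_nat (num_SYT \<rho>) / fact N)"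
    by (simp add: sum.inter_filter[symmetric] del: fact_Suc)
  also have "card {g \<in> SG N. ap g \<in> near_class N lam i} = card (near_class N lam i)"
  proof (rule bij_betw_same_card[of ap])
    show "bij_betw ap {g \<in> SG N. ap g \<in> near_class N lam i} (near_class N lam i)"
      by (rule bij_betw_byWitness[where f' = Sp])
        (auto simp: near_class_def ap_inverse ap_Sp' Sp_SG)
  qed
  finally have "a * (of_nat (num_SYT (dec_part l \<rho>)) * of_nat (num_SYT \<rho>) / fact N) =
      of_nat (card (near_class N lam i)) * (gen_char N \<rho> l lam i * of_nat (num_SYT \<rho>) / fact N)"
    by (simp only: a tau_smult tau_Gam[OF j])
  then have "a = of_nat (card (near_class N lam i)) * gen_char N \<rho> l lam i / of_nat (num_SYT (dec_part l \<rho>))"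
    using nz by (simp add: field_simps del: fact_Suc)
  then show ?thesis using a by simp
qed

lemma Z1_mult: "Z1 x \<Longrightarrow> Z1 y \<Longrightarrow> Z1 (x * y)"
  unfolding Z1_def by (simp add: mult.assoc) (simp add: mult.assoc[symmetric])

end

theorem theorem3p7:
  fixes n :: nat and lam \<mu> \<nu> :: "nat multiset" and i j k :: nat
  assumes "is_partition n lam" and "is_partition n \<mu>" and "is_partition n \<nu>"
    and "i \<in># lam" and "j \<in># \<mu>" and "k \<in># \<nu>"
  shows "galg_mult n (K_elem n lam i) (K_elem n \<mu> j) = K_comb n (conn_coeff n lam i \<mu> j) \<and>
    conn_coeff n lam i \<mu> j \<nu> k =
      of_nat (card (near_class n lam i)) * of_nat (card (near_class n \<mu> j)) / fact n *
      (\<Sum>(\<rho>, l) \<in> marked_partitions n.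
         gen_char n \<rho> l lam i * gen_char n \<rho> l \<mu> j * gen_char n \<rho> l \<nu> k
           / of_nat (num_SYT (dec_part l \<rho>))
         * (of_nat (num_SYT \<rho>) / of_nat (num_SYT (dec_part l \<rho>))))"
proof -
  \<comment> \<open>A partition of 0 has no part to mark. The centralizer results are stated for n =
    m + 1.\<close>
  have "n \<noteq> 0"
  proof
    assume "n = 0"
    then have "lam = {#}" using assms(1) by (cases lam) (auto simp: is_partition_def)
    then show False using assms(4) by simp
  qed
  then obtain m where n: "n = Suc m" by (cases n) auto
  let ?K = "K_elem n lam i" and ?K' = "K_elem n \<mu> j"
  let ?g = "galg_mult n ?K ?K'"
  let ?d = "\<lambda>\<rho> l. of_nat (num_SYT (dec_part l \<rho>)) :: complex"
  have Z: "Z1 m (emb n ?g)"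
    unfolding emb_mult n by (intro Z1_mult Z1_K_elem)
  note co = K_coeff_Z1[of m ?g, folded n, OF supp_galg_mult Z]
  have "(\<nu>, k) \<in> marked_partitions n" using assms by (simp add: marked_partitions_def)
  then obtain p where p: "p \<in> near_class n \<nu> k" using near_class_nonempty by blast
  have pS: "Sp p \<in> SG n" "ap (Sp p) = p" using p Sp_SG ap_Sp'[of p n] by (auto simp: near_class_def)
  define a where "a \<rho> l = of_nat (card (near_class n lam i)) * gen_char n \<rho> l lam i / ?d \<rho> l" for \<rho> l
  define b where "b \<rho> l = of_nat (card (near_class n \<mu> j)) * gen_char n \<rho> l \<mu> j / ?d \<rho> l" for \<rho> l
  have KG: "emb n ?K * Gam m \<rho> l = smult (a \<rho> l) (Gam m \<rho> l)"
    "emb n ?K' * Gam m \<rho> l = smult (b \<rho> l) (Gam m \<rho> l)" if "(\<rho>, l) \<in> marked_partitions n" for \<rho> l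
    unfolding a_def b_def n by (rule K_elem_Gam, use that n in simp)+
  have "emb n ?g = emb n ?K * emb n ?K' * (\<Sum>(\<rho>, l)\<in>marked_partitions n. Gam m \<rho> l)"
    using sum_Gam[of m] by (simp add: emb_mult n)
  also have "\<dots> = (\<Sum>(\<rho>, l)\<in>marked_partitions n. emb n ?K * (emb n ?K' * Gam m \<rho> l))"
    by (simp add: sum_distrib_left case_prod_unfold mult.assoc)
  also have "\<dots> = (\<Sum>(\<rho>, l)\<in>marked_partitions n. smult (a \<rho> l * b \<rho> l) (Gam m \<rho> l))"
    by (intro sum.cong) (auto simp: KG smult_simps mult.commute)
  finally have eg: "emb n ?g = (\<Sum>(\<rho>, l)\<in>marked_partitions n. smult (a \<rho> l * b \<rho> l) (Gam m \<rho> l))" .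
  have "conn_coeff n lam i \<mu> j \<nu> k = ?g p" unfolding conn_coeff_def by (rule co(2)[OF p])
  also have "\<dots> = Poly_Mapping.lookup (emb n ?g) (Sp p)" using pS by (simp add: lookup_emb)
  also have "\<dots> = (\<Sum>(\<rho>, l)\<in>marked_partitions n. a \<rho> l * b \<rho> l * Gamma_elem n \<rho> l p)"
    unfolding eg lookup_sum using pS
    by (intro sum.cong) (auto simp: emb_Gamma[of m, symmetric] n[symmetric] lookup_emb)
  \<comment> \<open>\<open>a\<close> and \<open>b\<close> each carry one factor 1 / d of
    \<open>dec_part l \<rho>\<close>; the factor d_rho / n! arises from undoing the normalization in
    \<open>gen_char\<close> for the third class.\<close>
  also have "\<dots> = (\<Sum>(\<rho>, l)\<in>marked_partitions n. a \<rho> l * b \<rho> l * (gen_char n \<rho> l \<nu> k * of_nat (num_SYT \<rho>) / fact n))"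
    using gen_char_eval[of _ _ m p \<nu> k, folded n] p by (intro sum.cong) auto
  also have "\<dots> = of_nat (card (near_class n lam i)) * of_nat (card (near_class n \<mu> j)) / fact n *
      (\<Sum>(\<rho>, l) \<in> marked_partitions n.
         gen_char n \<rho> l lam i * gen_char n \<rho> l \<mu> j * gen_char n \<rho> l \<nu> k
           / of_nat (num_SYT (dec_part l \<rho>))
         * (of_nat (num_SYT \<rho>) / of_nat (num_SYT (dec_part l \<rho>))))"
    unfolding sum_distrib_left by (intro sum.cong) (auto simp: a_def b_def)
  finally show ?thesis using co(1) unfolding conn_coeff_def by (intro conjI) simp_all
qed

end
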